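(* Suppose that $V\colon\mathbb{R}^3\to\mathbb{R}$ satisfies, for some positive constants $C_1,C_2,C_3$: (i) $0<C_1\le V(x)\le C_2$ for all $x\in\mathbb{R}^3$; (ii) $V\in C^1(\mathbb{R}^3,\mathbb{R})$; (iii) $0\le (\nabla V(x)\mid x)\le C_3$ for all $x\in\mathbb{R}^3$, where $(\cdot\mid\cdot)$ is the Euclidean scalar product of $\mathbb{R}^3$. Let $(u,\phi)\in H^1(\mathbb{R}^3)\times\mathcal{D}^{1,2}(\mathbb{R}^3)$ be a solution of the system $$ \begin{cases} -\Delta u + V(x) u + \phi u = u^5 & \text{in } \mathbb{R}^3,\\ -\Delta \phi = u^2 & \text{in } \mathbb{R}^3. \end{cases} $$ Then $u=\phi=0$.
   Context: $\mathcal{D}^{1,2}(\mathbb{R}^3)$ is the completion of $C_0^\infty(\mathbb{R}^3)$ with respect to the norm $\left(\int_{\mathbb{R}^3}|\nabla u|^2\right)^{1/2}$. Functions are real valued, and solutions in $H^1(\mathbb{R}^3)\times\mathcal{D}^{1,2}(\mathbb{R}^3)$ are understood in the weak sense. *)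

theory Defs
  imports "HOL-Analysis.Analysis"
begin

type_synonym R3 = "real^3"

definition grad :: "('a::euclidean_space \<Rightarrow> real) \<Rightarrow> 'a \<Rightarrow> 'a" where
  "grad f x = (\<Sum>b\<in>Basis. frechet_derivative f (at x) b *\<^sub>R b)"

lemma GDERIV_grad:
  assumes "f differentiable at x"
  shows "GDERIV f x :> grad f x"
proof -
  have D: "(f has_derivative frechet_derivative f (at x)) (at x)"
    using assms by (simp add: frechet_derivative_works)
  interpret linear "frechet_derivative f (at x)"
    using D by (rule has_derivative_linear)
  have "frechet_derivative f (at x) h = h \<bullet> grad f x" for h
  proof -
    have "frechet_derivative f (at x) h = frechet_derivative f (at x) (\<Sum>b\<in>Basis. (h \<bullet> b) *\<^sub>R b)"
      by (simp add: euclidean_representation)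
    also have "\<dots> = (\<Sum>b\<in>Basis. (h \<bullet> b) * frechet_derivative f (at x) b)"
      by (simp add: sum scaleR)
    also have "\<dots> = h \<bullet> grad f x"
      by (simp add: grad_def inner_sum_right mult.commute)
    finally show ?thesis .
  qed
  then have "frechet_derivative f (at x) = (\<lambda>h. h \<bullet> grad f x)" by blast
  with D show ?thesis by (simp add: gderiv_def)
qed

fun Ck :: "nat \<Rightarrow> ('a::euclidean_space \<Rightarrow> real) \<Rightarrow> bool" where
  "Ck 0 f \<longleftrightarrow> continuous_on UNIV f"
| "Ck (Suc k) f \<longleftrightarrow>
     (\<forall>x. f differentiable at x) \<and> (\<forall>b\<in>Basis. Ck k (\<lambda>x. grad f x \<bullet> b))"

definition test_function :: "(R3 \<Rightarrow> real) \<Rightarrow> bool" where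
  "test_function f \<longleftrightarrow> (\<forall>k. Ck k f) \<and> compact (closure {x. f x \<noteq> 0})"

text \<open>
  Elements of \<open>L\<^sup>p\<close> and of the Sobolev spaces below are represented by functions defined
  everywhere; equality in these spaces is equality almost everywhere.
\<close>

definition Lp :: "nat \<Rightarrow> (R3 \<Rightarrow> 'b::euclidean_space) set" where
  "Lp p = {f. f \<in> borel_measurable lebesgue \<and> integrable lebesgue (\<lambda>x. norm (f x) ^ p)}"

definition locally_integrable :: "(R3 \<Rightarrow> 'b::euclidean_space) \<Rightarrow> bool" where
  "locally_integrable f \<longleftrightarrow> (\<forall>K. compact K \<longrightarrow> f absolutely_integrable_on K)"

definition has_weak_gradient :: "(R3 \<Rightarrow> real) \<Rightarrow> (R3 \<Rightarrow> R3) \<Rightarrow> bool" where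
  "has_weak_gradient u G \<longleftrightarrow> locally_integrable u \<and> locally_integrable G \<and>
     (\<forall>\<psi>. test_function \<psi> \<longrightarrow>
        (LINT x|lebesgue. u x *\<^sub>R grad \<psi> x) = - (LINT x|lebesgue. \<psi> x *\<^sub>R G x))"

definition H1 :: "(R3 \<Rightarrow> real) set" where
  "H1 = {u. u \<in> Lp 2 \<and> (\<exists>G. has_weak_gradient u G \<and> G \<in> Lp 2)}"

text \<open>
  The completion of the test functions with respect to the \<open>L\<^sup>2\<close> norm of the gradient is realised
  as a space of functions: by the Sobolev inequality a sequence of test functions that is Cauchy
  for this norm also converges in \<open>L\<^sup>6\<close>, and its \<open>L\<^sup>6\<close> limit determines its class in the completion.
\<close>

definition D12 :: "(R3 \<Rightarrow> real) set" where
  "D12 = {\<phi>. \<phi> \<in> Lp 6 \<and>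
     (\<exists>\<psi> G. (\<forall>n. test_function (\<psi> n)) \<and> G \<in> Lp 2 \<and>
        (\<lambda>n. LINT x|lebesgue. norm (grad (\<psi> n) x - G x) ^ 2) \<longlonglongrightarrow> 0 \<and>
        (\<lambda>n. LINT x|lebesgue. \<bar>\<psi> n x - \<phi> x\<bar> ^ 6) \<longlonglongrightarrow> 0)}"

text \<open>
  For \<open>u\<close> in \<open>H1\<close>, \<open>\<phi>\<close> in \<open>D12\<close> and bounded measurable \<open>V\<close>, all integrands below are integrable
  (as \<open>u\<close> lies in \<open>L\<^sup>2 \<inter> L\<^sup>6\<close>), and the weak gradients exist and are unique almost everywhere.
\<close>

definition weak_solution :: "(R3 \<Rightarrow> real) \<Rightarrow> (R3 \<Rightarrow> real) \<Rightarrow> (R3 \<Rightarrow> real) \<Rightarrow> bool" where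
  "weak_solution V u \<phi> \<longleftrightarrow>
     (\<exists>Gu G\<phi>. has_weak_gradient u Gu \<and> has_weak_gradient \<phi> G\<phi> \<and>
        (\<forall>\<psi>. test_function \<psi> \<longrightarrow>
           (LINT x|lebesgue. Gu x \<bullet> grad \<psi> x + V x * u x * \<psi> x + \<phi> x * u x * \<psi> x)
             = (LINT x|lebesgue. u x ^ 5 * \<psi> x)) \<and>
        (\<forall>\<psi>. test_function \<psi> \<longrightarrow>
           (LINT x|lebesgue. G\<phi> x \<bullet> grad \<psi> x) = (LINT x|lebesgue. u x ^ 2 * \<psi> x)))"

end

theory Submission
  imports Defs
begin

text \<open>
  The proof combines the energy identities of the system with a Pohozaev identity.  Testing the first equation with
  \<open>u\<close> and the second with \<open>\<phi>\<close> gives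
  \<open>\<integral>|\<nabla>u|\<^sup>2 + \<integral>V u\<^sup>2 + \<integral>\<phi> u\<^sup>2 = \<integral>u\<^sup>6\<close> and \<open>\<integral>|\<nabla>\<phi>|\<^sup>2 = \<integral>\<phi> u\<^sup>2\<close>, while testing with the generators
  \<open>x \<bullet> \<nabla>u\<close> and \<open>x \<bullet> \<nabla>\<phi>\<close> of the dilations gives
  \<open>1/2 \<integral>|\<nabla>u|\<^sup>2 + 3/2 \<integral>V u\<^sup>2 + 1/2 \<integral>u\<^sup>2 (\<nabla>V \<bullet> x) + 5/4 \<integral>\<phi> u\<^sup>2 = 1/2 \<integral>u\<^sup>6\<close>.
  The exponent \<open>6\<close> is critical: half of the first identity, subtracted from the last, removes both the gradient of \<open>u\<close>
  and \<open>\<integral>u\<^sup>6\<close>, and leaves \<open>\<integral>V u\<^sup>2 + 1/2 \<integral>u\<^sup>2 (\<nabla>V \<bullet> x) + 3/4 \<integral>|\<nabla>\<phi>|\<^sup>2 = 0\<close>.  All terms are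
  nonnegative and \<open>V\<close> is bounded below by a positive constant; hence \<open>u = 0\<close> and \<open>\<nabla>\<phi> = 0\<close>, and the Sobolev
  inequality gives \<open>\<phi> = 0\<close>.
  
  The difficulty is that \<open>x \<bullet> \<nabla>u\<close> is not an admissible test function for a weak solution.  The identity
  \<open>stress_energy\<close> shows that for \<open>-\<Delta>v = f\<close> it may be used nevertheless, after multiplication of \<open>x\<close> by a cutoff, as
  soon as \<open>\<nabla>v\<close> and \<open>f\<close> are square integrable: mollifying \<open>v\<close> makes the identity classical, and it contains no
  second derivatives of \<open>v\<close>, so it survives in the limit.  For \<open>\<phi>\<close> one has \<open>f = u\<^sup>2\<close>, which is in \<open>L\<^sup>2\<close> by the Sobolev
  inequality.  For \<open>u\<close> one has \<open>f = u\<^sup>5 - V u - \<phi> u\<close>, and \<open>u\<^sup>5\<close> is in \<open>L\<^sup>2\<close> because one step of the Brezis-Kato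
  iteration, \<open>brezis_kato\<close>, improves the integrability of \<open>u\<close> from \<open>L\<^sup>6\<close> to \<open>L\<^sup>1\<^sup>2\<close>.  The nonlinear terms are then
  integrated by parts against the cutoff field (\<open>pohozaev_field\<close>), and the cutoff is removed by dominated convergence
  (\<open>pohozaev\<close>).
  
  The tools are built from one smooth bump function: mollifiers and their convergence in \<open>L\<^sup>1\<close> and \<open>L\<^sup>2\<close>; the density of
  test functions in \<open>H\<^sup>1\<close>, in the form of the predicate \<open>sobolev_pair\<close>, which allows the first equation to be tested
  with any function in \<open>H\<^sup>1\<close>; and the Sobolev inequality, which follows from the Loomis-Whitney inequality.  Functions
  are Borel measurable throughout; at the end the Lebesgue measurable functions of the theorem are replaced by Borel
  representatives.
\<close>
section \<open>Functions of class \<open>C\<^sup>k\<close>\<close>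

lemma grad_has_derivative:
  assumes "f differentiable at x"
  shows "(f has_derivative (\<lambda>h. h \<bullet> grad f x)) (at x)"
  using GDERIV_grad[OF assms] by (simp add: gderiv_def)

lemma gradI:
  assumes "(f has_derivative (\<lambda>h. h \<bullet> g)) (at x)"
  shows "grad f x = g"
proof -
  have "f differentiable at x" using assms by (auto simp: differentiable_def)
  from has_derivative_unique[OF grad_has_derivative[OF this] assms]
  have "\<And>h. h \<bullet> grad f x = h \<bullet> g" by meson
  then show ?thesis by (metis vector_eq_rdot inner_commute)
qed

text \<open>
  Every closure property of \<open>C\<^sup>k\<close> below is an induction on \<open>k\<close> that exhibits a gradient and
  shows that its components lie in the class one step down.
\<close>

lemma Ck_SucI:
  assumes "\<And>x. (f has_derivative (\<lambda>h. h \<bullet> g x)) (at x)"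
    and "\<And>b. b \<in> Basis \<Longrightarrow> Ck k (\<lambda>x. g x \<bullet> b)"
  shows "Ck (Suc k) f"
proof -
  have "\<And>x. f differentiable at x" using assms(1) by (auto simp: differentiable_def)
  moreover have "grad f = g" using gradI[OF assms(1)] by blast
  ultimately show ?thesis using assms(2) by simp
qed

lemma Ck_SucD: "Ck (Suc k) f \<Longrightarrow> Ck k f"
proof (induction k arbitrary: f)
  case 0 then show ?case
    by (auto intro!: continuous_at_imp_continuous_on differentiable_imp_continuous_within)
next
  case (Suc k) then show ?case by (metis Ck.simps(2))
qed

lemma Ck_has_derivative: "Ck (Suc k) f \<Longrightarrow> (f has_derivative (\<lambda>h. h \<bullet> grad f x)) (at x)"
  by (simp add: grad_has_derivative)

lemma Ck_const: "Ck k (\<lambda>x. c)"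
proof (induction k arbitrary: c)
  case (Suc k) show ?case by (rule Ck_SucI[where g="\<lambda>_. 0"]) (simp_all add: Suc)
qed simp

lemma Ck_inner_const: "Ck k (\<lambda>x. x \<bullet> a)"
proof (cases k)
  case 0 then show ?thesis by (auto intro!: continuous_intros)
next
  case (Suc j)
  have "((\<lambda>x. x \<bullet> a) has_derivative (\<lambda>h. h \<bullet> a)) (at x)" for x
    by (auto intro!: derivative_eq_intros)
  then show ?thesis unfolding Suc by (intro Ck_SucI[where g="\<lambda>_. a"] Ck_const)
qed

lemma Ck_add: "Ck k f \<Longrightarrow> Ck k g \<Longrightarrow> Ck k (\<lambda>x. f x + g x)"
proof (induction k arbitrary: f g)
  case 0 then show ?case by (simp add: continuous_on_add)
next
  case (Suc k)
  show ?case
  proof (rule Ck_SucI[where g="\<lambda>x. grad f x + grad g x"])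
    show "((\<lambda>x. f x + g x) has_derivative (\<lambda>h. h \<bullet> (grad f x + grad g x))) (at x)" for x
      using has_derivative_add[OF Ck_has_derivative[OF Suc.prems(1)] Ck_has_derivative[OF Suc.prems(2)]]
      by (simp add: inner_add_right)
  qed (use Suc in \<open>simp add: inner_add_left\<close>)
qed

lemma Ck_mult: "Ck k f \<Longrightarrow> Ck k g \<Longrightarrow> Ck k (\<lambda>x. f x * g x)"
proof (induction k arbitrary: f g)
  case 0 then show ?case by (simp add: continuous_on_mult)
next
  case (Suc k)
  show ?case
  proof (rule Ck_SucI[where g="\<lambda>x. f x *\<^sub>R grad g x + g x *\<^sub>R grad f x"])
    show "((\<lambda>x. f x * g x) has_derivative (\<lambda>h. h \<bullet> (f x *\<^sub>R grad g x + g x *\<^sub>R grad f x))) (at x)" for x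
      using has_derivative_mult[OF Ck_has_derivative[OF Suc.prems(1)] Ck_has_derivative[OF Suc.prems(2)]]
      by (simp add: inner_add_right algebra_simps)
    show "Ck k (\<lambda>x. (f x *\<^sub>R grad g x + g x *\<^sub>R grad f x) \<bullet> b)" if "b \<in> Basis" for b
      unfolding inner_add_left inner_scaleR_left using that Suc.prems
        Suc.prems[THEN Ck_SucD]
      by (intro Ck_add Suc.IH) auto
  qed
qed

lemma Ck_cmult: "Ck k f \<Longrightarrow> Ck k (\<lambda>x. c * f x)"
  by (intro Ck_mult Ck_const)

lemma Ck_uminus: "Ck k f \<Longrightarrow> Ck k (\<lambda>x. - f x)"
  using Ck_cmult[of k f "-1"] by simp

lemma Ck_diff: "Ck k f \<Longrightarrow> Ck k g \<Longrightarrow> Ck k (\<lambda>x. f x - g x)"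
  using Ck_add[OF _ Ck_uminus, of k f g] by simp

lemma Ck_power: "Ck k f \<Longrightarrow> Ck k (\<lambda>x. f x ^ n)"
  by (induction n) (simp_all add: Ck_const Ck_mult)

lemma Ck_sum: "(\<And>i. i \<in> I \<Longrightarrow> Ck k (f i)) \<Longrightarrow> Ck k (\<lambda>x. \<Sum>i\<in>I. f i x)"
  by (induction I rule: infinite_finite_induct) (simp_all add: Ck_const Ck_add)

lemma Ck_inner_self: "Ck k (\<lambda>x. x \<bullet> x)"
  by (subst euclidean_inner) (intro Ck_sum Ck_mult Ck_inner_const)

lemma has_derivative_real_grad:
  fixes h :: "real \<Rightarrow> real"
  assumes "h differentiable at x"
  shows "(h has_real_derivative grad h x) (at x)"
  using grad_has_derivative[OF assms] by (simp add: has_field_derivative_def mult_commute_abs)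

lemma grad_real: "(h has_real_derivative d) (at x) \<Longrightarrow> grad h x = d"
  by (rule gradI) (simp add: has_field_derivative_def mult_commute_abs)

lemma has_derivative_compose_grad:
  fixes h :: "real \<Rightarrow> real"
  assumes "f differentiable at x" "(h has_real_derivative d) (at (f x))"
  shows "((\<lambda>x. h (f x)) has_derivative (\<lambda>y. y \<bullet> (d *\<^sub>R grad f x))) (at x)"
  using diff_chain_at[OF grad_has_derivative[OF assms(1)] assms(2)[unfolded has_field_derivative_def]]
  by (simp add: o_def)

lemma Ck_compose:
  fixes h :: "real \<Rightarrow> real"
  shows "Ck k h \<Longrightarrow> Ck k f \<Longrightarrow> Ck k (\<lambda>x. h (f x))"
proof (induction k arbitrary: h f)
  case 0 then show ?case by (auto intro: continuous_on_compose2)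
next
  case (Suc k)
  show ?case
  proof (rule Ck_SucI[where g="\<lambda>x. grad h (f x) *\<^sub>R grad f x"])
    show "((\<lambda>x. h (f x)) has_derivative (\<lambda>y. y \<bullet> (grad h (f x) *\<^sub>R grad f x))) (at x)" for x
      using Suc.prems by (intro has_derivative_compose_grad has_derivative_real_grad) auto
    show "Ck k (\<lambda>x. (grad h (f x) *\<^sub>R grad f x) \<bullet> b)" if "b \<in> Basis" for b
      unfolding inner_scaleR_left using that Suc.prems Ck_SucD[OF Suc.prems(2)]
      by (intro Ck_mult Suc.IH[of "grad h" f]) auto
  qed
qed

text \<open>
  The derivative of \<open>1/f\<close> is \<open>- (1/f) (1/f) \<nabla>f\<close>, in which only \<open>1/f\<close> itself occurs besides the gradient
  of \<open>f\<close>, so the induction hypothesis covers it.  The same works for \<open>\<surd>f\<close>, with derivative \<open>\<nabla>f / (2 \<surd>f)\<close>.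
\<close>

lemma Ck_inverse: "(\<And>x. f x \<noteq> 0) \<Longrightarrow> Ck k f \<Longrightarrow> Ck k (\<lambda>x. inverse (f x))"
proof (induction k)
  case 0 then show ?case by (simp add: continuous_on_inverse)
next
  case (Suc k)
  have I: "Ck k (\<lambda>x. inverse (f x))" using Suc.prems Ck_SucD by (intro Suc.IH) blast+
  show ?case
  proof (rule Ck_SucI[where g="\<lambda>x. - (inverse (f x) * inverse (f x)) *\<^sub>R grad f x"])
    show "((\<lambda>x. inverse (f x)) has_derivative (\<lambda>y. y \<bullet> (- (inverse (f x) * inverse (f x)) *\<^sub>R grad f x))) (at x)" for x
      using Suc.prems by (intro has_derivative_compose_grad) (auto intro!: derivative_eq_intros)
    show "Ck k (\<lambda>x. (- (inverse (f x) * inverse (f x)) *\<^sub>R grad f x) \<bullet> b)" if "b \<in> Basis" for b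
      unfolding inner_scaleR_left using that Suc.prems I by (intro Ck_mult Ck_uminus) auto
  qed
qed

lemma Ck_sqrt: "(\<And>x. f x > 0) \<Longrightarrow> Ck k f \<Longrightarrow> Ck k (\<lambda>x. sqrt (f x))"
proof (induction k)
  case 0 then show ?case by (simp add: continuous_on_real_sqrt)
next
  case (Suc k)
  have "Ck k (\<lambda>x. sqrt (f x))" using Suc.prems Ck_SucD by (intro Suc.IH) blast+
  then have I: "Ck k (\<lambda>x. inverse (sqrt (f x)))" 
    by (intro Ck_inverse) (use Suc.prems(1) in \<open>auto simp: less_le\<close>)
  show ?case
  proof (rule Ck_SucI[where g="\<lambda>x. (inverse (sqrt (f x)) / 2) *\<^sub>R grad f x"])
    show "((\<lambda>x. sqrt (f x)) has_derivative (\<lambda>y. y \<bullet> ((inverse (sqrt (f x)) / 2) *\<^sub>R grad f x))) (at x)" for x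
      using Suc.prems by (intro has_derivative_compose_grad DERIV_real_sqrt) auto
    show "Ck k (\<lambda>x. ((inverse (sqrt (f x)) / 2) *\<^sub>R grad f x) \<bullet> b)" if "b \<in> Basis" for b
      unfolding inner_scaleR_left using that Suc.prems Ck_mult[OF Ck_const[of k "1/2"] I] by (intro Ck_mult) auto
  qed
qed

section \<open>A smooth bump function\<close>

text \<open>
  The functions \<open>p(1/t) exp(-1/t)\<close> extended by \<open>0\<close> to \<open>t \<le> 0\<close>.  Carrying the polynomial \<open>p\<close> along makes the
  family closed under differentiation, hence smooth.
\<close>

definition flat :: "real poly \<Rightarrow> real \<Rightarrow> real" where
  "flat p t = (if t \<le> 0 then 0 else poly p (1 / t) * exp (- (1 / t)))"

lemma poly_times_exp_minus_tendsto_0: "((\<lambda>s::real. poly p s * exp (- s)) \<longlongrightarrow> 0) at_top"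
proof -
  have "((\<lambda>s. \<Sum>i\<le>degree p. coeff p i * (s ^ i / exp s)) \<longlongrightarrow> (\<Sum>i\<le>degree p. coeff p i * 0)) at_top"
    by (intro tendsto_intros tendsto_power_div_exp_0)
  then show ?thesis
    by (simp add: poly_altdef sum_distrib_right exp_minus divide_inverse mult.assoc)
qed

lemma flat_has_derivative: "(flat p has_real_derivative flat ([:0, 0, 1:] * (p - pderiv p)) t) (at t)"
proof -
  consider "t < 0" | "t = 0" | "t > 0" by linarith
  then show ?thesis
  proof cases
    case 1
    have "(flat p has_real_derivative 0) (at t)"
      by (rule has_field_derivative_transform_within_open[where f="\<lambda>_. 0" and S="{..<0}"])
         (use 1 in \<open>auto simp: flat_def\<close>)
    then show ?thesis using 1 by (simp add: flat_def)
  next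
    case 3
    have "((\<lambda>t. poly p (1 / t) * exp (- (1 / t))) has_real_derivative flat ([:0, 0, 1:] * (p - pderiv p)) t) (at t)"
      using 3 by (auto intro!: derivative_eq_intros simp: flat_def power2_eq_square field_simps)
    then show ?thesis
      by (rule has_field_derivative_transform_within_open[where S="{0<..}"])
         (use 3 in \<open>auto simp: flat_def\<close>)
  next
    case 2
    have "((\<lambda>s. poly ([:0, 1:] * p) s * exp (- s)) \<longlongrightarrow> 0) at_top"
      by (rule poly_times_exp_minus_tendsto_0)
    then have "((\<lambda>h. poly ([:0, 1:] * p) (inverse h) * exp (- inverse h)) \<longlongrightarrow> 0) (at_right 0)"
      by (rule filterlim_compose[OF _ filterlim_inverse_at_top_right])
    moreover have "eventually (\<lambda>h. poly ([:0, 1:] * p) (inverse h) * exp (- inverse h) = flat p h / h) (at_right 0)"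
      unfolding eventually_at_right_field
      by (rule exI[of _ 1]) (auto simp: flat_def divide_inverse)
    ultimately have R: "((\<lambda>h. flat p h / h) \<longlongrightarrow> 0) (at_right 0)"
      by (rule Lim_transform_eventually)
    have "eventually (\<lambda>h. 0 = flat p h / h) (at_left 0)"
      unfolding eventually_at_left_field by (rule exI[of _ "-1"]) (auto simp: flat_def)
    with tendsto_const have "((\<lambda>h. flat p h / h) \<longlongrightarrow> 0) (at_left 0)"
      by (rule Lim_transform_eventually)
    with R have "((\<lambda>h. flat p h / h) \<longlongrightarrow> 0) (at 0)" by (simp add: filterlim_split_at)
    then show ?thesis using 2 by (simp add: DERIV_def flat_def)
  qed
qed

lemma Ck_flat: "Ck k (flat p)"
proof (induction k arbitrary: p)
  case 0
  show ?case using DERIV_isCont[OF flat_has_derivative] by (simp add: continuous_at_imp_continuous_on)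
next
  case (Suc k)
  show ?case
    by (rule Ck_SucI[where g="flat ([:0, 0, 1:] * (p - pderiv p))"])
       (use flat_has_derivative Suc in \<open>auto simp: has_field_derivative_def mult_commute_abs\<close>)
qed

definition bump :: "'a::euclidean_space \<Rightarrow> real" where
  "bump x = flat 1 (1 - x \<bullet> x)"

lemma Ck_bump: "Ck k bump"
  unfolding bump_def[abs_def]
  by (rule Ck_compose[where f="\<lambda>x. 1 - x \<bullet> x"]) (intro Ck_flat Ck_diff Ck_const Ck_inner_self)+

lemma bump_nonneg: "bump x \<ge> 0"
  by (simp add: bump_def flat_def)

lemma bump_0: "bump (0 :: 'a::euclidean_space) > 0"
  by (simp add: bump_def flat_def)

lemma bump_le_1: "bump x \<le> 1"
  by (simp add: bump_def flat_def)

lemma bump_eq_0: "norm x \<ge> 1 \<Longrightarrow> bump x = 0"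
  by (simp add: bump_def flat_def dot_square_norm abs_le_square_iff[of 1 "norm x", simplified])

section \<open>Bounded supports and integration by parts\<close>

text \<open>
  Vanishing outside a ball is easier to propagate than compactness of the closure of the support, and says
  the same.
\<close>

definition bounded_support :: "('a::real_normed_vector \<Rightarrow> 'b::zero) \<Rightarrow> bool" where
  "bounded_support f \<longleftrightarrow> (\<exists>r. \<forall>x. r \<le> norm x \<longrightarrow> f x = 0)"

definition C1c :: "('a::euclidean_space \<Rightarrow> real) \<Rightarrow> bool" where
  "C1c f \<longleftrightarrow> Ck 1 f \<and> bounded_support f"

lemma Ck_imp_continuous: "Ck k f \<Longrightarrow> continuous_on UNIV f"
  by (induction k) (simp, metis Ck_SucD)

lemma Ck_imp_continuous_grad:
  assumes "Ck (Suc k) f"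
  shows "continuous_on UNIV (grad f)"
  using assms Ck_imp_continuous
  by (subst continuous_on_componentwise) auto

lemma C1cD:
  assumes "C1c f"
  shows "Ck 1 f" "continuous_on UNIV f" "continuous_on UNIV (grad f)" "bounded_support f"
    "\<And>x. f differentiable at x" "\<And>x. (f has_derivative (\<lambda>h. h \<bullet> grad f x)) (at x)"
  using assms Ck_imp_continuous_grad[of 0 f] Ck_imp_continuous[of 1 f] Ck_has_derivative[of 0 f]
  by (simp_all add: C1c_def)

lemma bounded_support_grad:
  assumes "bounded_support f"
  shows "bounded_support (grad f)"
proof -
  obtain r where r: "\<And>x. r \<le> norm x \<Longrightarrow> f x = 0" using assms by (auto simp: bounded_support_def)
  have "grad f x = 0" if "r + 1 \<le> norm x" for x
  proof (rule gradI)
    have "((\<lambda>_. 0) has_derivative (\<lambda>h. h \<bullet> (0::'a))) (at x)" by simp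
    then show "(f has_derivative (\<lambda>h. h \<bullet> 0)) (at x)"
    proof (rule has_derivative_transform_within_open[where s="- cball 0 r"])
      show "open (- cball (0::'a) r)" by (simp add: open_Compl)
    qed (use that r in auto)
  qed
  then show ?thesis unfolding bounded_support_def by blast
qed

lemma bounded_support_mult1: "bounded_support f \<Longrightarrow> bounded_support (\<lambda>x. f x * (g x :: 'b::mult_zero))"
  and bounded_support_mult2: "bounded_support f \<Longrightarrow> bounded_support (\<lambda>x. (g x :: 'b::mult_zero) * f x)"
  by (fastforce simp: bounded_support_def)+

lemma bounded_support_add:
  "bounded_support f \<Longrightarrow> bounded_support g \<Longrightarrow> bounded_support (\<lambda>x. f x + g x :: 'b::monoid_add)"
  unfolding bounded_support_def by (metis add.right_neutral linear order_trans)

lemma bounded_support_inner1: "bounded_support f \<Longrightarrow> bounded_support (\<lambda>x. f x \<bullet> g x)"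
  unfolding bounded_support_def by (metis inner_zero_left)

lemma test_functionI: "(\<And>k. Ck k f) \<Longrightarrow> bounded_support f \<Longrightarrow> test_function f"
proof -
  assume *: "\<And>k. Ck k f" "bounded_support f"
  then obtain r where r: "\<And>x. r \<le> norm x \<Longrightarrow> f x = 0" by (auto simp: bounded_support_def)
  have "{x. f x \<noteq> 0} \<subseteq> cball 0 r" using r by force
  then have "bounded {x. f x \<noteq> 0}" using bounded_subset bounded_cball by blast
  then show "test_function f" using * by (simp add: test_function_def)
qed

lemma test_functionD:
  assumes "test_function f"
  shows "Ck k f" "bounded_support f" "C1c f"
proof -
  show 1: "Ck k f" for k using assms by (simp add: test_function_def)
  from assms have "bounded (closure {x. f x \<noteq> 0})" by (simp add: test_function_def compact_imp_bounded)
  then obtain r where "\<And>x. f x \<noteq> 0 \<Longrightarrow> norm x \<le> r"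
    using closure_subset[of "{x. f x \<noteq> 0}"] unfolding bounded_iff by blast
  then have "\<forall>x. r + 1 \<le> norm x \<longrightarrow> f x = 0" by (smt (verit))
  then show "bounded_support f" unfolding bounded_support_def by blast
  with 1 show "C1c f" by (simp only: C1c_def)
qed

lemma test_function_grad:
  assumes "test_function f" "b \<in> Basis"
  shows "test_function (\<lambda>x. grad f x \<bullet> b)"
proof (rule test_functionI)
  show "Ck k (\<lambda>x. grad f x \<bullet> b)" for k
    using test_functionD(1)[OF assms(1), of "Suc k"] assms(2) by simp
  show "bounded_support (\<lambda>x. grad f x \<bullet> b)"
    by (intro bounded_support_inner1 bounded_support_grad test_functionD(2) assms)
qed

lemma bounded_support_bound:
  fixes f :: "'a::euclidean_space \<Rightarrow> 'b::real_normed_vector"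
  assumes "continuous_on UNIV f" "bounded_support f"
  obtains K where "K > 0" "\<And>x. norm (f x) \<le> K"
proof -
  obtain r where r: "\<And>x. r \<le> norm x \<Longrightarrow> f x = 0"
    using assms(2) unfolding bounded_support_def by blast
  have "compact (f ` cball 0 r)"
    by (intro compact_continuous_image continuous_on_subset[OF assms(1)]) auto
  then obtain K where "K > 0" "\<And>y. y \<in> f ` cball 0 r \<Longrightarrow> norm y \<le> K"
    using compact_imp_bounded bounded_pos by metis
  moreover have "norm (f x) \<le> K" if "f x \<notin> f ` cball 0 r" for x
    using that r[of x] \<open>K > 0\<close> by (cases "norm x \<le> r") auto
  ultimately show ?thesis by (intro that[of K]) blast+
qed

lemma bounded_support_integrable:
  fixes f :: "'a::euclidean_space \<Rightarrow> 'b::euclidean_space"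
  assumes "continuous_on UNIV f" "bounded_support f"
  shows "integrable lborel f"
proof -
  obtain r where r: "\<And>x. r \<le> norm x \<Longrightarrow> f x = 0"
    using assms(2) unfolding bounded_support_def by blast
  have "integrable lborel (\<lambda>x. indicator (cball 0 r) x *\<^sub>R f x)"
    by (intro borel_integrable_compact continuous_on_subset[OF assms(1)]) auto
  moreover have "(\<lambda>x. indicator (cball 0 r) x *\<^sub>R f x) = f"
    using r by (force simp: indicator_def)
  ultimately show ?thesis by simp
qed

lemma lborel_integral_translation:
  fixes f :: "'a::euclidean_space \<Rightarrow> 'b::{banach,second_countable_topology}"
  assumes "integrable lborel f"
  shows "integrable lborel (\<lambda>x. f (x + a))" "(LBINT x. f (x + a)) = integral\<^sup>L lborel f"
proof -
  have d: "distr lborel borel (\<lambda>x. x + a) = (lborel :: 'a measure)"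
    using lborel_affine[of 1 a] by (simp add: density_1 add.commute)
  have [measurable]: "f \<in> borel_measurable borel" using borel_measurable_integrable[OF assms] by simp
  show "integrable lborel (\<lambda>x. f (x + a))"
    using assms by (subst (asm) d[symmetric]) (simp add: integrable_distr_eq)
  show "(LBINT x. f (x + a)) = integral\<^sup>L lborel f"
    by (subst (2) d[symmetric]) (simp add: integral_distr)
qed

lemma lipschitz_of_grad_bound:
  fixes f :: "'a::euclidean_space \<Rightarrow> real"
  assumes "\<And>x. f differentiable at x" "\<And>x. norm (grad f x) \<le> K"
  shows "\<bar>f y - f x\<bar> \<le> K * norm (y - x)"
proof -
  have "norm (f y - f x) \<le> K * norm (y - x)"
  proof (rule differentiable_bound[OF convex_UNIV])
    show "(f has_derivative (\<lambda>h. h \<bullet> grad f x)) (at x within UNIV)" for x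
      using grad_has_derivative[OF assms(1)] by simp
    show "onorm (\<lambda>h. h \<bullet> grad f x) \<le> K" for x
    proof (rule onorm_bound)
      show "0 \<le> K" using assms(2) norm_ge_zero order_trans by blast
      show "norm (h \<bullet> grad f x) \<le> K * norm h" for h
        using Cauchy_Schwarz_ineq2[of h "grad f x"] mult_left_mono[OF assms(2)[of x] norm_ge_zero[of h]]
        by (simp add: mult.commute)
    qed
  qed auto
  then show ?thesis by simp
qed

text \<open>
  Translation invariance gives \<open>\<integral> (f(x + tv) - f(x))/t dx = 0\<close> for every \<open>t\<close>.  The difference quotients are
  bounded by the Lipschitz constant of \<open>f\<close> and live in a fixed ball, so they may be integrated in the limit
  \<open>t \<rightarrow> 0\<close>.
\<close>

lemma integral_grad_eq_0:
  fixes f :: "'a::euclidean_space \<Rightarrow> real"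
  assumes "C1c f"
  shows "(LBINT x. grad f x \<bullet> v) = 0"
proof -
  note f = C1cD[OF assms]
  obtain r where r: "\<And>x. r \<le> norm x \<Longrightarrow> f x = 0" using f(4) by (auto simp: bounded_support_def)
  obtain K where K: "K > 0" "\<And>x. norm (grad f x) \<le> K"
    using bounded_support_bound[OF f(3) bounded_support_grad[OF f(4)]] by blast
  define t :: "nat \<Rightarrow> real" where "t n = inverse (real (Suc n))" for n
  have t: "t n > 0" "t n \<le> 1" for n by (auto simp: t_def field_simps)
  define D where "D n x = (f (x + t n *\<^sub>R v) - f x) / t n" for n x
  have int: "integrable lborel f" using bounded_support_integrable f by blast
  have D0: "integral\<^sup>L lborel (D n) = 0" for n
    unfolding D_def using lborel_integral_translation[OF int] int by simp
  have [measurable]: "f \<in> borel_measurable borel" "grad f \<in> borel_measurable borel"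
    using f borel_measurable_continuous_onI by blast+
  have "(\<lambda>n. integral\<^sup>L lborel (D n)) \<longlonglongrightarrow> (LBINT x. grad f x \<bullet> v)"
  proof (rule integral_dominated_convergence[where w="\<lambda>x. indicator (cball 0 (\<bar>r\<bar> + norm v)) x * (K * norm v)"])
    show "AE x in lborel. (\<lambda>n. D n x) \<longlonglongrightarrow> grad f x \<bullet> v"
    proof (intro AE_I2)
      fix x
      have "((\<lambda>s. f (x + s *\<^sub>R v)) has_derivative (\<lambda>s. (s *\<^sub>R v) \<bullet> grad f x)) (at 0)"
        by (rule has_derivative_compose[where f="\<lambda>s. x + s *\<^sub>R v" and g=f, simplified])
           (auto intro!: derivative_eq_intros f)
      then have "((\<lambda>s. f (x + s *\<^sub>R v)) has_field_derivative (grad f x \<bullet> v)) (at 0)"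
        by (simp add: has_field_derivative_def inner_commute mult_commute_abs)
      then have "((\<lambda>h. (f (x + h *\<^sub>R v) - f x) / h) \<longlongrightarrow> grad f x \<bullet> v) (at 0)"
        by (simp add: DERIV_def)
      moreover have "filterlim t (at 0) sequentially"
        unfolding filterlim_at using LIMSEQ_inverse_real_of_nat t
        by (auto simp: t_def[abs_def])
      ultimately show "(\<lambda>n. D n x) \<longlonglongrightarrow> grad f x \<bullet> v"
        unfolding D_def by (rule filterlim_compose)
    qed
    show "AE x in lborel. norm (D n x) \<le> indicator (cball 0 (\<bar>r\<bar> + norm v)) x * (K * norm v)" for n
    proof (intro AE_I2)
      fix x
      show "norm (D n x) \<le> indicator (cball 0 (\<bar>r\<bar> + norm v)) x * (K * norm v)"
      proof (cases "x \<in> cball 0 (\<bar>r\<bar> + norm v)")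
        case True
        have "\<bar>f (x + t n *\<^sub>R v) - f x\<bar> \<le> K * norm ((x + t n *\<^sub>R v) - x)"
          by (rule lipschitz_of_grad_bound[OF f(5) K(2)])
        then show ?thesis using True t[of n] by (simp add: D_def field_simps)
      next
        case False
        have "norm (t n *\<^sub>R v) \<le> norm v" using t[of n] by (simp add: mult_left_le_one_le)
        moreover have "\<bar>r\<bar> + norm v < norm x" using False by simp
        ultimately have "r \<le> norm (x + t n *\<^sub>R v)" "r \<le> norm x"
          using norm_diff_ineq[of x "t n *\<^sub>R v"] norm_ge_zero[of v] by linarith+
        then show ?thesis using False r by (simp add: D_def)
      qed
    qed
    have "integrable lborel (\<lambda>x::'a. indicator (cball 0 (\<bar>r\<bar> + norm v)) x :: real)"
      using integrable_real_indicator[OF _ emeasure_bounded_finite[OF bounded_cball]] by fastforce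
    then show "integrable lborel (\<lambda>x::'a. indicator (cball 0 (\<bar>r\<bar> + norm v)) x * (K * norm v) :: real)"
      by simp
  qed (auto simp: D_def[abs_def])
  then show ?thesis using D0 LIMSEQ_unique[OF _ tendsto_const] by force
qed

lemma grad_mult:
  assumes "f differentiable at x" "g differentiable at x"
  shows "grad (\<lambda>x. f x * g x) x = f x *\<^sub>R grad g x + g x *\<^sub>R grad f x"
  by (rule gradI)
     (use has_derivative_mult[OF grad_has_derivative[OF assms(1)] grad_has_derivative[OF assms(2)]]
      in \<open>simp add: inner_add_right algebra_simps\<close>)

lemma grad_diff:
  assumes "f differentiable at x" "g differentiable at x"
  shows "grad (\<lambda>x. f x - g x) x = grad f x - grad g x"
  by (rule gradI)
     (use has_derivative_diff[OF grad_has_derivative[OF assms(1)] grad_has_derivative[OF assms(2)]]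
      in \<open>simp add: inner_diff_right\<close>)

lemma grad_compose:
  fixes h :: "real \<Rightarrow> real"
  assumes "f differentiable at x" "h differentiable at (f x)"
  shows "grad (\<lambda>x. h (f x)) x = grad h (f x) *\<^sub>R grad f x"
  using assms by (intro gradI has_derivative_compose_grad has_derivative_real_grad)

lemma C1c_mult: "Ck 1 f \<Longrightarrow> C1c g \<Longrightarrow> C1c (\<lambda>x. f x * g x)"
  unfolding C1c_def by (blast intro: Ck_mult bounded_support_mult2)

lemma C1c_add: "C1c f \<Longrightarrow> C1c g \<Longrightarrow> C1c (\<lambda>x. f x + g x)"
  unfolding C1c_def by (blast intro: Ck_add bounded_support_add)

lemma integral_by_parts:
  fixes f g :: "'a::euclidean_space \<Rightarrow> real"
  assumes f: "Ck 1 f" and g: "C1c g"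
  shows "(LBINT x. (grad f x \<bullet> v) * g x) = - (LBINT x. f x * (grad g x \<bullet> v))"
proof -
  have cf: "continuous_on UNIV f" "continuous_on UNIV (grad f)" "\<And>x. f differentiable at x"
    using f Ck_imp_continuous[of 1 f] Ck_imp_continuous_grad[of 0 f] by simp_all
  note cg = C1cD[OF g]
  have 1: "integrable lborel (\<lambda>x. (grad f x \<bullet> v) * g x)"
    by (intro bounded_support_integrable bounded_support_mult2 continuous_intros cf cg)
  have 2: "integrable lborel (\<lambda>x. f x * (grad g x \<bullet> v))"
    by (intro bounded_support_integrable bounded_support_mult2 bounded_support_inner1 bounded_support_grad continuous_intros cf cg)
  have "0 = (LBINT x. grad (\<lambda>x. f x * g x) x \<bullet> v)"
    using integral_grad_eq_0[OF C1c_mult[OF f g]] by simp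
  also have "\<dots> = (LBINT x. (grad f x \<bullet> v) * g x + f x * (grad g x \<bullet> v))"
    using cf(3) cg(5) by (simp add: grad_mult inner_add_left algebra_simps)
  also have "\<dots> = (LBINT x. (grad f x \<bullet> v) * g x) + (LBINT x. f x * (grad g x \<bullet> v))"
    using 1 2 by simp
  finally show ?thesis by simp
qed

section \<open>Convolution and mollifiers\<close>

definition loc_int :: "('a::euclidean_space \<Rightarrow> real) \<Rightarrow> bool" where
  "loc_int f \<longleftrightarrow> f \<in> borel_measurable borel \<and>
     (\<forall>r. integrable lborel (\<lambda>x. indicator (cball 0 r) x * f x))"

definition conv :: "('a::euclidean_space \<Rightarrow> real) \<Rightarrow> ('a \<Rightarrow> real) \<Rightarrow> 'a \<Rightarrow> real" where
  "conv \<rho> f x = (LBINT y. \<rho> (x - y) * f y)"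

lemma integrable_imp_loc_int: "integrable lborel f \<Longrightarrow> loc_int f"
  using borel_measurable_integrable[of lborel f]
  by (auto simp: loc_int_def intro!: integrable_mult_indicator[where 'b=real, simplified])

lemma loc_int_integrable_mult:
  assumes f: "loc_int f" and k: "continuous_on UNIV k" "bounded_support k"
  shows "integrable lborel (\<lambda>y. k y * f y)"
proof -
  obtain r where r: "\<And>x. r \<le> norm x \<Longrightarrow> k x = 0" using k(2) unfolding bounded_support_def by blast
  obtain K where K: "\<And>x. norm (k x) \<le> K" using bounded_support_bound[OF k] by metis
  have [measurable]: "f \<in> borel_measurable borel" "k \<in> borel_measurable borel"
    using f k borel_measurable_continuous_onI by (auto simp: loc_int_def)
  have "integrable lborel (\<lambda>x. indicator (cball 0 r) x * f x)" using f by (simp add: loc_int_def)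
  then have "integrable lborel (\<lambda>x. K * (indicator (cball 0 r) x * f x))" by simp
  then show ?thesis
  proof (rule Bochner_Integration.integrable_bound)
    show "AE x in lborel. norm (k x * f x) \<le> norm (K * (indicator (cball 0 r) x * f x))"
    proof (intro AE_I2)
      fix x
      have "\<bar>k x\<bar> \<le> \<bar>K\<bar>" using K[of x] by auto
      then have "\<bar>k x\<bar> * \<bar>f x\<bar> \<le> \<bar>K\<bar> * \<bar>f x\<bar>" by (intro mult_right_mono) auto
      then show "norm (k x * f x) \<le> norm (K * (indicator (cball 0 r) x * f x))"
        using r[of x] by (cases "norm x \<le> r") (auto simp: abs_mult)
    qed
  qed simp
qed

lemma reflected_kernel:
  fixes \<rho> :: "'a::euclidean_space \<Rightarrow> 'b::real_normed_vector"
  assumes "continuous_on UNIV \<rho>" "bounded_support \<rho>"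
  shows "continuous_on UNIV (\<lambda>y. \<rho> (x - y))" "bounded_support (\<lambda>y. \<rho> (x - y))"
proof -
  show "continuous_on UNIV (\<lambda>y. \<rho> (x - y))"
    by (rule continuous_on_compose2[OF assms(1)]) (auto intro!: continuous_intros)
  obtain r where r: "\<And>x. r \<le> norm x \<Longrightarrow> \<rho> x = 0" using assms(2) unfolding bounded_support_def by blast
  have "\<rho> (x - y) = 0" if "r + norm x \<le> norm y" for y
    using that norm_triangle_ineq2[of y x] by (intro r) (simp add: norm_minus_commute)
  then show "bounded_support (\<lambda>y. \<rho> (x - y))" unfolding bounded_support_def by blast
qed

lemma conv_integrable:
  assumes "loc_int f" "continuous_on UNIV \<rho>" "bounded_support \<rho>"
  shows "integrable lborel (\<lambda>y. \<rho> (x - y) * f y)"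
  using assms reflected_kernel by (intro loc_int_integrable_mult) auto

text \<open>
  Uniform continuity of the gradient makes the first order Taylor remainder small uniformly in the base
  point.  This uniformity is what allows differentiation under the integral sign in a convolution.
\<close>

lemma C1c_uniform_derivative:
  fixes \<rho> :: "'a::euclidean_space \<Rightarrow> real"
  assumes "C1c \<rho>" "e > 0"
  obtains d where "d > 0" "d \<le> 1" "\<And>z h. norm h < d \<Longrightarrow> \<bar>\<rho> (z + h) - \<rho> z - h \<bullet> grad \<rho> z\<bar> \<le> e * norm h"
proof -
  note r = C1cD[OF assms(1)]
  obtain R where R: "\<And>x. R \<le> norm x \<Longrightarrow> grad \<rho> x = 0"
    using bounded_support_grad[OF r(4)] unfolding bounded_support_def by blast
  have "uniformly_continuous_on (cball 0 (R + 2)) (grad \<rho>)"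
    by (intro compact_uniformly_continuous continuous_on_subset[OF r(3)]) auto
  then obtain d where d: "d > 0" "\<And>x y. x \<in> cball 0 (R + 2) \<Longrightarrow> y \<in> cball 0 (R + 2) \<Longrightarrow> dist y x < d \<Longrightarrow>
      dist (grad \<rho> y) (grad \<rho> x) < e"
    using assms(2) unfolding uniformly_continuous_on_def by metis
  have close: "norm (grad \<rho> (z + k) - grad \<rho> z) \<le> e" if "norm k < min d 1" for z k
  proof (cases "norm z \<le> R + 1")
    case True
    then have "norm (z + k) \<le> R + 2" using that norm_triangle_ineq[of z k] by linarith
    then show ?thesis using True that less_imp_le[OF d(2)[of z "z + k"]]
      by (simp add: dist_norm norm_minus_commute add.commute)
  next
    case False
    then have "R \<le> norm (z + k)" "R \<le> norm z" using that norm_diff_ineq[of z k] by linarith+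
    then show ?thesis using R assms(2) by simp
  qed
  show ?thesis
  proof (rule that[of "min d 1"])
    fix z h :: 'a assume h: "norm h < min d 1"
    have der: "((\<lambda>t. \<rho> (z + t *\<^sub>R h)) has_real_derivative h \<bullet> grad \<rho> (z + t *\<^sub>R h)) (at t)" for t
    proof -
      have "((\<lambda>t. \<rho> (z + t *\<^sub>R h)) has_derivative (\<lambda>s. (s *\<^sub>R h) \<bullet> grad \<rho> (z + t *\<^sub>R h))) (at t)"
        by (rule has_derivative_compose[where f="\<lambda>s. z + s *\<^sub>R h" and g=\<rho>, simplified])
           (auto intro!: derivative_eq_intros r)
      then show ?thesis by (simp add: has_field_derivative_def mult_commute_abs)
    qed
    obtain t where t: "0 < t" "t < 1" "\<rho> (z + h) - \<rho> z = h \<bullet> grad \<rho> (z + t *\<^sub>R h)"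
      using MVT2[of 0 1 "\<lambda>t. \<rho> (z + t *\<^sub>R h)" "\<lambda>t. h \<bullet> grad \<rho> (z + t *\<^sub>R h)"] der by auto
    have "norm (t *\<^sub>R h) \<le> norm h" using t by (simp add: mult_left_le_one_le)
    then have "norm (t *\<^sub>R h) < min d 1" using h by linarith
    then have "norm (grad \<rho> (z + t *\<^sub>R h) - grad \<rho> z) \<le> e" by (rule close)
    then have "\<bar>h \<bullet> (grad \<rho> (z + t *\<^sub>R h) - grad \<rho> z)\<bar> \<le> norm h * e"
      using Cauchy_Schwarz_ineq2 mult_left_mono norm_ge_zero order_trans by metis
    then show "\<bar>\<rho> (z + h) - \<rho> z - h \<bullet> grad \<rho> z\<bar> \<le> e * norm h"
      by (simp add: t(3) inner_diff_right mult.commute)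
  qed (use d in auto)
qed

text \<open>
  The Taylor remainder of \<open>\<rho>\<close> is at most \<open>\<epsilon>|h|\<close> everywhere if \<open>h\<close> is small, and only the values of \<open>f\<close> in a fixed ball are
  met for \<open>|h| \<le> 1\<close>; hence local integrability of \<open>f\<close> suffices.
\<close>

lemma conv_has_derivative:
  fixes \<rho> f :: "'a::euclidean_space \<Rightarrow> real"
  assumes \<rho>: "C1c \<rho>" and f: "loc_int f"
  shows "(conv \<rho> f has_derivative (\<lambda>h. h \<bullet> (\<Sum>b\<in>Basis. conv (\<lambda>z. grad \<rho> z \<bullet> b) f x *\<^sub>R b))) (at x)"
proof -
  note r = C1cD[OF \<rho>]
  obtain R where R: "\<And>x. R \<le> norm x \<Longrightarrow> \<rho> x = 0" "\<And>x. R \<le> norm x \<Longrightarrow> grad \<rho> x = 0"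
  proof -
    obtain R1 R2 where "\<And>x. R1 \<le> norm x \<Longrightarrow> \<rho> x = 0" "\<And>x. R2 \<le> norm x \<Longrightarrow> grad \<rho> x = 0"
      using r(4) bounded_support_grad[OF r(4)] unfolding bounded_support_def by blast
    then show ?thesis using that[of "max R1 R2"] by simp
  qed
  have intg: "integrable lborel (\<lambda>y. (grad \<rho> (x - y) \<bullet> h) * f y)" for h
    using conv_integrable[OF f, of "\<lambda>z. grad \<rho> z \<bullet> h"] r
    by (simp add: continuous_intros bounded_support_inner1 bounded_support_grad)
  have lin: "h \<bullet> (\<Sum>b\<in>Basis. conv (\<lambda>z. grad \<rho> z \<bullet> b) f x *\<^sub>R b) = (LBINT y. (grad \<rho> (x - y) \<bullet> h) * f y)" for h
  proof -
    have "(LBINT y. (grad \<rho> (x - y) \<bullet> h) * f y) = (LBINT y. (\<Sum>b\<in>Basis. (h \<bullet> b) * ((grad \<rho> (x - y) \<bullet> b) * f y)))"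
      by (subst euclidean_inner) (simp add: sum_distrib_left sum_distrib_right mult_ac)
    also have "\<dots> = (\<Sum>b\<in>Basis. (h \<bullet> b) * conv (\<lambda>z. grad \<rho> z \<bullet> b) f x)"
      using intg by (subst Bochner_Integration.integral_sum) (auto simp: conv_def)
    finally show ?thesis by (simp add: inner_sum_right mult.commute)
  qed
  define A where "A = (LBINT y. \<bar>indicator (cball 0 (norm x + \<bar>R\<bar> + 1)) y * f y\<bar>)"
  have iA: "integrable lborel (\<lambda>y. \<bar>indicator (cball 0 (norm x + \<bar>R\<bar> + 1)) y * f y\<bar>)"
    using f by (simp add: loc_int_def)
  have A0: "A \<ge> 0" by (simp add: A_def)
  show ?thesis
    unfolding has_derivative_at_alt
  proof (intro conjI allI impI)
    show "bounded_linear (\<lambda>h. h \<bullet> (\<Sum>b\<in>Basis. conv (\<lambda>z. grad \<rho> z \<bullet> b) f x *\<^sub>R b))"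
      by (rule bounded_linear_inner_left)
    fix e :: real assume e: "e > 0"
    then have "e / (A + 1) > 0" using A0 by simp
    from C1c_uniform_derivative[OF \<rho> this] obtain d where d: "d > 0" "d \<le> 1"
      "\<And>z h. norm h < d \<Longrightarrow> \<bar>\<rho> (z + h) - \<rho> z - h \<bullet> grad \<rho> z\<bar> \<le> e / (A + 1) * norm h" by metis
    show "\<exists>d>0. \<forall>y. norm (y - x) < d \<longrightarrow>
      norm (conv \<rho> f y - conv \<rho> f x - (y - x) \<bullet> (\<Sum>b\<in>Basis. conv (\<lambda>z. grad \<rho> z \<bullet> b) f x *\<^sub>R b)) \<le> e * norm (y - x)"
    proof (intro exI[of _ d] conjI d(1) allI impI)
      fix x' assume x': "norm (x' - x) < d"
      define h where "h = x' - x"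
      have hd: "norm h < d" using x' by (simp add: h_def)
      have "conv \<rho> f x' - conv \<rho> f x - h \<bullet> (\<Sum>b\<in>Basis. conv (\<lambda>z. grad \<rho> z \<bullet> b) f x *\<^sub>R b)
        = (LBINT y. \<rho> (x' - y) * f y - \<rho> (x - y) * f y - (grad \<rho> (x - y) \<bullet> h) * f y)"
        unfolding lin using conv_integrable[OF f r(2) r(4)] intg by (simp add: conv_def)
      also have "\<bar>\<dots>\<bar> \<le> (LBINT y. e / (A + 1) * norm h * \<bar>indicator (cball 0 (norm x + \<bar>R\<bar> + 1)) y * f y\<bar>)"
      proof (rule integral_abs_bound[THEN order_trans], rule integral_mono)
        show "integrable lborel (\<lambda>y. \<bar>\<rho> (x' - y) * f y - \<rho> (x - y) * f y - (grad \<rho> (x - y) \<bullet> h) * f y\<bar>)"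
          using conv_integrable[OF f r(2) r(4)] intg by simp
        show "integrable lborel (\<lambda>y. e / (A + 1) * norm h * \<bar>indicator (cball 0 (norm x + \<bar>R\<bar> + 1)) y * f y\<bar>)"
          using iA by simp
        fix y
        have eq: "\<rho> (x' - y) * f y - \<rho> (x - y) * f y - (grad \<rho> (x - y) \<bullet> h) * f y
            = (\<rho> ((x - y) + h) - \<rho> (x - y) - h \<bullet> grad \<rho> (x - y)) * f y"
          by (simp add: h_def algebra_simps inner_commute)
        show "\<bar>\<rho> (x' - y) * f y - \<rho> (x - y) * f y - (grad \<rho> (x - y) \<bullet> h) * f y\<bar>
          \<le> e / (A + 1) * norm h * \<bar>indicator (cball 0 (norm x + \<bar>R\<bar> + 1)) y * f y\<bar>"
        proof (cases "norm y \<le> norm x + \<bar>R\<bar> + 1")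
          case True
          have "\<bar>\<rho> ((x - y) + h) - \<rho> (x - y) - h \<bullet> grad \<rho> (x - y)\<bar> * \<bar>f y\<bar> \<le> e / (A + 1) * norm h * \<bar>f y\<bar>"
            by (intro mult_right_mono d(3) hd) simp
          then show ?thesis using True unfolding eq by (simp add: abs_mult)
        next
          case False
          then have "R \<le> norm (x - y)" using norm_triangle_ineq2[of y x] by (simp add: norm_minus_commute)
          moreover have "R \<le> norm ((x - y) + h)"
            using False norm_triangle_ineq2[of y x] norm_diff_ineq[of "x - y" h] hd d(2) by (simp add: norm_minus_commute)
          ultimately show ?thesis unfolding eq using R e A0 by simp
        qed
      qed
      also have "\<dots> = e / (A + 1) * norm h * A" by (simp add: A_def)
      also have "\<dots> \<le> e * norm h"
      proof -
        have "e * A \<le> e * (A + 1)" using e by simp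
        then have "e / (A + 1) * A \<le> e" using A0 by (simp add: field_simps)
        from mult_right_mono[OF this norm_ge_zero[of h]] show ?thesis by (simp add: mult_ac)
      qed
      finally show "norm (conv \<rho> f x' - conv \<rho> f x - (x' - x) \<bullet> (\<Sum>b\<in>Basis. conv (\<lambda>z. grad \<rho> z \<bullet> b) f x *\<^sub>R b)) \<le> e * norm (x' - x)"
        by (simp add: h_def)
    qed
  qed
qed

lemma grad_conv:
  assumes "C1c \<rho>" "loc_int f" "b \<in> Basis"
  shows "grad (conv \<rho> f) x \<bullet> b = conv (\<lambda>z. grad \<rho> z \<bullet> b) f x"
  using gradI[OF conv_has_derivative[OF assms(1,2)]] assms(3)
  by (simp add: inner_sum_left inner_Basis if_distrib sum.delta cong: if_cong)

text \<open>
  On \<open>\<real>\<^sup>3\<close> these are exactly the test functions.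
\<close>

definition smooth_kernel :: "('a::euclidean_space \<Rightarrow> real) \<Rightarrow> bool" where
  "smooth_kernel \<rho> \<longleftrightarrow> (\<forall>k. Ck k \<rho>) \<and> bounded_support \<rho>"

lemma smooth_kernel_C1c: "smooth_kernel \<rho> \<Longrightarrow> C1c \<rho>"
  unfolding smooth_kernel_def C1c_def by blast

lemma smooth_kernel_grad:
  assumes "smooth_kernel \<rho>" "b \<in> Basis"
  shows "smooth_kernel (\<lambda>x. grad \<rho> x \<bullet> b)"
  unfolding smooth_kernel_def
proof (intro conjI allI bounded_support_inner1 bounded_support_grad)
  show "Ck k (\<lambda>x. grad \<rho> x \<bullet> b)" for k
    using assms(1)[unfolded smooth_kernel_def, THEN conjunct1, rule_format, of "Suc k"] assms(2) by simp
qed (use assms in \<open>simp add: smooth_kernel_def\<close>)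

lemma Ck_conv:
  assumes "smooth_kernel \<rho>" "loc_int f"
  shows "Ck k (conv \<rho> f)"
  using assms(1)
proof (induction k arbitrary: \<rho>)
  case 0
  have "\<And>x. conv \<rho> f differentiable at x"
    using conv_has_derivative[OF smooth_kernel_C1c[OF 0] assms(2)] differentiable_def by blast
  then show ?case
    by (simp add: continuous_at_imp_continuous_on differentiable_imp_continuous_within)
next
  case (Suc k)
  have "\<And>x. conv \<rho> f differentiable at x"
    using conv_has_derivative[OF smooth_kernel_C1c[OF Suc.prems] assms(2)] differentiable_def by blast
  then show ?case
    using Suc.IH[OF smooth_kernel_grad[OF Suc.prems]]
      grad_conv[OF smooth_kernel_C1c[OF Suc.prems] assms(2)] by simp
qed

text \<open>
  The bump function rescaled to the ball of radius \<open>1/(n+1)\<close> and normalised by its own integral.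
\<close>

definition mollifier :: "nat \<Rightarrow> 'a::euclidean_space \<Rightarrow> real" where
  "mollifier n x = bump (real (Suc n) *\<^sub>R x) / (\<integral>y. bump (real (Suc n) *\<^sub>R y) \<partial>(lborel :: 'a measure))"

lemma bump_scaled_smooth_kernel: "smooth_kernel (\<lambda>x::'a::euclidean_space. bump (real (Suc n) *\<^sub>R x))"
proof -
  have "Ck k (\<lambda>x::'a. bump (real (Suc n) *\<^sub>R x))" for k
  proof -
    have eq: "(\<lambda>x::'a. bump (real (Suc n) *\<^sub>R x)) = (\<lambda>x. flat 1 (1 - (real (Suc n))\<^sup>2 * (x \<bullet> x)))"
      by (simp add: bump_def fun_eq_iff power2_eq_square mult.assoc)
    show ?thesis unfolding eq
      by (rule Ck_compose[where f="\<lambda>x. 1 - (real (Suc n))\<^sup>2 * (x \<bullet> x)"])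
         (intro Ck_flat Ck_diff Ck_const Ck_cmult Ck_inner_self)+
  qed
  moreover have "bump (real (Suc n) *\<^sub>R x) = 0" if "1 \<le> norm x" for x :: 'a
    using that mult_mono[of 1 "real (Suc n)" 1 "norm x"] by (intro bump_eq_0) auto
  ultimately show ?thesis unfolding smooth_kernel_def bounded_support_def by blast
qed

lemma bump_scaled_integral_pos: "(\<integral>y. bump (real (Suc n) *\<^sub>R y) \<partial>(lborel :: 'a::euclidean_space measure)) > 0"
proof -
  let ?f = "\<lambda>y::'a. bump (real (Suc n) *\<^sub>R y) :: real"
  note k = C1cD[OF smooth_kernel_C1c[OF bump_scaled_smooth_kernel[where 'a='a and n=n]]]
  have int: "integrable lborel ?f" using k bounded_support_integrable by blast
  have "integral\<^sup>L lborel ?f \<noteq> 0"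
  proof
    assume "integral\<^sup>L lborel ?f = 0"
    then have "AE x in lborel. ?f x = 0"
      using integral_nonneg_eq_0_iff_AE[OF int] bump_nonneg by auto
    moreover have o: "open {x. ?f x \<noteq> 0}"
      using k(2) by (intro open_Collect_neq) auto
    ultimately have "{x. ?f x \<noteq> 0} \<in> null_sets lborel"
      by (subst AE_iff_null_sets) (use borel_open[OF o] in simp, simp)
    moreover note o
    moreover have "0 \<in> {x. ?f x \<noteq> 0}" using bump_0[where 'a='a] by simp
    ultimately show False
      by (metis (no_types, lifting) empty_iff null_sets_completionI negligible_iff_null_sets open_not_negligible)
  qed
  moreover have "integral\<^sup>L lborel ?f \<ge> 0" using bump_nonneg by (intro integral_nonneg_AE) auto
  ultimately show ?thesis by simp
qed

lemma mollifier_smooth_kernel: "smooth_kernel (mollifier n)"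
proof -
  have "mollifier n = (\<lambda>x::'a. (1 / (\<integral>y. bump (real (Suc n) *\<^sub>R y) \<partial>(lborel :: 'a measure))) * bump (real (Suc n) *\<^sub>R x))"
    by (simp add: mollifier_def fun_eq_iff)
  moreover have "smooth_kernel (\<lambda>x::'a. c * bump (real (Suc n) *\<^sub>R x))" for c :: real
    using bump_scaled_smooth_kernel[where 'a='a and n=n] unfolding smooth_kernel_def
    by (intro conjI allI Ck_cmult bounded_support_mult2) auto
  ultimately show ?thesis by (simp only:)
qed

lemma mollifier_nonneg: "mollifier n x \<ge> 0"
  unfolding mollifier_def by (intro divide_nonneg_pos bump_nonneg bump_scaled_integral_pos)

lemma mollifier_integral: "integral\<^sup>L lborel (mollifier n) = 1"
  using bump_scaled_integral_pos[where 'a='a and n=n] by (simp add: mollifier_def[abs_def])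

lemma mollifier_eq_0: "1 \<le> real (Suc n) * norm x \<Longrightarrow> mollifier n x = 0"
  unfolding mollifier_def by (subst bump_eq_0) auto

lemma
  shows mollifier_continuous: "continuous_on UNIV (mollifier n)"
    and mollifier_support: "bounded_support (mollifier n)"
    and mollifier_integrable: "integrable lborel (mollifier n)"
  using C1cD[OF smooth_kernel_C1c[OF mollifier_smooth_kernel]] bounded_support_integrable by blast+

lemma conv_diff: 
  assumes "smooth_kernel \<rho>" "loc_int f" "loc_int g"
  shows "conv \<rho> (\<lambda>x. f x - g x) x = conv \<rho> f x - conv \<rho> g x"
  using conv_integrable[OF assms(2)] conv_integrable[OF assms(3)] C1cD[OF smooth_kernel_C1c[OF assms(1)]]
  by (simp add: conv_def right_diff_distrib)

lemma conv_borel_measurable: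
  assumes "smooth_kernel \<rho>" "loc_int f"
  shows "conv \<rho> f \<in> borel_measurable borel"
  using Ck_conv[OF assms, of 0] by (simp add: borel_measurable_continuous_onI)

lemma mollifier_borel [measurable]: "mollifier n \<in> borel_measurable borel"
  using mollifier_continuous by (rule borel_measurable_continuous_onI)

lemma lborel_reflect: "distr lborel borel (\<lambda>y. x - y) = (lborel :: 'a::euclidean_space measure)"
  using lborel_affine[of "-1" x] by (simp add: density_1)

lemma nn_integral_reflect:
  fixes g :: "'a::euclidean_space \<Rightarrow> ennreal"
  assumes [measurable]: "g \<in> borel_measurable borel"
  shows "(\<integral>\<^sup>+y. g (x - y) \<partial>lborel) = integral\<^sup>N lborel g"
  by (subst (2) lborel_reflect[of x, symmetric]) (simp add: nn_integral_distr)

lemma nn_integral_shift: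
  fixes g :: "'a::euclidean_space \<Rightarrow> ennreal"
  assumes [measurable]: "g \<in> borel_measurable borel"
  shows "(\<integral>\<^sup>+x. g (x - y) \<partial>lborel) = integral\<^sup>N lborel g"
proof -
  have d: "distr lborel borel (\<lambda>x. x - y) = (lborel :: 'a measure)"
    using lborel_affine[of 1 "-y"] by (simp add: density_1)
  show ?thesis by (subst (2) d[symmetric]) (simp add: nn_integral_distr)
qed

lemma mollifier_nn_integral: "(\<integral>\<^sup>+y. ennreal (mollifier n (x - y)) \<partial>lborel) = 1"
  "(\<integral>\<^sup>+x. ennreal (mollifier n (x - y)) \<partial>lborel) = 1"
proof -
  have *: "(\<integral>\<^sup>+y. ennreal (mollifier n y) \<partial>lborel) = 1"
    using nn_integral_eq_integral[OF mollifier_integrable] mollifier_nonneg mollifier_integral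
    by (metis (mono_tags, lifting) AE_I2 ennreal_1)
  show "(\<integral>\<^sup>+y. ennreal (mollifier n (x - y)) \<partial>lborel) = 1"
    using nn_integral_reflect[of "\<lambda>y. ennreal (mollifier n y)" x] * by simp
  show "(\<integral>\<^sup>+x. ennreal (mollifier n (x - y)) \<partial>lborel) = 1"
    using nn_integral_shift[of "\<lambda>y. ennreal (mollifier n y)" y] * by simp
qed

lemma conv_mollifier_bound:
  assumes f: "loc_int f"
  shows "ennreal \<bar>conv (mollifier n) f x\<bar> \<le> (\<integral>\<^sup>+y. ennreal (mollifier n (x - y)) * ennreal \<bar>f y\<bar> \<partial>lborel)"
proof -
  have "integrable lborel (\<lambda>y. mollifier n (x - y) * f y)"
    using conv_integrable[OF f] mollifier_continuous mollifier_support by blast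
  then have "ennreal \<bar>conv (mollifier n) f x\<bar> \<le> (\<integral>\<^sup>+y. ennreal \<bar>mollifier n (x - y) * f y\<bar> \<partial>lborel)"
    unfolding conv_def using integral_norm_bound_ennreal by force
  then show ?thesis by (simp add: abs_mult ennreal_mult abs_of_nonneg[OF mollifier_nonneg] mollifier_nonneg)
qed

lemma nn_integral_mollified:
  fixes g :: "'a::euclidean_space \<Rightarrow> ennreal"
  assumes [measurable]: "g \<in> borel_measurable borel"
  shows "(\<integral>\<^sup>+x. (\<integral>\<^sup>+y. ennreal (mollifier n (x - y)) * g y \<partial>lborel) \<partial>lborel) = integral\<^sup>N lborel g"
proof -
  have "(\<integral>\<^sup>+x. (\<integral>\<^sup>+y. ennreal (mollifier n (x - y)) * g y \<partial>lborel) \<partial>lborel) =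
    (\<integral>\<^sup>+y. (\<integral>\<^sup>+x. ennreal (mollifier n (x - y)) * g y \<partial>lborel) \<partial>lborel)"
    by (rule lborel_pair.Fubini') measurable
  also have "\<dots> = (\<integral>\<^sup>+y. (\<integral>\<^sup>+x. ennreal (mollifier n (x - y)) \<partial>lborel) * g y \<partial>lborel)"
    by (subst nn_integral_multc) measurable
  also have "\<dots> = integral\<^sup>N lborel g" by (simp add: mollifier_nn_integral)
  finally show ?thesis .
qed

lemma conv_mollifier_L1:
  assumes f: "loc_int f"
  shows "(\<integral>\<^sup>+x. ennreal \<bar>conv (mollifier n) f x\<bar> \<partial>lborel) \<le> (\<integral>\<^sup>+x. ennreal \<bar>f x\<bar> \<partial>lborel)"
proof -
  have [measurable]: "f \<in> borel_measurable borel" using f by (simp add: loc_int_def)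
  show ?thesis
    using nn_integral_mono[OF conv_mollifier_bound[OF f], where M=lborel]
    by (subst nn_integral_mollified[symmetric, where n=n]) auto
qed

text \<open>
  The Cauchy-Schwarz inequality for the probability density \<open>\<rho>(x - y) dy\<close> gives
  \<open>|\<rho> * f|\<^sup>2 \<le> \<rho> * |f|\<^sup>2\<close>; integrating in \<open>x\<close> first yields the claim.
\<close>

lemma conv_mollifier_L2:
  assumes f: "loc_int f"
  shows "(\<integral>\<^sup>+x. ennreal ((conv (mollifier n) f x)\<^sup>2) \<partial>lborel) \<le> (\<integral>\<^sup>+x. ennreal ((f x)\<^sup>2) \<partial>lborel)"
proof -
  have [measurable]: "f \<in> borel_measurable borel" using f by (simp add: loc_int_def)
  have "ennreal ((conv (mollifier n) f x)\<^sup>2) \<le> (\<integral>\<^sup>+y. ennreal (mollifier n (x - y)) * ennreal ((f y)\<^sup>2) \<partial>lborel)" for x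
  proof -
    have s: "ennreal (sqrt (mollifier n z)) * ennreal (sqrt (mollifier n z)) = ennreal (mollifier n z)" for z :: 'a
      using mollifier_nonneg[of n z] by (simp add: ennreal_mult[symmetric])
    have "ennreal ((conv (mollifier n) f x)\<^sup>2) = (ennreal \<bar>conv (mollifier n) f x\<bar>)\<^sup>2"
      by (simp add: ennreal_power)
    also have "\<dots> \<le> (\<integral>\<^sup>+y. ennreal (mollifier n (x - y)) * ennreal \<bar>f y\<bar> \<partial>lborel)\<^sup>2"
      by (intro power_mono conv_mollifier_bound f) simp
    also have "\<dots> = (\<integral>\<^sup>+y. ennreal (sqrt (mollifier n (x - y))) * (ennreal (sqrt (mollifier n (x - y))) * ennreal \<bar>f y\<bar>) \<partial>lborel)\<^sup>2"
      by (simp add: s mult.assoc[symmetric])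
    also have "\<dots> \<le> (\<integral>\<^sup>+y. (ennreal (sqrt (mollifier n (x - y))))\<^sup>2 \<partial>lborel) *
        (\<integral>\<^sup>+y. (ennreal (sqrt (mollifier n (x - y))) * ennreal \<bar>f y\<bar>)\<^sup>2 \<partial>lborel)"
      by (rule Cauchy_Schwarz_nn_integral) measurable
    also have "\<dots> = (\<integral>\<^sup>+y. ennreal (mollifier n (x - y)) * ennreal ((f y)\<^sup>2) \<partial>lborel)"
    proof -
      have 2: "(ennreal (sqrt (mollifier n z)))\<^sup>2 = ennreal (mollifier n z)" for z :: 'a
        by (simp add: power2_eq_square s)
      show ?thesis by (simp add: power_mult_distrib 2 mollifier_nn_integral ennreal_power)
    qed
    finally show ?thesis .
  qed
  then have "(\<integral>\<^sup>+x. ennreal ((conv (mollifier n) f x)\<^sup>2) \<partial>lborel) \<le>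
     (\<integral>\<^sup>+x. (\<integral>\<^sup>+y. ennreal (mollifier n (x - y)) * ennreal ((f y)\<^sup>2) \<partial>lborel) \<partial>lborel)"
    by (rule nn_integral_mono)
  then show ?thesis by (subst (asm) nn_integral_mollified) auto
qed

text \<open>
  A mollified function is an average of values at distance less than \<open>1/(n+1)\<close>.  Used with \<open>c = f(x)\<close> for
  convergence at points of continuity, and with large \<open>e\<close> for bounds.
\<close>

lemma conv_mollifier_pointwise:
  fixes f :: "'a::euclidean_space \<Rightarrow> real"
  assumes f: "loc_int f" and close: "\<And>y. real (Suc n) * norm (x - y) < 1 \<Longrightarrow> \<bar>f y - c\<bar> \<le> e"
  shows "\<bar>conv (mollifier n) f x - c\<bar> \<le> e"
proof -
  have i: "integrable lborel (\<lambda>y. mollifier n (x - y) * f y)"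
    using conv_integrable[OF f] mollifier_continuous mollifier_support by blast
  have "loc_int (\<lambda>_::'a. 1)"
    unfolding loc_int_def using emeasure_bounded_finite[OF bounded_cball]
    by (auto intro!: integrable_real_indicator)
  then have "integrable lborel (\<lambda>y. mollifier n (x - y) * 1)"
    using conv_integrable mollifier_continuous mollifier_support by blast
  then have i1: "integrable lborel (\<lambda>y. mollifier n (x - y))" by simp
  have I1: "(LBINT y. mollifier n (x - y)) = 1"
    using integral_eq_nn_integral[of "\<lambda>y. mollifier n (x - y)" lborel] mollifier_nn_integral(1)[of n x]
    by (simp add: mollifier_nonneg)
  have "conv (mollifier n) f x - c = (LBINT y. mollifier n (x - y) * f y - mollifier n (x - y) * c)"
    using i i1 I1 by (simp add: conv_def)
  also have "\<bar>\<dots>\<bar> \<le> (LBINT y. mollifier n (x - y) * e)"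
  proof (rule integral_abs_bound[THEN order_trans], rule integral_mono)
    fix y
    have eq: "mollifier n (x - y) * f y - mollifier n (x - y) * c = mollifier n (x - y) * (f y - c)"
      by (simp add: algebra_simps)
    show "\<bar>mollifier n (x - y) * f y - mollifier n (x - y) * c\<bar> \<le> mollifier n (x - y) * e"
    proof (cases "real (Suc n) * norm (x - y) < 1")
      case True
      then show ?thesis unfolding eq abs_mult using close[of y] mollifier_nonneg[of n "x - y"]
        by (simp add: mult_left_mono)
    next
      case False then show ?thesis unfolding eq using mollifier_eq_0[of n "x - y"] by simp
    qed
  qed (use i i1 in auto)
  also have "\<dots> = e" using I1 by simp
  finally show ?thesis .
qed

lemma loc_int_bounded:
  fixes f :: "'a::euclidean_space \<Rightarrow> real"
  assumes [measurable]: "f \<in> borel_measurable borel" and "\<And>x. \<bar>f x\<bar> \<le> K"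
  shows "loc_int f"
  unfolding loc_int_def
proof (intro conjI allI)
  fix r
  have "integrable lborel (\<lambda>x::'a. indicator (cball 0 r) x :: real)"
    using emeasure_bounded_finite[OF bounded_cball] by (intro integrable_real_indicator) auto
  then have "integrable lborel (\<lambda>x::'a. K * indicator (cball 0 r) x)" by simp
  then show "integrable lborel (\<lambda>x. indicator (cball 0 r) x * f x)"
    by (rule Bochner_Integration.integrable_bound) (use assms(2) in \<open>auto simp: indicator_def intro: order_trans[OF _ abs_ge_self]\<close>)
qed simp

lemma mollify_C0c_L1:
  fixes g :: "'a::euclidean_space \<Rightarrow> real"
  assumes g: "continuous_on UNIV g" "bounded_support g"
  shows "(\<lambda>n. LBINT x. \<bar>conv (mollifier n) g x - g x\<bar>) \<longlonglongrightarrow> 0"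
proof -
  obtain R where R: "\<And>x. R \<le> norm x \<Longrightarrow> g x = 0" using g(2) unfolding bounded_support_def by blast
  obtain K where K: "K > 0" "\<And>x. norm (g x) \<le> K" using bounded_support_bound[OF g] by metis
  have [measurable]: "g \<in> borel_measurable borel" using g(1) borel_measurable_continuous_onI by blast
  have li: "loc_int g" using K(2) by (intro loc_int_bounded[where K=K]) auto
  have [measurable]: "conv (mollifier n) g \<in> borel_measurable borel" for n
    using conv_borel_measurable mollifier_smooth_kernel li by blast
  have "(\<lambda>n. LBINT x. \<bar>conv (mollifier n) g x - g x\<bar>) \<longlonglongrightarrow> (\<integral>x. 0 \<partial>(lborel :: 'a measure))"
  proof (rule integral_dominated_convergence[where w="\<lambda>x. indicator (cball 0 (R + 1)) x * (2 * K)"])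
    have "integrable lborel (\<lambda>x::'a. indicator (cball 0 (R + 1)) x :: real)"
      using emeasure_bounded_finite[OF bounded_cball] by (intro integrable_real_indicator) auto
    then show "integrable lborel (\<lambda>x::'a. indicator (cball 0 (R + 1)) x * (2 * K) :: real)" by simp
    show "AE x in lborel. norm \<bar>conv (mollifier n) g x - g x\<bar> \<le> indicator (cball 0 (R + 1)) x * (2 * K)" for n
    proof (intro AE_I2)
      fix x
      show "norm \<bar>conv (mollifier n) g x - g x\<bar> \<le> indicator (cball 0 (R + 1)) x * (2 * K)"
      proof (cases "norm x \<le> R + 1")
        case True
        have "\<bar>g y - g x\<bar> \<le> 2 * K" for y using K(2)[of x] K(2)[of y] by simp
        from conv_mollifier_pointwise[OF li this] show ?thesis using True by simp
      next
        case False
        have "\<bar>g y - 0\<bar> \<le> 0" if "real (Suc n) * norm (x - y) < 1" for y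
        proof -
          have "1 * norm (x - y) \<le> real (Suc n) * norm (x - y)" by (intro mult_right_mono) auto
          then have "R \<le> norm y" using that False norm_triangle_ineq2[of x y] by linarith
          then show ?thesis using R by simp
        qed
        from conv_mollifier_pointwise[OF li this] show ?thesis using False R[of x] by simp
      qed
    qed
    show "AE x in lborel. (\<lambda>n. \<bar>conv (mollifier n) g x - g x\<bar>) \<longlonglongrightarrow> 0"
    proof (intro AE_I2 LIMSEQ_I)
      fix x and e :: real assume e: "e > 0"
      have "isCont g x" using g(1) by (simp add: continuous_on_eq_continuous_at)
      then obtain d where d: "d > 0" "\<And>y. dist y x < d \<Longrightarrow> dist (g y) (g x) < e / 2"
        using e unfolding continuous_at_eps_delta by (metis half_gt_zero dist_norm)
      obtain N where N: "inverse (real (Suc N)) < d" using reals_Archimedean d(1) by blast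
      show "\<exists>N. \<forall>n\<ge>N. norm (\<bar>conv (mollifier n) g x - g x\<bar> - 0) < e"
      proof (intro exI[of _ N] allI impI)
        fix n assume "N \<le> n"
        then have n: "inverse (real (Suc n)) < d" using N by (smt (verit) Suc_le_mono inverse_of_nat_le old.nat.distinct(1) of_nat_le_iff le_imp_inverse_le of_nat_0_less_iff zero_less_Suc)
        have "\<bar>g y - g x\<bar> \<le> e / 2" if "real (Suc n) * norm (x - y) < 1" for y
        proof -
          have "norm (x - y) < inverse (real (Suc n))" using that by (simp add: field_simps)
          then show ?thesis using d(2)[of y] n by (simp add: dist_norm norm_minus_commute)
        qed
        then have "\<bar>conv (mollifier n) g x - g x\<bar> \<le> e / 2"
          by (rule conv_mollifier_pointwise[OF li])
        then show "norm (\<bar>conv (mollifier n) g x - g x\<bar> - 0) < e"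
          using e by simp
      qed
    qed
  qed auto
  then show ?thesis by simp
qed

section \<open>Mollification in \<open>L\<^sup>1\<close>\<close>

text \<open>
  By linearity and limits it suffices to approximate the indicator of a set \<open>A\<close> of finite measure.  Outer
  regularity replaces \<open>A\<close> by an open set \<open>U\<close>, and \<open>min 1 (n dist(x, -U))\<close>, cut off at infinity, increases to
  the indicator of \<open>U\<close>.
\<close>

lemma L1_density:
  fixes f :: "'a::euclidean_space \<Rightarrow> real"
  assumes "integrable lborel f"
  shows "\<forall>e>0. \<exists>g. continuous_on UNIV g \<and> bounded_support g \<and> (LBINT x. \<bar>f x - g x\<bar>) < e"
  using assms
proof (induction rule: integrable_induct)
  case (base A c)
  show ?case
  proof (intro allI impI)
    fix e :: real assume "e > 0"
    \<comment> \<open>The summand 1 keeps the denominator positive when c = 0.\<close>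
    define e' where "e' = e / (2 * (\<bar>c\<bar> + 1))"
    have e': "e' > 0" using \<open>e > 0\<close> by (simp add: e'_def)
    have [measurable]: "A \<in> sets borel" using base by simp
    obtain U where U: "open U" "A \<subseteq> U" "emeasure lborel (U - A) < e'"
      using outer_regular_lborel[of A e'] e' by auto
    have [measurable]: "U \<in> sets borel" using U(1) by simp
    have "emeasure lborel U = emeasure lborel A + emeasure lborel (U - A)"
      using U(2) by (subst plus_emeasure) (auto simp: Un_absorb1)
    moreover have "emeasure lborel (U - A) < top"
      using U(3) ennreal_less_top by (rule order_less_trans)
    ultimately have Ufin: "emeasure lborel U < \<infinity>"
      using base(2) by (simp add: ennreal_add_less_top)
    have Une: "- U \<noteq> {}"
    proof
      assume "- U = {}"
      then have "U = UNIV" by auto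
      then show False using Ufin by simp
    qed
    define g :: "nat \<Rightarrow> 'a \<Rightarrow> real" where
      "g n x = c * (min 1 (real n * infdist x (- U)) * max 0 (min 1 (real n - norm x)))" for n x
    have gc: "continuous_on UNIV (g n)" for n
      unfolding g_def by (intro continuous_intros)
    have gs: "bounded_support (g n)" for n
      unfolding bounded_support_def g_def by (intro exI[of _ "real n"]) (auto simp: max_def)
    have [measurable]: "g n \<in> borel_measurable borel" for n using gc borel_measurable_continuous_onI by blast
    have iU: "integrable lborel (\<lambda>x. indicator U x :: real)" using Ufin by (intro integrable_real_indicator) auto
    have iA: "integrable lborel (\<lambda>x. indicator A x :: real)" using base by (intro integrable_real_indicator) auto
    have "(\<lambda>n. LBINT x. \<bar>c * indicator U x - g n x\<bar>) \<longlonglongrightarrow> (\<integral>x. 0 \<partial>(lborel :: 'a measure))"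
    proof (rule integral_dominated_convergence[where w="\<lambda>x. indicator U x * \<bar>c\<bar>"])
      show "integrable lborel (\<lambda>x. indicator U x * \<bar>c\<bar>)" using iU by simp
      show "AE x in lborel. (\<lambda>n. \<bar>c * indicator U x - g n x\<bar>) \<longlonglongrightarrow> 0"
      proof (intro AE_I2)
        fix x
        show "(\<lambda>n. \<bar>c * indicator U x - g n x\<bar>) \<longlonglongrightarrow> 0"
        proof (cases "x \<in> U")
          case True
          then have "infdist x (- U) > 0"
            using U(1) Une by (simp add: infdist_pos_not_in_closed closed_Compl)
          then obtain N1 where N1: "1 \<le> real N1 * infdist x (- U)"
            by (metis ex_less_of_nat_mult less_imp_le)
          obtain N2 where N2: "1 + norm x \<le> real N2" using real_arch_simple by blast
          have "g n x = c" if "n \<ge> max N1 N2" for n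
          proof -
            have "real N1 * infdist x (- U) \<le> real n * infdist x (- U)"
              using that infdist_nonneg by (intro mult_right_mono) auto
            then have "min 1 (real n * infdist x (- U)) = 1" using N1 by simp
            moreover have "max 0 (min 1 (real n - norm x)) = 1" using that N2 by simp
            ultimately show ?thesis by (simp add: g_def)
          qed
          then have "eventually (\<lambda>n. 0 = \<bar>c * indicator U x - g n x\<bar>) sequentially"
            using True unfolding eventually_sequentially by (intro exI[of _ "max N1 N2"]) auto
          then show ?thesis by (rule Lim_transform_eventually[OF tendsto_const])
        next
          case False then show ?thesis by (simp add: g_def)
        qed
      qed
      show "AE x in lborel. norm \<bar>c * indicator U x - g n x\<bar> \<le> indicator U x * \<bar>c\<bar>" for n
      proof (intro AE_I2)
        fix x
        show "norm \<bar>c * indicator U x - g n x\<bar> \<le> indicator U x * \<bar>c\<bar>"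
        proof (cases "x \<in> U")
          case True
          define t where "t = min 1 (real n * infdist x (- U)) * max 0 (min 1 (real n - norm x))"
          have "0 \<le> t" "t \<le> 1" unfolding t_def using infdist_nonneg[of x "- U"]
            by (auto intro!: mult_nonneg_nonneg mult_le_one)
          then have "\<bar>c * (1 - t)\<bar> \<le> \<bar>c\<bar>" by (simp add: abs_mult mult_left_le)
          then have "\<bar>c - c * t\<bar> \<le> \<bar>c\<bar>" by (simp add: right_diff_distrib)
          then show ?thesis using True by (simp add: g_def t_def)
        qed (simp add: g_def)
      qed
    qed auto
    then have "eventually (\<lambda>n. (LBINT x. \<bar>c * indicator U x - g n x\<bar>) < e / 2) sequentially"
      using \<open>e > 0\<close> by (intro order_tendstoD) auto
    then obtain n where n: "(LBINT x. \<bar>c * indicator U x - g n x\<bar>) < e / 2"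
      by (auto simp: eventually_sequentially)
    have ig: "integrable lborel (g n)" using bounded_support_integrable gc gs by blast
    have "(LBINT x. \<bar>indicator A x *\<^sub>R c - g n x\<bar>) \<le> (LBINT x. \<bar>c\<bar> * indicator (U - A) x + \<bar>c * indicator U x - g n x\<bar>)"
    proof (rule integral_mono)
      have "integrable lborel (\<lambda>x. indicator (U - A) x :: real)"
        using U(3) by (intro integrable_real_indicator) (auto simp: order_less_trans[OF _ ennreal_less_top])
      then show "integrable lborel (\<lambda>x. \<bar>c\<bar> * indicator (U - A) x + \<bar>c * indicator U x - g n x\<bar>)"
        using iU ig by simp
      show "integrable lborel (\<lambda>x. \<bar>indicator A x *\<^sub>R c - g n x\<bar>)" using iA ig by simp
      show "\<bar>indicator A x *\<^sub>R c - g n x\<bar> \<le> \<bar>c\<bar> * indicator (U - A) x + \<bar>c * indicator U x - g n x\<bar>" for x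
        using U(2) by (auto simp: indicator_def)
    qed
    also have "\<dots> = \<bar>c\<bar> * measure lborel (U - A) + (LBINT x. \<bar>c * indicator U x - g n x\<bar>)"
    proof -
      have "integrable lborel (\<lambda>x. indicator (U - A) x :: real)"
        using U(3) by (intro integrable_real_indicator) (auto simp: order_less_trans[OF _ ennreal_less_top])
      then show ?thesis using iU ig by simp
    qed
    also have "\<bar>c\<bar> * measure lborel (U - A) \<le> e / 2"
    proof -
      have "measure lborel (U - A) \<le> e'"
        using U(3) e' unfolding measure_def by (simp add: enn2real_leI less_imp_le)
      then have "\<bar>c\<bar> * measure lborel (U - A) \<le> (\<bar>c\<bar> + 1) * e'"
        by (intro mult_mono) auto
      also have "(\<bar>c\<bar> + 1) * e' = e / 2"
      proof -
        have "a * (e / (2 * a)) = e / 2" if "a \<noteq> 0" for a :: real using that by simp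
        from this[of "\<bar>c\<bar> + 1"] show ?thesis unfolding e'_def by linarith
      qed
      finally show ?thesis .
    qed
    finally show "\<exists>g. continuous_on UNIV g \<and> bounded_support g \<and> (LBINT x. \<bar>indicator A x *\<^sub>R c - g x\<bar>) < e"
      using gc gs n by (intro exI[of _ "g n"]) auto
  qed
next
  case (add f1 f2)
  show ?case
  proof (intro allI impI)
    fix e :: real assume "e > 0"
    then obtain g1 g2 where g: "continuous_on UNIV g1" "bounded_support g1" "(LBINT x. \<bar>f1 x - g1 x\<bar>) < e / 2"
       "continuous_on UNIV g2" "bounded_support g2" "(LBINT x. \<bar>f2 x - g2 x\<bar>) < e / 2"
      using add(3,4) by (meson half_gt_zero)
    have i: "integrable lborel g1" "integrable lborel g2" using g bounded_support_integrable by blast+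
    have "(LBINT x. \<bar>(f1 x + f2 x) - (g1 x + g2 x)\<bar>) \<le> (LBINT x. \<bar>f1 x - g1 x\<bar> + \<bar>f2 x - g2 x\<bar>)"
      by (intro integral_mono) (use add i in auto)
    also have "\<dots> < e" using add i g(3,6) by simp
    finally show "\<exists>g. continuous_on UNIV g \<and> bounded_support g \<and> (LBINT x. \<bar>f1 x + f2 x - g x\<bar>) < e"
      using g by (intro exI[of _ "\<lambda>x. g1 x + g2 x"]) (auto intro: continuous_intros bounded_support_add)
  qed
next
  case (lim f s)
  show ?case
  proof (intro allI impI)
    fix e :: real assume "e > 0"
    have [measurable]: "f \<in> borel_measurable lborel" "\<And>i. s i \<in> borel_measurable lborel" using lim by auto
    have "(\<lambda>i. LBINT x. \<bar>f x - s i x\<bar>) \<longlonglongrightarrow> (\<integral>x. 0 \<partial>(lborel :: 'a measure))"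
    proof (rule integral_dominated_convergence[where w="\<lambda>x. 3 * \<bar>f x\<bar>"])
      show "AE x in lborel. (\<lambda>i. \<bar>f x - s i x\<bar>) \<longlonglongrightarrow> 0"
      proof (intro AE_I2)
        fix x
        have "(\<lambda>i. \<bar>f x - s i x\<bar>) \<longlonglongrightarrow> \<bar>f x - f x\<bar>" using lim(2) by (intro tendsto_intros) auto
        then show "(\<lambda>i. \<bar>f x - s i x\<bar>) \<longlonglongrightarrow> 0" by simp
      qed
      show "AE x in lborel. norm \<bar>f x - s i x\<bar> \<le> 3 * \<bar>f x\<bar>" for i
        using lim(3)[of _ i] by (intro AE_I2) (smt (verit) real_norm_def space_lborel UNIV_I)
    qed (use lim in auto)
    then have "eventually (\<lambda>i. (LBINT x. \<bar>f x - s i x\<bar>) < e / 2) sequentially"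
      using \<open>e > 0\<close> by (intro order_tendstoD) auto
    then obtain i where i: "(LBINT x. \<bar>f x - s i x\<bar>) < e / 2"
      by (auto simp: eventually_sequentially)
    obtain g where g: "continuous_on UNIV g" "bounded_support g" "(LBINT x. \<bar>s i x - g x\<bar>) < e / 2"
      using lim(5)[of i] \<open>e > 0\<close> by (meson half_gt_zero)
    have ig: "integrable lborel g" using g bounded_support_integrable by blast
    have "(LBINT x. \<bar>f x - g x\<bar>) \<le> (LBINT x. \<bar>f x - s i x\<bar> + \<bar>s i x - g x\<bar>)"
      by (intro integral_mono) (use lim ig in auto)
    also have "\<dots> < e" using lim ig i g(3) by simp
    finally show "\<exists>g. continuous_on UNIV g \<and> bounded_support g \<and> (LBINT x. \<bar>f x - g x\<bar>) < e"
      using g by blast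
  qed
qed

lemma conv_mollifier_integrable:
  assumes f: "integrable lborel f"
  shows "integrable lborel (conv (mollifier n) f)"
    "(LBINT x. \<bar>conv (mollifier n) f x\<bar>) \<le> (LBINT x. \<bar>f x\<bar>)"
proof -
  note li = integrable_imp_loc_int[OF f]
  have [measurable]: "conv (mollifier n) f \<in> borel_measurable borel"
    using conv_borel_measurable mollifier_smooth_kernel li by blast
  have le: "(\<integral>\<^sup>+x. ennreal \<bar>conv (mollifier n) f x\<bar> \<partial>lborel) \<le> ennreal (LBINT x. \<bar>f x\<bar>)"
    using conv_mollifier_L1[OF li, of n] nn_integral_eq_integral[of lborel "\<lambda>x. \<bar>f x\<bar>"] f by simp
  show i: "integrable lborel (conv (mollifier n) f)"
    by (rule integrableI_bounded) (use le ennreal_less_top in \<open>auto intro: le_less_trans\<close>)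
  show "(LBINT x. \<bar>conv (mollifier n) f x\<bar>) \<le> (LBINT x. \<bar>f x\<bar>)"
    using le nn_integral_eq_integral[of lborel "\<lambda>x. \<bar>conv (mollifier n) f x\<bar>"] i by simp
qed

text \<open>
  Mollification contracts \<open>L\<^sup>1\<close>, so convergence needs to be known only on the dense set of continuous functions
  with bounded support.
\<close>

lemma mollify_L1:
  fixes f :: "'a::euclidean_space \<Rightarrow> real"
  assumes f: "integrable lborel f"
  shows "(\<lambda>n. LBINT x. \<bar>conv (mollifier n) f x - f x\<bar>) \<longlonglongrightarrow> 0"
proof (rule LIMSEQ_I)
  fix e :: real assume "e > 0"
  then obtain g where g: "continuous_on UNIV g" "bounded_support g" "(LBINT x. \<bar>f x - g x\<bar>) < e / 3"
    using L1_density[OF f] by (meson divide_pos_pos zero_less_numeral)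
  have ig: "integrable lborel g" using g bounded_support_integrable by blast
  obtain N where N: "\<And>n. n \<ge> N \<Longrightarrow> (LBINT x. \<bar>conv (mollifier n) g x - g x\<bar>) < e / 3"
    using LIMSEQ_D[OF mollify_C0c_L1[OF g(1,2)], of "e / 3"] \<open>e > 0\<close> by (force simp: abs_less_iff)
  show "\<exists>N. \<forall>n\<ge>N. norm ((LBINT x. \<bar>conv (mollifier n) f x - f x\<bar>) - 0) < e"
  proof (intro exI[of _ N] allI impI)
    fix n assume n: "N \<le> n"
    have ifg: "integrable lborel (\<lambda>x. f x - g x)" using f ig by simp
    have eq: "conv (mollifier n) f x = conv (mollifier n) (\<lambda>x. f x - g x) x + conv (mollifier n) g x" for x
      using conv_diff[OF mollifier_smooth_kernel f[THEN integrable_imp_loc_int] ig[THEN integrable_imp_loc_int], of n x] by simp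
    have "(LBINT x. \<bar>conv (mollifier n) f x - f x\<bar>) \<le>
      (LBINT x. \<bar>conv (mollifier n) (\<lambda>x. f x - g x) x\<bar> + \<bar>conv (mollifier n) g x - g x\<bar> + \<bar>f x - g x\<bar>)"
    proof (rule integral_mono)
      show "\<bar>conv (mollifier n) f x - f x\<bar> \<le> \<bar>conv (mollifier n) (\<lambda>x. f x - g x) x\<bar> + \<bar>conv (mollifier n) g x - g x\<bar> + \<bar>f x - g x\<bar>" for x
        unfolding eq by linarith
    qed (intro Bochner_Integration.integrable_add Bochner_Integration.integrable_diff integrable_abs
          conv_mollifier_integrable(1) f ig ifg)+
    also have "\<dots> = (LBINT x. \<bar>conv (mollifier n) (\<lambda>x. f x - g x) x\<bar>) + (LBINT x. \<bar>conv (mollifier n) g x - g x\<bar>)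
       + (LBINT x. \<bar>f x - g x\<bar>)"
      using f ig ifg conv_mollifier_integrable(1)[OF ifg, of n] conv_mollifier_integrable(1)[OF ig, of n] by simp
    also have "\<dots> < e" using conv_mollifier_integrable(2)[OF ifg, of n] N[OF n] g(3) by simp
    finally show "norm ((LBINT x. \<bar>conv (mollifier n) f x - f x\<bar>) - 0) < e"
      by simp
  qed
qed

section \<open>Square integrable functions\<close>

definition L2 :: "('a::euclidean_space \<Rightarrow> 'b::euclidean_space) \<Rightarrow> bool" where
  "L2 f \<longleftrightarrow> f \<in> borel_measurable borel \<and> integrable lborel (\<lambda>x. (norm (f x))\<^sup>2)"

text \<open>
  Norm convergence, written with the square of the norm; the members and the limit are required to lie in
  \<open>L\<^sup>2\<close> because an integral that does not exist has the value \<open>0\<close>.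
\<close>

definition tendsto_L2 :: "(nat \<Rightarrow> 'a::euclidean_space \<Rightarrow> 'b::euclidean_space) \<Rightarrow> ('a \<Rightarrow> 'b) \<Rightarrow> bool" where
  "tendsto_L2 F f \<longleftrightarrow> (\<forall>n. L2 (F n)) \<and> L2 f \<and> (\<lambda>n. LBINT x. (norm (F n x - f x))\<^sup>2) \<longlonglongrightarrow> 0"

lemma L2_measurable [measurable_dest]: "L2 f \<Longrightarrow> f \<in> borel_measurable borel"
  by (simp add: L2_def)

lemma L2_integrable: "L2 f \<Longrightarrow> integrable lborel (\<lambda>x. (norm (f x))\<^sup>2)"
  by (simp add: L2_def)

lemma L2_dominated:
  fixes f :: "'a::euclidean_space \<Rightarrow> 'b::euclidean_space"
  assumes "f \<in> borel_measurable borel" "integrable lborel g" "\<And>x. (norm (f x))\<^sup>2 \<le> g x"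
  shows "L2 f"
proof -
  have "norm ((norm (f x))\<^sup>2) \<le> norm (g x)" for x using assms(3)[of x] by simp
  then show ?thesis unfolding L2_def using assms(1,2)
    by (auto intro: Bochner_Integration.integrable_bound[of lborel g])
qed

lemma norm_sum_square_le: "(norm (a + b :: 'b::real_normed_vector))\<^sup>2 \<le> 2 * (norm a)\<^sup>2 + 2 * (norm b)\<^sup>2"
proof -
  have "(norm (a + b))\<^sup>2 \<le> (norm a + norm b)\<^sup>2" by (intro power_mono norm_triangle_ineq) auto
  also have "\<dots> \<le> 2 * (norm a)\<^sup>2 + 2 * (norm b)\<^sup>2"
    using zero_le_power2[of "norm a - norm b"] by (simp add: power2_sum power2_diff)
  finally show ?thesis .
qed

lemma L2_add: "L2 f \<Longrightarrow> L2 g \<Longrightarrow> L2 (\<lambda>x. f x + g x)"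
  by (rule L2_dominated[where g="\<lambda>x. 2 * (norm (f x))\<^sup>2 + 2 * (norm (g x))\<^sup>2"])
     (auto simp: L2_def norm_sum_square_le)

lemma L2_uminus: "L2 f \<Longrightarrow> L2 (\<lambda>x. - f x)"
  by (auto simp: L2_def)

lemma L2_diff: "L2 f \<Longrightarrow> L2 g \<Longrightarrow> L2 (\<lambda>x. f x - g x)"
  using L2_add[OF _ L2_uminus, of f g] by simp

lemma L2_zero: "L2 (\<lambda>_. 0)" by (simp add: L2_def)

lemma L2_bounded_scaleR:
  fixes k :: "'a::euclidean_space \<Rightarrow> real"
  assumes "L2 f" "k \<in> borel_measurable borel" "\<And>x. \<bar>k x\<bar> \<le> K"
  shows "L2 (\<lambda>x. k x *\<^sub>R f x)"
proof (rule L2_dominated[where g="\<lambda>x. K\<^sup>2 * (norm (f x))\<^sup>2"])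
  show "(norm (k x *\<^sub>R f x))\<^sup>2 \<le> K\<^sup>2 * (norm (f x))\<^sup>2" for x
    using assms(3)[of x] power_mono[of "\<bar>k x\<bar>" K 2] by (simp add: power_mult_distrib mult_right_mono)
qed (use assms in \<open>auto simp: L2_def\<close>)

lemma L2_bounded_mult:
  fixes k :: "'a::euclidean_space \<Rightarrow> real"
  shows "L2 f \<Longrightarrow> k \<in> borel_measurable borel \<Longrightarrow> (\<And>x. \<bar>k x\<bar> \<le> K) \<Longrightarrow> L2 (\<lambda>x. k x * f x)"
  using L2_bounded_scaleR[of f k K] by simp

lemma L2_linear:
  assumes "L2 f" "bounded_linear T"
  shows "L2 (\<lambda>x. T (f x))"
proof -
  obtain K where K: "\<And>x. norm (T x) \<le> norm x * K" using bounded_linear.bounded[OF assms(2)] by blast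
  show ?thesis
  proof (rule L2_dominated[where g="\<lambda>x. K\<^sup>2 * (norm (f x))\<^sup>2"])
    show "(norm (T (f x)))\<^sup>2 \<le> K\<^sup>2 * (norm (f x))\<^sup>2" for x
      using power_mono[OF K[of "f x"], of 2] by (simp add: power_mult_distrib mult.commute)
    have "T \<in> borel_measurable borel"
      by (intro borel_measurable_continuous_onI linear_continuous_on assms)
    then show "(\<lambda>x. T (f x)) \<in> borel_measurable borel"
      using assms(1) by (auto simp: L2_def intro: measurable_compose)
  qed (use assms in \<open>auto simp: L2_def\<close>)
qed

lemma L2_sum: "(\<And>i. i \<in> I \<Longrightarrow> L2 (f i)) \<Longrightarrow> L2 (\<lambda>x. \<Sum>i\<in>I. f i x)"
  by (induction I rule: infinite_finite_induct) (auto simp: L2_zero L2_add)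

lemma L2_integrable_prod:
  fixes f :: "'a::euclidean_space \<Rightarrow> 'b::euclidean_space" and g :: "'a \<Rightarrow> 'c::euclidean_space"
  assumes "L2 f" "L2 g"
  shows "integrable lborel (\<lambda>x. norm (f x) * norm (g x))"
proof (rule Bochner_Integration.integrable_bound)
  show "integrable lborel (\<lambda>x. (norm (f x))\<^sup>2 + (norm (g x))\<^sup>2)" using assms by (simp add: L2_integrable)
  have "norm (f x) * norm (g x) \<le> (norm (f x))\<^sup>2 + (norm (g x))\<^sup>2" for x
    using sum_squares_bound[of "norm (f x)" "norm (g x)"] zero_le_power2[of "norm (f x)"] zero_le_power2[of "norm (g x)"]
      mult_nonneg_nonneg[OF norm_ge_zero[of "f x"] norm_ge_zero[of "g x"]] by linarith
  then show "AE x in lborel. norm (norm (f x) * norm (g x)) \<le> norm ((norm (f x))\<^sup>2 + (norm (g x))\<^sup>2)"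
    by simp
qed (use assms in measurable)

lemma Cauchy_Schwarz_integral:
  fixes f g :: "'a::euclidean_space \<Rightarrow> real"
  assumes "L2 f" "L2 g"
  shows "(LBINT x. \<bar>f x\<bar> * \<bar>g x\<bar>)\<^sup>2 \<le> (LBINT x. (f x)\<^sup>2) * (LBINT x. (g x)\<^sup>2)"
proof -
  have [measurable]: "f \<in> borel_measurable borel" "g \<in> borel_measurable borel" using assms by (auto simp: L2_def)
  have "(\<integral>\<^sup>+x. ennreal \<bar>f x\<bar> * ennreal \<bar>g x\<bar> \<partial>lborel)\<^sup>2 \<le>
     (\<integral>\<^sup>+x. (ennreal \<bar>f x\<bar>)\<^sup>2 \<partial>lborel) * (\<integral>\<^sup>+x. (ennreal \<bar>g x\<bar>)\<^sup>2 \<partial>lborel)"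
    by (rule Cauchy_Schwarz_nn_integral) auto
  moreover have "(\<integral>\<^sup>+x. ennreal \<bar>f x\<bar> * ennreal \<bar>g x\<bar> \<partial>lborel) = ennreal (LBINT x. \<bar>f x\<bar> * \<bar>g x\<bar>)"
    using L2_integrable_prod[OF assms] by (subst nn_integral_eq_integral[symmetric]) (auto simp: ennreal_mult)
  moreover have "(\<integral>\<^sup>+x. (ennreal \<bar>h x\<bar>)\<^sup>2 \<partial>lborel) = ennreal (LBINT x. (h x)\<^sup>2)" if "L2 h" for h :: "'a \<Rightarrow> real"
    using L2_integrable[OF that] by (subst nn_integral_eq_integral[symmetric]) (auto simp: ennreal_power)
  ultimately show ?thesis using assms
    by (simp add: ennreal_power ennreal_mult[symmetric] integral_nonneg_AE)
qed

lemma tendsto_L2D: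
  assumes "tendsto_L2 F f"
  shows "L2 (F n)" "L2 f" "(\<lambda>n. LBINT x. (norm (F n x - f x))\<^sup>2) \<longlonglongrightarrow> 0"
  using assms by (auto simp: tendsto_L2_def)

lemma tendsto_L2_const: "L2 f \<Longrightarrow> tendsto_L2 (\<lambda>_. f) f"
  by (simp add: tendsto_L2_def)

lemma tendsto_L2_mono:
  fixes F :: "nat \<Rightarrow> 'a::euclidean_space \<Rightarrow> 'b::euclidean_space"
  assumes "\<And>n. L2 (F n)" "L2 f" "\<And>n. integrable lborel (g n)" "\<And>n x. (norm (F n x - f x))\<^sup>2 \<le> g n x"
    "(\<lambda>n. integral\<^sup>L lborel (g n)) \<longlonglongrightarrow> 0"
  shows "tendsto_L2 F f"
  unfolding tendsto_L2_def
proof (intro conjI allI assms)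
  show "(\<lambda>n. LBINT x. (norm (F n x - f x))\<^sup>2) \<longlonglongrightarrow> 0"
  proof (rule tendsto_sandwich[OF _ _ tendsto_const assms(5)])
    show "\<forall>\<^sub>F n in sequentially. (LBINT x. (norm (F n x - f x))\<^sup>2) \<le> integral\<^sup>L lborel (g n)"
      using assms(3,4) L2_integrable[OF L2_diff[OF assms(1,2)]] by (intro always_eventually allI integral_mono) auto
  qed (auto intro!: always_eventually integral_nonneg_AE)
qed

lemma tendsto_L2_add:
  assumes "tendsto_L2 F f" "tendsto_L2 G g"
  shows "tendsto_L2 (\<lambda>n x. F n x + G n x) (\<lambda>x. f x + g x)"
proof (rule tendsto_L2_mono)
  note F = tendsto_L2D[OF assms(1)] and G = tendsto_L2D[OF assms(2)]
  note i = L2_integrable[OF L2_diff[OF F(1) F(2)]] L2_integrable[OF L2_diff[OF G(1) G(2)]]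
  show "integrable lborel (\<lambda>x. 2 * (norm (F n x - f x))\<^sup>2 + 2 * (norm (G n x - g x))\<^sup>2)" for n
    using i by auto
  show "(norm (F n x + G n x - (f x + g x)))\<^sup>2 \<le> 2 * (norm (F n x - f x))\<^sup>2 + 2 * (norm (G n x - g x))\<^sup>2" for n x
    using norm_sum_square_le[of "F n x - f x" "G n x - g x"] by (simp add: algebra_simps)
  have "(\<lambda>n. 2 * (LBINT x. (norm (F n x - f x))\<^sup>2) + 2 * (LBINT x. (norm (G n x - g x))\<^sup>2)) \<longlonglongrightarrow> 2 * 0 + 2 * 0"
    by (intro tendsto_intros F G)
  then show "(\<lambda>n. LBINT x. 2 * (norm (F n x - f x))\<^sup>2 + 2 * (norm (G n x - g x))\<^sup>2) \<longlonglongrightarrow> 0"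
    using i by simp
qed (use assms in \<open>auto simp: tendsto_L2_def L2_add\<close>)

lemma tendsto_L2_sum:
  "(\<And>i. i \<in> I \<Longrightarrow> tendsto_L2 (F i) (f i)) \<Longrightarrow> tendsto_L2 (\<lambda>n x. \<Sum>i\<in>I. F i n x) (\<lambda>x. \<Sum>i\<in>I. f i x)"
  by (induction I rule: infinite_finite_induct) (auto simp: tendsto_L2_const L2_zero tendsto_L2_add)

lemma tendsto_L2_bounded_scaleR:
  fixes k :: "'a::euclidean_space \<Rightarrow> real"
  assumes "tendsto_L2 F f" "k \<in> borel_measurable borel" "\<And>x. \<bar>k x\<bar> \<le> K"
  shows "tendsto_L2 (\<lambda>n x. k x *\<^sub>R F n x) (\<lambda>x. k x *\<^sub>R f x)"
proof (rule tendsto_L2_mono)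
  note F = tendsto_L2D[OF assms(1)]
  show "integrable lborel (\<lambda>x. K\<^sup>2 * (norm (F n x - f x))\<^sup>2)" for n
    using L2_integrable[OF L2_diff[OF F(1) F(2)]] by simp
  show "(norm (k x *\<^sub>R F n x - k x *\<^sub>R f x))\<^sup>2 \<le> K\<^sup>2 * (norm (F n x - f x))\<^sup>2" for n x
    unfolding scaleR_diff_right[symmetric]
    using assms(3)[of x] power_mono[of "\<bar>k x\<bar>" K 2] by (simp add: power_mult_distrib mult_right_mono)
  show "(\<lambda>n. LBINT x. K\<^sup>2 * (norm (F n x - f x))\<^sup>2) \<longlonglongrightarrow> 0"
    using tendsto_mult[OF tendsto_const[of "K\<^sup>2"] F(3)] by simp
qed (use assms in \<open>auto simp: tendsto_L2_def intro!: L2_bounded_scaleR\<close>)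

lemma tendsto_L2_bounded_mult:
  fixes k :: "'a::euclidean_space \<Rightarrow> real"
  shows "tendsto_L2 F f \<Longrightarrow> k \<in> borel_measurable borel \<Longrightarrow> (\<And>x. \<bar>k x\<bar> \<le> K) \<Longrightarrow>
    tendsto_L2 (\<lambda>n x. k x * F n x) (\<lambda>x. k x * f x)"
  using tendsto_L2_bounded_scaleR[of F f k K] by simp

lemma tendsto_L2_linear:
  assumes "tendsto_L2 F f" "bounded_linear T"
  shows "tendsto_L2 (\<lambda>n x. T (F n x)) (\<lambda>x. T (f x))"
proof -
  obtain K where K: "\<And>x. norm (T x) \<le> norm x * K" using bounded_linear.bounded[OF assms(2)] by blast
  note F = tendsto_L2D[OF assms(1)]
  show ?thesis
  proof (rule tendsto_L2_mono)
    show "integrable lborel (\<lambda>x. K\<^sup>2 * (norm (F n x - f x))\<^sup>2)" for n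
      using L2_integrable[OF L2_diff[OF F(1) F(2)]] by simp
    show "(norm (T (F n x) - T (f x)))\<^sup>2 \<le> K\<^sup>2 * (norm (F n x - f x))\<^sup>2" for n x
      using power_mono[OF K[of "F n x - f x"], of 2]
      by (simp add: linear_diff[OF bounded_linear.linear[OF assms(2)]] power_mult_distrib mult.commute)
    show "(\<lambda>n. LBINT x. K\<^sup>2 * (norm (F n x - f x))\<^sup>2) \<longlonglongrightarrow> 0"
      using tendsto_mult[OF tendsto_const[of "K\<^sup>2"] F(3)] by simp
  qed (use F assms in \<open>auto intro: L2_linear\<close>)
qed

lemma tendsto_L2_vec:
  fixes F :: "nat \<Rightarrow> 'a::euclidean_space \<Rightarrow> 'b::euclidean_space"
  assumes "\<And>b. b \<in> Basis \<Longrightarrow> tendsto_L2 (\<lambda>n x. F n x \<bullet> b) (\<lambda>x. f x \<bullet> b)"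
  shows "tendsto_L2 F f"
proof -
  have "tendsto_L2 (\<lambda>n x. \<Sum>b\<in>Basis. (F n x \<bullet> b) *\<^sub>R b) (\<lambda>x. \<Sum>b\<in>Basis. (f x \<bullet> b) *\<^sub>R b)"
    by (intro tendsto_L2_sum tendsto_L2_linear[where T="\<lambda>r. r *\<^sub>R b" for b] assms bounded_linear_scaleR_left)
  then show ?thesis by (simp add: euclidean_representation)
qed

text \<open>
  Polarization reduces the inner product to squared norms.  These converge because
  \<open>||a|\<^sup>2 - |b|\<^sup>2| \<le> (1 + 1/t) |a - b|\<^sup>2 + t |b|\<^sup>2\<close> for every \<open>t > 0\<close>.
\<close>

lemma tendsto_integral_inner:
  fixes F G :: "nat \<Rightarrow> 'a::euclidean_space \<Rightarrow> 'b::euclidean_space"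
  assumes "tendsto_L2 F f" "tendsto_L2 G g"
  shows "(\<lambda>n. LBINT x. F n x \<bullet> G n x) \<longlonglongrightarrow> (LBINT x. f x \<bullet> g x)"
proof -
  note F = tendsto_L2D[OF assms(1)] and G = tendsto_L2D[OF assms(2)]
  have int: "integrable lborel (\<lambda>x. h x \<bullet> k x)" if "L2 h" "L2 k" for h k :: "'a \<Rightarrow> 'b"
    by (rule Bochner_Integration.integrable_bound[OF L2_integrable_prod[OF that]])
       (use that in \<open>auto simp: L2_def Cauchy_Schwarz_ineq2\<close>)
  have pol: "(LBINT x. h x \<bullet> k x) = ((LBINT x. (norm (h x + k x))\<^sup>2) - (LBINT x. (norm (h x))\<^sup>2) - (LBINT x. (norm (k x))\<^sup>2)) / 2"
    if "L2 h" "L2 k" for h k :: "'a \<Rightarrow> 'b"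
  proof -
    have "(LBINT x. (norm (h x + k x))\<^sup>2) = (LBINT x. (norm (h x))\<^sup>2 + 2 * (h x \<bullet> k x) + (norm (k x))\<^sup>2)"
      by (intro Bochner_Integration.integral_cong refl) (simp add: power2_norm_eq_inner inner_add_left inner_add_right inner_commute)
    then show ?thesis using that int[OF that] by (simp add: L2_integrable)
  qed
  have sq: "(\<lambda>n. LBINT x. (norm (H n x))\<^sup>2) \<longlonglongrightarrow> (LBINT x. (norm (h x))\<^sup>2)" if H: "tendsto_L2 H h"
    for H :: "nat \<Rightarrow> 'a \<Rightarrow> 'b" and h
  proof (rule LIMSEQ_I)
    note H = tendsto_L2D[OF H]
    let ?A = "LBINT x. (norm (h x))\<^sup>2"
    have A: "?A \<ge> 0" by simp
    fix e :: real assume e: "e > 0"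
    \<comment> \<open>With this t the term t |h|^2 contributes at most e/2 to the integral.\<close>
    define t where "t = min 1 (e / (2 * (?A + 1)))"
    have pos1: "?A + 1 > 0" by (rule add_nonneg_pos[OF A zero_less_one])
    have pos: "2 * (?A + 1) > 0" by (rule mult_pos_pos[OF zero_less_numeral pos1])
    have t: "0 < t" "t \<le> 1" unfolding t_def using divide_pos_pos[OF e pos] by auto
    have "t * ?A \<le> (e / (2 * (?A + 1))) * (?A + 1)"
      using A t divide_pos_pos[OF e pos] by (intro mult_mono) (auto simp: t_def)
    also have "\<dots> = e / 2"
    proof -
      have "(e / (2 * a)) * a = e / 2" if "a \<noteq> 0" for a :: real using that by simp
      from this[OF less_imp_neq[OF pos1, symmetric]] show ?thesis .
    qed
    finally have tA: "t * ?A \<le> e / 2" .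
    have "(\<lambda>n. (1 + 1 / t) * (LBINT x. (norm (H n x - h x))\<^sup>2)) \<longlonglongrightarrow> (1 + 1 / t) * 0"
      by (intro tendsto_intros H)
    from LIMSEQ_D[OF this, of "e / 2"] e
    obtain N where N: "\<And>n. n \<ge> N \<Longrightarrow> (1 + 1 / t) * (LBINT x. (norm (H n x - h x))\<^sup>2) < e / 2"
      by (force simp: abs_less_iff)
    have key: "\<bar>(norm (a::'b))\<^sup>2 - (norm b)\<^sup>2\<bar> \<le> (1 + 1 / t) * (norm (a - b))\<^sup>2 + t * (norm b)\<^sup>2" for a b
    proof -
      have 1: "(norm a)\<^sup>2 - (norm b)\<^sup>2 = (norm (a - b))\<^sup>2 + 2 * ((a - b) \<bullet> b)"
        by (simp add: power2_norm_eq_inner inner_diff_left inner_diff_right inner_commute)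
      have "\<bar>2 * ((a - b) \<bullet> b)\<bar> \<le> 2 * (norm (a - b) * norm b)"
        using Cauchy_Schwarz_ineq2[of "a - b" b] by simp
      also have "\<dots> \<le> 1 / t * (norm (a - b))\<^sup>2 + t * (norm b)\<^sup>2"
      proof -
        have "0 \<le> (norm (a - b) - t * norm b)\<^sup>2 / t" using t by simp
        then show ?thesis using t by (simp add: power2_diff power_mult_distrib field_simps power2_eq_square)
      qed
      finally have "\<bar>2 * ((a - b) \<bullet> b)\<bar> \<le> 1 / t * (norm (a - b))\<^sup>2 + t * (norm b)\<^sup>2" .
      moreover have "0 \<le> (norm (a - b))\<^sup>2" by simp
      ultimately show ?thesis unfolding 1 distrib_right mult_1 by linarith
    qed
    show "\<exists>N. \<forall>n\<ge>N. norm ((LBINT x. (norm (H n x))\<^sup>2) - ?A) < e"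
    proof (intro exI[of _ N] allI impI)
      fix n assume n: "N \<le> n"
      have "(LBINT x. (norm (H n x))\<^sup>2) - ?A = (LBINT x. (norm (H n x))\<^sup>2 - (norm (h x))\<^sup>2)"
        using H by (simp add: L2_integrable)
      also have "\<bar>\<dots>\<bar> \<le> (LBINT x. (1 + 1 / t) * (norm (H n x - h x))\<^sup>2 + t * (norm (h x))\<^sup>2)"
        by (rule integral_abs_bound[THEN order_trans], rule integral_mono)
           (use L2_integrable[OF H(1)] L2_integrable[OF H(2)] L2_integrable[OF L2_diff[OF H(1,2)]] key in auto)
      also have "\<dots> = (1 + 1 / t) * (LBINT x. (norm (H n x - h x))\<^sup>2) + t * ?A"
        using L2_integrable[OF H(2)] L2_integrable[OF L2_diff[OF H(1,2)]] by simp
      also have "\<dots> < e" using add_less_le_mono[OF N[OF n] tA] by (simp only: field_sum_of_halves)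
      finally show "norm ((LBINT x. (norm (H n x))\<^sup>2) - ?A) < e" by simp
    qed
  qed
  show ?thesis
    unfolding pol[OF F(1) G(1)] pol[OF F(2) G(2)]
    by (intro tendsto_intros sq assms tendsto_L2_add) simp
qed

lemma tendsto_integral_mult:
  fixes F G :: "nat \<Rightarrow> 'a::euclidean_space \<Rightarrow> real"
  shows "tendsto_L2 F f \<Longrightarrow> tendsto_L2 G g \<Longrightarrow>
    (\<lambda>n. LBINT x. F n x * G n x) \<longlonglongrightarrow> (LBINT x. f x * g x)"
  using tendsto_integral_inner[of F f G g] by simp

lemma integrable_inner_L2: "L2 f \<Longrightarrow> L2 g \<Longrightarrow> integrable lborel (\<lambda>x. f x \<bullet> g x)"
  by (rule Bochner_Integration.integrable_bound[OF L2_integrable_prod, of f g])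
     (auto simp: L2_def Cauchy_Schwarz_ineq2)

lemma integrable_mult_L2:
  fixes f :: "'a::euclidean_space \<Rightarrow> real"
  shows "L2 f \<Longrightarrow> L2 g \<Longrightarrow> integrable lborel (\<lambda>x. f x * g x)"
  using integrable_inner_L2[of f g] by simp

lemma tendsto_L2_AE_subseq:
  fixes F :: "nat \<Rightarrow> 'a::euclidean_space \<Rightarrow> 'b::euclidean_space"
  assumes "tendsto_L2 F f"
  obtains r where "strict_mono r" "AE x in lborel. (\<lambda>n. F (r n) x) \<longlonglongrightarrow> f x"
proof -
  note F = tendsto_L2D[OF assms]
  have "\<exists>r. strict_mono r \<and> (AE x in lborel. (\<lambda>n. (norm (F (r n) x - f x))\<^sup>2) \<longlonglongrightarrow> 0)"
    by (rule tendsto_L1_AE_subseq) (use F L2_integrable[OF L2_diff[OF F(1) F(2)]] in auto)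
  then obtain r where r: "strict_mono r" "AE x in lborel. (\<lambda>n. (norm (F (r n) x - f x))\<^sup>2) \<longlonglongrightarrow> 0"
    by blast
  have "AE x in lborel. (\<lambda>n. F (r n) x) \<longlonglongrightarrow> f x"
    using r(2)
  proof eventually_elim
    case (elim x)
    from tendsto_real_sqrt[OF elim] have "(\<lambda>n. norm (F (r n) x - f x)) \<longlonglongrightarrow> 0" by simp
    then show ?case using LIM_zero_cancel tendsto_norm_zero_iff by blast
  qed
  with r(1) show ?thesis by (rule that)
qed

lemma tendsto_L2_subseq: "tendsto_L2 F f \<Longrightarrow> strict_mono r \<Longrightarrow> tendsto_L2 (\<lambda>n. F (r n)) f"
  unfolding tendsto_L2_def using LIMSEQ_subseq_LIMSEQ by (fastforce simp: o_def)

lemma indicator_ball_L2: "L2 (\<lambda>x::'a::euclidean_space. indicator (cball 0 r) x :: real)"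
proof -
  have "(norm (indicator (cball 0 r) x :: real))\<^sup>2 = indicator (cball 0 r) x" for x :: 'a
    by (simp add: indicator_def)
  then show ?thesis
    unfolding L2_def using emeasure_bounded_finite[OF bounded_cball, of "0::'a" r]
    by (intro conjI borel_measurable_indicator) (auto intro!: integrable_real_indicator)
qed

lemma L2_loc_int:
  fixes f :: "'a::euclidean_space \<Rightarrow> real"
  assumes "L2 f"
  shows "loc_int f"
  unfolding loc_int_def
proof (intro conjI allI)
  fix r
  show "integrable lborel (\<lambda>x. indicator (cball 0 r) x * f x)"
    by (rule integrable_mult_L2[OF indicator_ball_L2 assms])
qed (use assms in \<open>simp add: L2_def\<close>)

section \<open>Mollification in \<open>L\<^sup>2\<close>\<close>

lemma conv_mollifier_L2_real:
  fixes f :: "'a::euclidean_space \<Rightarrow> real"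
  assumes f: "L2 f"
  shows "L2 (conv (mollifier n) f)" "(LBINT x. (conv (mollifier n) f x)\<^sup>2) \<le> (LBINT x. (f x)\<^sup>2)"
proof -
  note li = L2_loc_int[OF f]
  have i: "integrable lborel (\<lambda>x. (f x)\<^sup>2)" using L2_integrable[OF f] by simp
  have m [measurable]: "conv (mollifier n) f \<in> borel_measurable borel"
    using conv_borel_measurable mollifier_smooth_kernel li by blast
  have le: "(\<integral>\<^sup>+x. ennreal ((conv (mollifier n) f x)\<^sup>2) \<partial>lborel) \<le> ennreal (LBINT x. (f x)\<^sup>2)"
    using conv_mollifier_L2[OF li, of n] nn_integral_eq_integral[OF i] by simp
  have ic: "integrable lborel (\<lambda>x. (conv (mollifier n) f x)\<^sup>2)"
    by (rule integrableI_bounded) (use le ennreal_less_top in \<open>auto intro: le_less_trans\<close>)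
  with m show "L2 (conv (mollifier n) f)" by (simp add: L2_def)
  show "(LBINT x. (conv (mollifier n) f x)\<^sup>2) \<le> (LBINT x. (f x)\<^sup>2)"
    using le nn_integral_eq_integral[OF ic] by (simp add: integral_nonneg_AE)
qed

lemma mollify_bounded_L2:
  fixes h :: "'a::euclidean_space \<Rightarrow> real"
  assumes h: "integrable lborel h" "\<And>x. \<bar>h x\<bar> \<le> M"
  shows "(\<lambda>n. LBINT x. (conv (mollifier n) h x - h x)\<^sup>2) \<longlonglongrightarrow> 0"
    and "integrable lborel (\<lambda>x. (conv (mollifier n) h x - h x)\<^sup>2)"
proof -
  note li = integrable_imp_loc_int[OF h(1)]
  have [measurable]: "conv (mollifier n) h \<in> borel_measurable borel" for n
    using conv_borel_measurable mollifier_smooth_kernel li by blast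
  have [measurable]: "h \<in> borel_measurable borel" using li by (simp add: loc_int_def)
  have i: "integrable lborel (\<lambda>x. 2 * M * \<bar>conv (mollifier n) h x - h x\<bar>)" for n
    using h(1) conv_mollifier_integrable(1)[OF h(1), of n] by simp
  have le: "(conv (mollifier n) h x - h x)\<^sup>2 \<le> 2 * M * \<bar>conv (mollifier n) h x - h x\<bar>" for n x
  proof -
    have "\<bar>h y - h x\<bar> \<le> 2 * M" for y using h(2)[of x] h(2)[of y] by linarith
    then have "\<bar>conv (mollifier n) h x - h x\<bar> \<le> 2 * M" by (rule conv_mollifier_pointwise[OF li])
    then have "\<bar>conv (mollifier n) h x - h x\<bar> * \<bar>conv (mollifier n) h x - h x\<bar> \<le> 2 * M * \<bar>conv (mollifier n) h x - h x\<bar>"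
      by (intro mult_right_mono) auto
    then show ?thesis by (simp add: power2_eq_square)
  qed
  show j: "integrable lborel (\<lambda>x. (conv (mollifier n) h x - h x)\<^sup>2)" for n
    by (rule Bochner_Integration.integrable_bound[OF i[of n]]) (auto intro!: order_trans[OF le abs_ge_self])
  show "(\<lambda>n. LBINT x. (conv (mollifier n) h x - h x)\<^sup>2) \<longlonglongrightarrow> 0"
  proof (rule tendsto_sandwich[OF _ _ tendsto_const])
    show "(\<lambda>n. LBINT x. 2 * M * \<bar>conv (mollifier n) h x - h x\<bar>) \<longlonglongrightarrow> 0"
      using tendsto_mult[OF tendsto_const[of "2 * M"] mollify_L1[OF h(1)]] by simp
    show "\<forall>\<^sub>F n in sequentially. (LBINT x. (conv (mollifier n) h x - h x)\<^sup>2) \<le> (LBINT x. 2 * M * \<bar>conv (mollifier n) h x - h x\<bar>)"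
      by (intro always_eventually allI integral_mono i j le)
  qed (auto intro!: always_eventually integral_nonneg_AE)
qed

text \<open>
  Truncate \<open>f\<close> in height and in space.  The truncation is bounded and integrable, so its mollifications, which
  converge in \<open>L\<^sup>1\<close>, converge in \<open>L\<^sup>2\<close>; the error of the truncation is small in \<open>L\<^sup>2\<close> and stays so under the
  contraction \<open>f \<mapsto> \<rho> * f\<close>.
\<close>

lemma mollify_L2:
  fixes f :: "'a::euclidean_space \<Rightarrow> real"
  assumes f: "L2 f"
  shows "tendsto_L2 (\<lambda>n. conv (mollifier n) f) f"
  unfolding tendsto_L2_def real_norm_def power2_abs
proof (intro conjI allI f conv_mollifier_L2_real LIMSEQ_I)
  fix e :: real assume "e > 0"
  have [measurable]: "f \<in> borel_measurable borel" using f by (simp add: L2_def)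
  have if2: "integrable lborel (\<lambda>x. (f x)\<^sup>2)" using L2_integrable[OF f] by simp
  define h where "h M x = (if norm x \<le> real M \<and> \<bar>f x\<bar> \<le> real M then f x else 0)" for M x
  have [measurable]: "h M \<in> borel_measurable borel" for M unfolding h_def by measurable
  have "(\<lambda>M. LBINT x. (f x - h M x)\<^sup>2) \<longlonglongrightarrow> (\<integral>x. 0 \<partial>(lborel :: 'a measure))"
  proof (rule integral_dominated_convergence[where w="\<lambda>x. (f x)\<^sup>2"])
    show "AE x in lborel. (\<lambda>M. (f x - h M x)\<^sup>2) \<longlonglongrightarrow> 0"
    proof (intro AE_I2)
      fix x
      obtain N where N: "max (norm x) \<bar>f x\<bar> \<le> real N" using real_arch_simple by blast
      have "0 = (f x - h M x)\<^sup>2" if "N \<le> M" for M using N that by (auto simp: h_def)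
      then have "eventually (\<lambda>M. 0 = (f x - h M x)\<^sup>2) sequentially"
        unfolding eventually_sequentially by blast
      then show "(\<lambda>M. (f x - h M x)\<^sup>2) \<longlonglongrightarrow> 0" by (rule Lim_transform_eventually[OF tendsto_const])
    qed
  qed (use if2 in \<open>auto simp: h_def\<close>)
  then have "eventually (\<lambda>M. (LBINT x. (f x - h M x)\<^sup>2) < e / 9) sequentially"
    using \<open>e > 0\<close> by (intro order_tendstoD) auto
  then obtain M where M: "(LBINT x. (f x - h M x)\<^sup>2) < e / 9"
    by (auto simp: eventually_sequentially)
  have hb: "\<bar>h M x\<bar> \<le> real M" for x by (auto simp: h_def)
  have hi: "integrable lborel (h M)"
  proof -
    have "loc_int (h M)" using hb by (intro loc_int_bounded[where K="real M"]) auto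
    then have "integrable lborel (\<lambda>x. indicator (cball 0 (real M)) x * h M x)" by (simp add: loc_int_def)
    moreover have "(\<lambda>x. indicator (cball 0 (real M)) x * h M x) = h M" by (auto simp: h_def indicator_def)
    ultimately show ?thesis by simp
  qed
  have hL2: "L2 (h M)" by (rule L2_dominated[OF _ if2]) (auto simp: h_def)
  note fh = L2_diff[OF f hL2]
  obtain N where N: "\<And>n. n \<ge> N \<Longrightarrow> (LBINT x. (conv (mollifier n) (h M) x - h M x)\<^sup>2) < e / 9"
    using LIMSEQ_D[OF mollify_bounded_L2(1)[OF hi hb], of "e / 9"] \<open>e > 0\<close> by (force simp: abs_less_iff)
  show "\<exists>N. \<forall>n\<ge>N. norm ((LBINT x. (conv (mollifier n) f x - f x)\<^sup>2) - 0) < e"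
  proof (intro exI[of _ N] allI impI)
    fix n assume n: "N \<le> n"
    let ?a = "\<lambda>x. conv (mollifier n) (\<lambda>x. f x - h M x) x" and ?b = "\<lambda>x. conv (mollifier n) (h M) x - h M x"
      and ?c = "\<lambda>x. f x - h M x"
    have eq: "conv (mollifier n) f x - f x = ?a x + ?b x - ?c x" for x
      using conv_diff[OF mollifier_smooth_kernel f[THEN L2_loc_int] hL2[THEN L2_loc_int], of n x] by simp
    have ia: "integrable lborel (\<lambda>x. (?a x)\<^sup>2)" using L2_integrable[OF conv_mollifier_L2_real(1)[OF fh]] by simp
    have ib: "integrable lborel (\<lambda>x. (?b x)\<^sup>2)" using mollify_bounded_L2(2)[OF hi hb] .
    have ic: "integrable lborel (\<lambda>x. (?c x)\<^sup>2)" using L2_integrable[OF fh] by simp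
    have "(LBINT x. (conv (mollifier n) f x - f x)\<^sup>2) \<le> (LBINT x. 3 * (?a x)\<^sup>2 + 3 * (?b x)\<^sup>2 + 3 * (?c x)\<^sup>2)"
    proof (rule integral_mono)
      show "integrable lborel (\<lambda>x. (conv (mollifier n) f x - f x)\<^sup>2)"
        using L2_integrable[OF L2_diff[OF conv_mollifier_L2_real(1)[OF f] f]] by simp
      have "(a + b - c)\<^sup>2 \<le> 3 * a\<^sup>2 + 3 * b\<^sup>2 + 3 * c\<^sup>2" for a b c :: real
        using zero_le_power2[of "a - b"] zero_le_power2[of "a + c"] zero_le_power2[of "b + c"]
        by (simp add: power2_eq_square algebra_simps)
      then show "(conv (mollifier n) f x - f x)\<^sup>2 \<le> 3 * (?a x)\<^sup>2 + 3 * (?b x)\<^sup>2 + 3 * (?c x)\<^sup>2" for x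
        unfolding eq .
    qed (use ia ib ic in simp)
    also have "\<dots> = 3 * (LBINT x. (?a x)\<^sup>2) + 3 * (LBINT x. (?b x)\<^sup>2) + 3 * (LBINT x. (?c x)\<^sup>2)"
      using ia ib ic by simp
    also have "\<dots> < e" using conv_mollifier_L2_real(2)[OF fh, of n] N[OF n] M by simp
    finally show "norm ((LBINT x. (conv (mollifier n) f x - f x)\<^sup>2) - 0) < e"
      by (simp add: integral_nonneg_AE)
  qed
qed

section \<open>Weak gradients\<close>

lemma has_derivative_reflect:
  assumes "f differentiable at (x - y)"
  shows "((\<lambda>y. f (x - y)) has_derivative (\<lambda>h. h \<bullet> (- grad f (x - y)))) (at y)"
proof -
  have "((\<lambda>y. x - y) has_derivative (\<lambda>h. - h)) (at y)" by (auto intro!: derivative_eq_intros)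
  from diff_chain_at[OF this grad_has_derivative[OF assms]] show ?thesis by (simp add: o_def)
qed

lemma Ck_reflect: "Ck k f \<Longrightarrow> Ck k (\<lambda>y. f (x - y))"
proof (induction k arbitrary: f)
  case 0
  then show ?case by (auto intro!: continuous_on_compose2[of UNIV f] continuous_intros)
next
  case (Suc k)
  show ?case
  proof (rule Ck_SucI[where g="\<lambda>y. - grad f (x - y)"])
    show "((\<lambda>y. f (x - y)) has_derivative (\<lambda>h. h \<bullet> (- grad f (x - y)))) (at y)" for y
      using Suc.prems by (intro has_derivative_reflect) simp
    show "Ck k (\<lambda>y. - grad f (x - y) \<bullet> b)" if "b \<in> Basis" for b
      using Ck_uminus[OF Suc.IH[of "\<lambda>y. grad f y \<bullet> b"]] Suc.prems that by simp
  qed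
qed

lemma test_function_iff: "test_function f \<longleftrightarrow> smooth_kernel f"
  using test_functionI test_functionD(1,2) unfolding smooth_kernel_def by blast

lemma test_function_reflect:
  assumes "test_function f"
  shows "test_function (\<lambda>y. f (x - y))"
proof (rule test_functionI)
  show "Ck k (\<lambda>y. f (x - y))" for k using test_functionD(1)[OF assms] by (rule Ck_reflect)
  show "bounded_support (\<lambda>y. f (x - y))"
    using C1cD[OF test_functionD(3)[OF assms]] reflected_kernel(2) by blast
qed

text \<open>
  For Borel functions this agrees with \<open>has_weak_gradient\<close>; the components turn the vector-valued integrals into
  real ones.
\<close>

definition weak_gradient :: "(R3 \<Rightarrow> real) \<Rightarrow> (R3 \<Rightarrow> R3) \<Rightarrow> bool" where
  "weak_gradient u G \<longleftrightarrow> loc_int u \<and> (\<forall>b\<in>Basis. loc_int (\<lambda>x. G x \<bullet> b)) \<and>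
     (\<forall>\<psi> b. test_function \<psi> \<longrightarrow> b \<in> Basis \<longrightarrow>
        (LBINT x. u x * (grad \<psi> x \<bullet> b)) = - (LBINT x. \<psi> x * (G x \<bullet> b)))"

text \<open>
  The derivative of a mollification falls on the kernel, and \<open>y \<mapsto> \<rho>(x - y)\<close> is a test function, so the weak
  formulation moves it over to \<open>u\<close>.
\<close>

lemma grad_conv_weak:
  assumes "test_function \<rho>" "weak_gradient u G" "b \<in> Basis"
  shows "grad (conv \<rho> u) x \<bullet> b = conv \<rho> (\<lambda>y. G y \<bullet> b) x"
proof -
  note \<rho> = test_functionD(3)[OF assms(1)]
  have g: "grad (\<lambda>y. \<rho> (x - y)) y = - grad \<rho> (x - y)" for y
    using C1cD(5)[OF \<rho>] by (intro gradI has_derivative_reflect)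
  have "(LBINT y. u y * (grad (\<lambda>y. \<rho> (x - y)) y \<bullet> b)) = - (LBINT y. \<rho> (x - y) * (G y \<bullet> b))"
    using assms(2,3) test_function_reflect[OF assms(1)] unfolding weak_gradient_def by blast
  then show ?thesis
    using assms(2) by (subst grad_conv[OF \<rho> _ assms(3)]) (simp_all add: weak_gradient_def conv_def g mult.commute)
qed

text \<open>
  The fundamental lemma of the calculus of variations: on a given ball the mollifications of \<open>g\<close>, restricted
  to a larger ball, vanish, and they converge to \<open>g\<close> in \<open>L\<^sup>1\<close>.
\<close>

lemma integral_zero_imp_AE_zero:
  fixes g :: "R3 \<Rightarrow> real"
  assumes g: "loc_int g" and z: "\<And>\<psi>. test_function \<psi> \<Longrightarrow> (LBINT x. \<psi> x * g x) = 0"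
  shows "AE x in lborel. g x = 0"
proof -
  have [measurable]: "g \<in> borel_measurable borel" using g by (simp add: loc_int_def)
  have "AE x in lborel. norm x \<le> real R \<longrightarrow> g x = 0" for R :: nat
  proof -
    define f where "f x = indicator (cball 0 (real R + 1)) x * g x" for x
    have i: "integrable lborel f" unfolding f_def using g by (simp add: loc_int_def)
    have iR: "integrable lborel (\<lambda>x. \<bar>indicator (cball 0 (real R)) x * g x\<bar>)" using g by (simp add: loc_int_def)
    have c0: "conv (mollifier n) f x = 0" if "norm x \<le> real R" for x n
    proof -
      have "mollifier n (x - y) * f y = mollifier n (x - y) * g y" for y
      proof (cases "norm y \<le> real R + 1")
        case False
        then have "1 \<le> norm (x - y)" using that norm_triangle_ineq2[of y x] by (simp add: norm_minus_commute)
        moreover have "1 * norm (x - y) \<le> real (Suc n) * norm (x - y)" by (intro mult_right_mono) auto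
        ultimately show ?thesis using mollifier_eq_0[of n "x - y"] by simp
      qed (simp add: f_def)
      then have "conv (mollifier n) f x = (LBINT y. mollifier n (x - y) * g y)" by (simp only: conv_def)
      also have "\<dots> = 0"
        using mollifier_smooth_kernel test_function_iff by (intro z test_function_reflect) blast
      finally show ?thesis .
    qed
    have "(LBINT x. \<bar>indicator (cball 0 (real R)) x * g x\<bar>) \<le> (LBINT x. \<bar>conv (mollifier n) f x - f x\<bar>)" for n
    proof (rule integral_mono[OF iR])
      show "integrable lborel (\<lambda>x. \<bar>conv (mollifier n) f x - f x\<bar>)"
        using conv_mollifier_integrable(1)[OF i, of n] i by simp
      show "\<bar>indicator (cball 0 (real R)) x * g x\<bar> \<le> \<bar>conv (mollifier n) f x - f x\<bar>" for x
        using c0[of x n] by (auto simp: indicator_def f_def)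
    qed
    from LIMSEQ_le_const[OF mollify_L1[OF i]] this
    have "(LBINT x. \<bar>indicator (cball 0 (real R)) x * g x\<bar>) \<le> 0" by blast
    then have "(LBINT x. \<bar>indicator (cball 0 (real R)) x * g x\<bar>) = 0"
      by (simp add: integral_nonneg_AE antisym)
    then have "AE x in lborel. \<bar>indicator (cball 0 (real R)) x * g x\<bar> = 0"
      using integral_nonneg_eq_0_iff_AE[OF iR] by simp
    then show ?thesis by eventually_elim (auto simp: indicator_def)
  qed
  then have "AE x in lborel. \<forall>R::nat. norm x \<le> real R \<longrightarrow> g x = 0"
    unfolding AE_all_countable by blast
  then show ?thesis by eventually_elim (use real_arch_simple in blast)
qed

section \<open>Cutoff functions\<close>

text \<open>
  Dilations of one bump with value \<open>1\<close> at the origin.  They serve as cutoffs because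
  \<open>cutoff n \<rightarrow> 1\<close> pointwise and \<open>|x| |\<nabla>(cutoff n)|\<close> stays bounded and tends to \<open>0\<close>
  pointwise.
\<close>

definition cutoff :: "nat \<Rightarrow> 'a::euclidean_space \<Rightarrow> real" where
  "cutoff n x = bump ((1 / real (Suc n)) *\<^sub>R x) / bump (0::'a)"

lemma cutoff_eq_0: "real (Suc n) \<le> norm x \<Longrightarrow> cutoff n x = 0"
  unfolding cutoff_def by (subst bump_eq_0) (auto simp: field_simps)

lemma cutoff_has_derivative:
  "(cutoff n has_derivative (\<lambda>h. h \<bullet> ((1 / (real (Suc n) * bump (0::'a::euclidean_space))) *\<^sub>R grad bump ((1 / real (Suc n)) *\<^sub>R x)))) (at (x::'a))"
proof -
  have b: "bump differentiable at (y::'a)" for y using Ck_bump[of 1, where 'a='a] by simp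
  have "((\<lambda>y::'a. (1 / real (Suc n)) *\<^sub>R y) has_derivative (\<lambda>h. (1 / real (Suc n)) *\<^sub>R h)) (at x)"
    by (auto intro!: derivative_eq_intros)
  from diff_chain_at[OF this grad_has_derivative[OF b]]
  have "((\<lambda>y. bump ((1 / real (Suc n)) *\<^sub>R y)) has_derivative (\<lambda>h. (1 / real (Suc n)) *\<^sub>R h \<bullet> grad bump ((1 / real (Suc n)) *\<^sub>R x))) (at x)"
    by (simp add: o_def)
  from has_derivative_mult_right[OF this, of "1 / bump (0::'a)"]
  show ?thesis by (simp add: cutoff_def[abs_def] mult.commute)
qed

lemma cutoff_smooth_kernel: "smooth_kernel (cutoff n :: 'a::euclidean_space \<Rightarrow> real)"
proof -
  have "Ck k (cutoff n :: 'a \<Rightarrow> real)" for k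
  proof -
    have eq: "(cutoff n :: 'a \<Rightarrow> real) = (\<lambda>x. (1 / bump (0::'a)) * flat 1 (1 - (1 / real (Suc n))\<^sup>2 * (x \<bullet> x)))"
      by (simp add: cutoff_def bump_def fun_eq_iff power2_eq_square)
    show ?thesis unfolding eq
      by (rule Ck_cmult, rule Ck_compose[where f="\<lambda>x. 1 - (1 / real (Suc n))\<^sup>2 * (x \<bullet> x)"])
         (intro Ck_flat Ck_diff Ck_const Ck_cmult Ck_inner_self)+
  qed
  then show ?thesis unfolding smooth_kernel_def bounded_support_def using cutoff_eq_0 by blast
qed

lemma cutoff_bounds:
  obtains K where "K > 0" "\<And>n x. \<bar>cutoff n (x::'a::euclidean_space)\<bar> \<le> K"
    "\<And>n x. real (Suc n) * norm (grad (cutoff n) (x::'a)) \<le> K"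
    "\<And>n x. norm x * norm (grad (cutoff n) (x::'a)) \<le> K"
proof -
  have c: "C1c (bump :: 'a \<Rightarrow> real)"
    unfolding C1c_def bounded_support_def using bump_eq_0 Ck_bump by blast
  obtain L where L: "L > 0" "\<And>x::'a. norm (grad bump x) \<le> L"
    using bounded_support_bound[OF C1cD(3)[OF c] bounded_support_grad[OF C1cD(4)[OF c]]] by blast
  let ?b = "bump (0::'a)"
  have b: "?b > 0" by (rule bump_0)
  have g: "grad (cutoff n) x = (1 / (real (Suc n) * ?b)) *\<^sub>R grad bump ((1 / real (Suc n)) *\<^sub>R x)" for n and x :: 'a
    by (rule gradI[OF cutoff_has_derivative])
  have 2: "real (Suc n) * norm (grad (cutoff n) x) \<le> L / ?b" for n and x :: 'a
  proof -
    have "real (Suc n) * norm (grad (cutoff n) x) = norm (grad bump ((1 / real (Suc n)) *\<^sub>R x)) / ?b"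
      using b unfolding g norm_scaleR by (simp del: of_nat_Suc)
    then show ?thesis using L(2)[of "(1 / real (Suc n)) *\<^sub>R x"] b by (simp add: divide_right_mono)
  qed
  have 3: "norm x * norm (grad (cutoff n) x) \<le> L / ?b" for n and x :: 'a
  proof (cases "norm x \<le> real (Suc n)")
    case True
    then have "norm x * norm (grad (cutoff n) x) \<le> real (Suc n) * norm (grad (cutoff n) x)"
      by (intro mult_right_mono) auto
    then show ?thesis using 2[of n x] by linarith
  next
    case False
    have "grad (cutoff n) x = 0"
    proof (rule gradI)
      show "(cutoff n has_derivative (\<lambda>h. h \<bullet> 0)) (at x)"
        by (rule has_derivative_transform_within_open[where s="- cball 0 (real (Suc n))" and f="\<lambda>_. 0"])
           (use False in \<open>auto simp: open_Compl cutoff_eq_0\<close>)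
    qed
    then show ?thesis using L b by simp
  qed
  have 1: "\<bar>cutoff n x\<bar> \<le> 1 / ?b" for n and x :: 'a
    using b bump_nonneg[of "(1 / real (Suc n)) *\<^sub>R x"] bump_le_1[of "(1 / real (Suc n)) *\<^sub>R x"]
    by (simp add: cutoff_def divide_right_mono)
  show ?thesis
    by (rule that[of "L / ?b + 1 / ?b"]) (use 1 2 3 L b in \<open>auto intro: add_pos_pos add_increasing add_increasing2 less_imp_le\<close>)
qed

lemma cutoff_tendsto: "(\<lambda>n. cutoff n (x::'a::euclidean_space)) \<longlonglongrightarrow> 1"
proof -
  have "continuous_on UNIV (bump :: 'a \<Rightarrow> real)"
    by (rule Ck_imp_continuous[OF Ck_bump[of 0]])
  then have "isCont (bump :: 'a \<Rightarrow> real) 0"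
    by (simp add: continuous_on_eq_continuous_at)
  moreover have "(\<lambda>n. (1 / real (Suc n)) *\<^sub>R x) \<longlonglongrightarrow> 0"
    using tendsto_scaleR[OF LIMSEQ_inverse_real_of_nat tendsto_const[of x]] by (simp add: divide_inverse)
  ultimately have "(\<lambda>n. bump ((1 / real (Suc n)) *\<^sub>R x)) \<longlonglongrightarrow> bump (0::'a)"
    by (rule isCont_tendsto_compose)
  then have "(\<lambda>n. bump ((1 / real (Suc n)) *\<^sub>R x) / bump (0::'a)) \<longlonglongrightarrow> bump (0::'a) / bump (0::'a)"
    using bump_0[where 'a='a] by (intro tendsto_divide tendsto_const) auto
  then show ?thesis using bump_0[where 'a='a] by (simp add: cutoff_def)
qed

lemma grad_cutoff_tendsto: "(\<lambda>n. norm (grad (cutoff n) (x::'a::euclidean_space))) \<longlonglongrightarrow> 0"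
proof -
  obtain K where K: "\<And>n x. real (Suc n) * norm (grad (cutoff n) (x::'a)) \<le> K" using cutoff_bounds by metis
  show ?thesis
  proof (rule tendsto_sandwich[OF _ _ tendsto_const])
    show "(\<lambda>n. K * inverse (real (Suc n))) \<longlonglongrightarrow> 0"
      using tendsto_mult[OF tendsto_const[of K] LIMSEQ_inverse_real_of_nat] by simp
    show "\<forall>\<^sub>F n in sequentially. norm (grad (cutoff n) x) \<le> K * inverse (real (Suc n))"
      using K[of _ x] by (intro always_eventually allI) (simp add: field_simps)
  qed auto
qed

section \<open>The Sobolev inequality\<close>

definition esqrt :: "ennreal \<Rightarrow> ennreal" where
  "esqrt a = (if a = top then top else ennreal (sqrt (enn2real a)))"

lemma esqrt_power2: "(esqrt a)\<^sup>2 = a"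
  by (cases a) (auto simp: esqrt_def ennreal_power ennreal_top_eq_mult_iff power2_eq_square ennreal_mult[symmetric])

lemma esqrt_measurable [measurable]: "esqrt \<in> borel_measurable borel"
  unfolding esqrt_def by measurable

lemma le_esqrt: "x \<ge> 0 \<Longrightarrow> ennreal (x\<^sup>2) \<le> a \<Longrightarrow> ennreal x \<le> esqrt a"
  by (cases a) (auto simp: esqrt_def intro!: ennreal_leI real_le_rsqrt)

text \<open>
  Two applications of the Cauchy-Schwarz inequality: first in \<open>c\<close> for fixed \<open>(a, b)\<close>, then in \<open>(a, b)\<close>, where
  the first step has separated the variables.
\<close>

lemma loomis_whitney_3:
  fixes p q r :: "real \<Rightarrow> real \<Rightarrow> ennreal"
  assumes [measurable]: "case_prod p \<in> borel_measurable (borel \<Otimes>\<^sub>M borel)"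
    "case_prod q \<in> borel_measurable (borel \<Otimes>\<^sub>M borel)" "case_prod r \<in> borel_measurable (borel \<Otimes>\<^sub>M borel)"
  shows "(\<integral>\<^sup>+a. \<integral>\<^sup>+b. \<integral>\<^sup>+c. p b c * q a c * r a b \<partial>lborel \<partial>lborel \<partial>lborel)\<^sup>2 \<le>
    (\<integral>\<^sup>+b. \<integral>\<^sup>+c. (p b c)\<^sup>2 \<partial>lborel \<partial>lborel) * (\<integral>\<^sup>+a. \<integral>\<^sup>+c. (q a c)\<^sup>2 \<partial>lborel \<partial>lborel) * (\<integral>\<^sup>+a. \<integral>\<^sup>+b. (r a b)\<^sup>2 \<partial>lborel \<partial>lborel)"
proof -
  define J where "J a b = (\<integral>\<^sup>+c. p b c * q a c \<partial>lborel)" for a b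
  define P where "P b = (\<integral>\<^sup>+c. (p b c)\<^sup>2 \<partial>lborel)" for b
  define Q where "Q a = (\<integral>\<^sup>+c. (q a c)\<^sup>2 \<partial>lborel)" for a
  have [measurable]: "case_prod J \<in> borel_measurable (borel \<Otimes>\<^sub>M borel)" unfolding J_def by measurable
  have [measurable]: "P \<in> borel_measurable borel" "Q \<in> borel_measurable borel" unfolding P_def Q_def by measurable
  have J: "(J a b)\<^sup>2 \<le> P b * Q a" for a b
    unfolding J_def P_def Q_def by (rule Cauchy_Schwarz_nn_integral) measurable
  have fst: "(\<integral>\<^sup>+z. f (fst z) (snd z) \<partial>(lborel \<Otimes>\<^sub>M lborel)) = (\<integral>\<^sup>+a. \<integral>\<^sup>+b. f a b \<partial>lborel \<partial>lborel)"
    if [measurable]: "case_prod f \<in> borel_measurable (borel \<Otimes>\<^sub>M borel)" for f :: "real \<Rightarrow> real \<Rightarrow> ennreal"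
    by (subst lborel.nn_integral_fst[symmetric]) (auto simp: case_prod_beta')
  have "(\<integral>\<^sup>+a. \<integral>\<^sup>+b. \<integral>\<^sup>+c. p b c * q a c * r a b \<partial>lborel \<partial>lborel \<partial>lborel) = (\<integral>\<^sup>+a. \<integral>\<^sup>+b. r a b * J a b \<partial>lborel \<partial>lborel)"
    unfolding J_def by (subst nn_integral_multc) (auto simp: mult.commute)
  also have "\<dots> = (\<integral>\<^sup>+z. r (fst z) (snd z) * J (fst z) (snd z) \<partial>(lborel \<Otimes>\<^sub>M lborel))"
    by (subst fst[of "\<lambda>a b. r a b * J a b"]) auto
  also have "\<dots>\<^sup>2 \<le> (\<integral>\<^sup>+z. (r (fst z) (snd z))\<^sup>2 \<partial>(lborel \<Otimes>\<^sub>M lborel)) * (\<integral>\<^sup>+z. (J (fst z) (snd z))\<^sup>2 \<partial>(lborel \<Otimes>\<^sub>M lborel))"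
    by (rule Cauchy_Schwarz_nn_integral) measurable
  also have "(\<integral>\<^sup>+z. (r (fst z) (snd z))\<^sup>2 \<partial>(lborel \<Otimes>\<^sub>M lborel)) = (\<integral>\<^sup>+a. \<integral>\<^sup>+b. (r a b)\<^sup>2 \<partial>lborel \<partial>lborel)"
    by (subst fst[of "\<lambda>a b. (r a b)\<^sup>2"]) auto
  also have "(\<integral>\<^sup>+z. (J (fst z) (snd z))\<^sup>2 \<partial>(lborel \<Otimes>\<^sub>M lborel)) = (\<integral>\<^sup>+a. \<integral>\<^sup>+b. (J a b)\<^sup>2 \<partial>lborel \<partial>lborel)"
    by (subst fst[of "\<lambda>a b. (J a b)\<^sup>2"]) auto
  finally have "(\<integral>\<^sup>+a. \<integral>\<^sup>+b. \<integral>\<^sup>+c. p b c * q a c * r a b \<partial>lborel \<partial>lborel \<partial>lborel)\<^sup>2 \<le>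
    (\<integral>\<^sup>+a. \<integral>\<^sup>+b. (r a b)\<^sup>2 \<partial>lborel \<partial>lborel) * (\<integral>\<^sup>+a. \<integral>\<^sup>+b. (J a b)\<^sup>2 \<partial>lborel \<partial>lborel)" .
  also have "\<dots> \<le> (\<integral>\<^sup>+a. \<integral>\<^sup>+b. (r a b)\<^sup>2 \<partial>lborel \<partial>lborel) * (\<integral>\<^sup>+a. \<integral>\<^sup>+b. P b * Q a \<partial>lborel \<partial>lborel)"
    by (intro mult_left_mono nn_integral_mono J) simp
  also have "(\<integral>\<^sup>+a. \<integral>\<^sup>+b. P b * Q a \<partial>lborel \<partial>lborel) = (\<integral>\<^sup>+b. P b \<partial>lborel) * (\<integral>\<^sup>+a. Q a \<partial>lborel)"
    by (simp add: nn_integral_multc nn_integral_cmult)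
  finally show ?thesis by (simp add: P_def Q_def mult_ac)
qed

text \<open>
  \<open>\<real>\<^sup>3\<close> is a space of functions on a three-element type; this map makes its Lebesgue measure available as an
  iterated integral over the three coordinates.
\<close>

definition pt :: "real \<Rightarrow> real \<Rightarrow> real \<Rightarrow> R3" where
  "pt a b c = a *\<^sub>R axis 1 1 + b *\<^sub>R axis 2 1 + c *\<^sub>R axis 3 1"

lemma pt_nth: "pt a b c $ 1 = a" "pt a b c $ 2 = b" "pt a b c $ 3 = c"
  by (simp_all add: pt_def axis_def)

lemma pt_measurable [measurable (raw)]:
  "f \<in> borel_measurable M \<Longrightarrow> g \<in> borel_measurable M \<Longrightarrow> h \<in> borel_measurable M \<Longrightarrow>
   (\<lambda>x. pt (f x) (g x) (h x)) \<in> borel_measurable M"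
  unfolding pt_def by (intro borel_measurable_add borel_measurable_scaleR borel_measurable_const)

lemma lborel_R3: "lborel = distr (lborel \<Otimes>\<^sub>M (lborel \<Otimes>\<^sub>M lborel)) borel (\<lambda>(a, b, c). pt a b c)"
proof (rule lborel_eqI)
  fix l u :: R3 assume le: "\<And>b. b \<in> Basis \<Longrightarrow> l \<bullet> b \<le> u \<bullet> b"
  have nth: "l $ i \<le> u $ i" for i using le[of "axis i 1"] by (simp add: inner_axis axis_in_Basis_iff)
  have vim: "(\<lambda>(a, b, c). pt a b c) -` box l u = {l$1<..<u$1} \<times> {l$2<..<u$2} \<times> {l$3<..<u$3}"
    by (auto simp: mem_box_cart forall_3 pt_nth)
  have "emeasure (distr (lborel \<Otimes>\<^sub>M (lborel \<Otimes>\<^sub>M lborel)) borel (\<lambda>(a, b, c). pt a b c)) (box l u)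
     = emeasure (lborel \<Otimes>\<^sub>M (lborel \<Otimes>\<^sub>M lborel)) ({l$1<..<u$1} \<times> {l$2<..<u$2} \<times> {l$3<..<u$3})"
    by (subst emeasure_distr) (auto simp: vim space_pair_measure)
  also have "\<dots> = ennreal (u$1 - l$1) * (ennreal (u$2 - l$2) * ennreal (u$3 - l$3))"
  proof -
    have "sigma_finite_measure (lborel \<Otimes>\<^sub>M lborel :: (real \<times> real) measure)"
      by (simp add: lborel_prod sigma_finite_lborel)
    then show ?thesis
      using nth by (subst sigma_finite_measure.emeasure_pair_measure_Times) (auto simp: lborel.emeasure_pair_measure_Times)
  qed
  also have "\<dots> = ennreal (\<Prod>i\<in>UNIV. (u - l) $ i)"
  proof -
    have "(\<Prod>i\<in>UNIV. (u - l) $ i) = (u$1 - l$1) * ((u$2 - l$2) * (u$3 - l$3))"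
      unfolding UNIV_3 by simp
    then show ?thesis using nth[of 1] nth[of 2] nth[of 3] by (simp only: ennreal_mult diff_ge_0_iff_ge mult_nonneg_nonneg)
  qed
  also have "(\<Prod>i\<in>UNIV. (u - l) $ i) = (\<Prod>b\<in>Basis. (u - l) \<bullet> b)"
  proof -
    have B: "(Basis :: R3 set) = (\<lambda>i. axis i 1) ` UNIV" by (auto simp: Basis_vec_def)
    have "inj (\<lambda>i::3. axis i (1::real))" by (auto simp: inj_def axis_eq_axis)
    then show ?thesis unfolding B by (subst prod.reindex) (auto simp: inner_axis)
  qed
  finally show "emeasure (distr (lborel \<Otimes>\<^sub>M (lborel \<Otimes>\<^sub>M lborel)) borel (\<lambda>(a, b, c). pt a b c)) (box l u) = ennreal (\<Prod>b\<in>Basis. (u - l) \<bullet> b)" .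
qed simp

lemma nn_integral_R3:
  fixes f :: "R3 \<Rightarrow> ennreal"
  assumes [measurable]: "f \<in> borel_measurable borel"
  shows "integral\<^sup>N lborel f = (\<integral>\<^sup>+a. \<integral>\<^sup>+b. \<integral>\<^sup>+c. f (pt a b c) \<partial>lborel \<partial>lborel \<partial>lborel)"
proof -
  have sf: "sigma_finite_measure (lborel \<Otimes>\<^sub>M lborel :: (real \<times> real) measure)"
    by (simp add: lborel_prod sigma_finite_lborel)
  have "integral\<^sup>N lborel f = (\<integral>\<^sup>+z. f (pt (fst z) (fst (snd z)) (snd (snd z))) \<partial>(lborel \<Otimes>\<^sub>M (lborel \<Otimes>\<^sub>M lborel)))"
  proof -
    have m: "(\<lambda>z. pt (fst z) (fst (snd z)) (snd (snd z))) \<in> lborel \<Otimes>\<^sub>M (lborel \<Otimes>\<^sub>M lborel) \<rightarrow>\<^sub>M borel"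
      by measurable
    have "lborel = distr (lborel \<Otimes>\<^sub>M (lborel \<Otimes>\<^sub>M lborel)) borel (\<lambda>z. pt (fst z) (fst (snd z)) (snd (snd z)))"
      using lborel_R3 unfolding case_prod_beta' .
    then have "integral\<^sup>N lborel f = integral\<^sup>N (distr (lborel \<Otimes>\<^sub>M (lborel \<Otimes>\<^sub>M lborel)) borel (\<lambda>z. pt (fst z) (fst (snd z)) (snd (snd z)))) f"
      by (rule arg_cong)
    also have "\<dots> = (\<integral>\<^sup>+z. f (pt (fst z) (fst (snd z)) (snd (snd z))) \<partial>(lborel \<Otimes>\<^sub>M (lborel \<Otimes>\<^sub>M lborel)))"
      by (rule nn_integral_distr[OF m]) simp
    finally show ?thesis .
  qed
  also have "\<dots> = (\<integral>\<^sup>+a. \<integral>\<^sup>+y. f (pt a (fst y) (snd y)) \<partial>(lborel \<Otimes>\<^sub>M lborel) \<partial>lborel)"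
    by (subst sigma_finite_measure.nn_integral_fst[OF sf, symmetric]) auto
  also have "\<dots> = (\<integral>\<^sup>+a. \<integral>\<^sup>+b. \<integral>\<^sup>+c. f (pt a b c) \<partial>lborel \<partial>lborel \<partial>lborel)"
    by (subst lborel.nn_integral_fst[symmetric]) auto
  finally show ?thesis .
qed

lemma abs_le_nn_integral_derivative:
  fixes g g' :: "real \<Rightarrow> real"
  assumes "\<And>x. (g has_real_derivative g' x) (at x)" "continuous_on UNIV g'" "\<And>x. R \<le> \<bar>x\<bar> \<Longrightarrow> g x = 0"
  shows "ennreal \<bar>g a\<bar> \<le> (\<integral>\<^sup>+x. ennreal \<bar>g' x\<bar> \<partial>lborel)"
proof -
  \<comment> \<open>A point to the left of a and of the support.\<close>
  define m where "m = min a (- \<bar>R\<bar>)"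
  have m: "m \<le> a" "g m = 0" by (auto simp: m_def intro!: assms(3))
  have c: "continuous_on {m..a} g'" using assms(2) continuous_on_subset by blast
  have [measurable]: "g' \<in> borel_measurable borel" using assms(2) borel_measurable_continuous_onI by blast
  have i: "integrable lborel (\<lambda>x. indicator {m..a} x *\<^sub>R g' x)"
    using borel_integrable_atLeastAtMost'[OF c] by (simp add: set_integrable_def)
  have "(LBINT x. indicator {m..a} x *\<^sub>R g' x) = g a - g m"
    by (rule integral_FTC_atLeastAtMost[OF m(1) _ c])
       (use assms(1) in \<open>auto intro: has_field_derivative_at_within simp: has_real_derivative_iff_has_vector_derivative[symmetric]\<close>)
  then have "ennreal \<bar>g a\<bar> = ennreal (norm (LBINT x. indicator {m..a} x *\<^sub>R g' x))" using m by simp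
  also have "\<dots> \<le> (\<integral>\<^sup>+x. ennreal (norm (indicator {m..a} x *\<^sub>R g' x)) \<partial>lborel)"
    by (rule integral_norm_bound_ennreal[OF i])
  also have "\<dots> \<le> (\<integral>\<^sup>+x. ennreal \<bar>g' x\<bar> \<partial>lborel)"
    by (intro nn_integral_mono) (auto simp: indicator_def)
  finally show ?thesis .
qed

lemma C1c_line_bound:
  fixes f :: "R3 \<Rightarrow> real"
  assumes f: "C1c f" and b: "norm b = 1"
  shows "ennreal \<bar>f (z + t *\<^sub>R b)\<bar> \<le> (\<integral>\<^sup>+s. ennreal \<bar>grad f (z + s *\<^sub>R b) \<bullet> b\<bar> \<partial>lborel)"
proof -
  note c = C1cD[OF f]
  obtain r where r: "\<And>x. r \<le> norm x \<Longrightarrow> f x = 0" using c(4) unfolding bounded_support_def by blast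
  show ?thesis
  proof (rule abs_le_nn_integral_derivative[where R="r + norm z" and g="\<lambda>s. f (z + s *\<^sub>R b)" and a=t])
    fix s
    have "((\<lambda>s. f (z + s *\<^sub>R b)) has_derivative (\<lambda>h. (h *\<^sub>R b) \<bullet> grad f (z + s *\<^sub>R b))) (at s)"
      by (rule has_derivative_compose[where f="\<lambda>s. z + s *\<^sub>R b" and g=f, simplified])
         (auto intro!: derivative_eq_intros c)
    then show "((\<lambda>s. f (z + s *\<^sub>R b)) has_real_derivative grad f (z + s *\<^sub>R b) \<bullet> b) (at s)"
      by (simp add: has_field_derivative_def mult_commute_abs inner_commute)
    show "f (z + s *\<^sub>R b) = 0" if "r + norm z \<le> \<bar>s\<bar>"
      using that b norm_diff_ineq[of "s *\<^sub>R b" z] by (intro r) (simp add: add.commute)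
  next
    show "continuous_on UNIV (\<lambda>s. grad f (z + s *\<^sub>R b) \<bullet> b)"
      by (intro continuous_intros continuous_on_compose2[OF c(3)]) auto
  qed
qed

text \<open>
  By the fundamental theorem of calculus \<open>|f|\<close> is bounded along each coordinate direction by the integral of
  \<open>|\<nabla>f|\<close> over the line.  The product of the square roots of the three bounds dominates \<open>|f|\<^sup>3\<^sup>/\<^sup>2\<close>, and each factor
  depends on two variables only, which is the situation of the Loomis-Whitney inequality.
\<close>

lemma gagliardo_nirenberg_sobolev_L1:
  fixes f :: "R3 \<Rightarrow> real"
  assumes f: "C1c f"
  shows "(\<integral>\<^sup>+x. ennreal (sqrt \<bar>f x\<bar> ^ 3) \<partial>lborel)\<^sup>2 \<le> (\<integral>\<^sup>+x. ennreal (norm (grad f x)) \<partial>lborel) ^ 3"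
proof -
  note c = C1cD[OF f]
  have [measurable]: "f \<in> borel_measurable borel" "grad f \<in> borel_measurable borel"
    using c borel_measurable_continuous_onI by blast+
  define F :: "R3 \<Rightarrow> ennreal" where "F x = ennreal (norm (grad f x))" for x
  have [measurable]: "F \<in> borel_measurable borel" unfolding F_def by measurable
  have bd: "ennreal \<bar>f (z + t *\<^sub>R axis i 1)\<bar> \<le> (\<integral>\<^sup>+s. F (z + s *\<^sub>R axis i 1) \<partial>lborel)" for z t i
  proof -
    have "ennreal \<bar>f (z + t *\<^sub>R axis i 1)\<bar> \<le> (\<integral>\<^sup>+s. ennreal \<bar>grad f (z + s *\<^sub>R axis i 1) \<bullet> axis i 1\<bar> \<partial>lborel)"
      by (rule C1c_line_bound[OF f]) simp
    also have "\<dots> \<le> (\<integral>\<^sup>+s. F (z + s *\<^sub>R axis i 1) \<partial>lborel)"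
      unfolding F_def by (intro nn_integral_mono ennreal_leI order_trans[OF Cauchy_Schwarz_ineq2]) simp
    finally show ?thesis .
  qed
  define A where "A b c = (\<integral>\<^sup>+s. F (pt s b c) \<partial>lborel)" for b c
  define B where "B a c = (\<integral>\<^sup>+s. F (pt a s c) \<partial>lborel)" for a c
  define C where "C a b = (\<integral>\<^sup>+s. F (pt a b s) \<partial>lborel)" for a b
  have [measurable]: "case_prod A \<in> borel_measurable (borel \<Otimes>\<^sub>M borel)" "case_prod B \<in> borel_measurable (borel \<Otimes>\<^sub>M borel)"
     "case_prod C \<in> borel_measurable (borel \<Otimes>\<^sub>M borel)" unfolding A_def B_def C_def by measurable
  have A: "ennreal \<bar>f (pt a b c)\<bar> \<le> A b c" for a b c
    using bd[of "pt 0 b c" a 1] by (simp add: A_def pt_def add_ac)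
  have B: "ennreal \<bar>f (pt a b c)\<bar> \<le> B a c" for a b c
    using bd[of "pt a 0 c" b 2] by (simp add: B_def pt_def add_ac)
  have C: "ennreal \<bar>f (pt a b c)\<bar> \<le> C a b" for a b c
    using bd[of "pt a b 0" c 3] by (simp add: C_def pt_def add_ac)
  have "ennreal (sqrt \<bar>f (pt a b c)\<bar> ^ 3) \<le> esqrt (A b c) * esqrt (B a c) * esqrt (C a b)" for a b c
  proof -
    have "ennreal (sqrt \<bar>f (pt a b c)\<bar> ^ 3) = ennreal (sqrt \<bar>f (pt a b c)\<bar>) * ennreal (sqrt \<bar>f (pt a b c)\<bar>) * ennreal (sqrt \<bar>f (pt a b c)\<bar>)"
      by (simp add: power3_eq_cube ennreal_mult[symmetric])
    also have "\<dots> \<le> esqrt (A b c) * esqrt (B a c) * esqrt (C a b)"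
      using A B C by (intro mult_mono le_esqrt) auto
    finally show ?thesis .
  qed
  then have "(\<integral>\<^sup>+x. ennreal (sqrt \<bar>f x\<bar> ^ 3) \<partial>lborel) \<le> (\<integral>\<^sup>+a. \<integral>\<^sup>+b. \<integral>\<^sup>+c. esqrt (A b c) * esqrt (B a c) * esqrt (C a b) \<partial>lborel \<partial>lborel \<partial>lborel)"
    by (subst nn_integral_R3) (auto intro!: nn_integral_mono)
  then have "(\<integral>\<^sup>+x. ennreal (sqrt \<bar>f x\<bar> ^ 3) \<partial>lborel)\<^sup>2 \<le> (\<integral>\<^sup>+a. \<integral>\<^sup>+b. \<integral>\<^sup>+c. esqrt (A b c) * esqrt (B a c) * esqrt (C a b) \<partial>lborel \<partial>lborel \<partial>lborel)\<^sup>2"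
    by (intro power_mono) auto
  also have "\<dots> \<le> (\<integral>\<^sup>+b. \<integral>\<^sup>+c. A b c \<partial>lborel \<partial>lborel) * (\<integral>\<^sup>+a. \<integral>\<^sup>+c. B a c \<partial>lborel \<partial>lborel) * (\<integral>\<^sup>+a. \<integral>\<^sup>+b. C a b \<partial>lborel \<partial>lborel)"
    using loomis_whitney_3[of "\<lambda>b c. esqrt (A b c)" "\<lambda>b c. esqrt (B b c)" "\<lambda>b c. esqrt (C b c)"]
    by (simp add: esqrt_power2)
  also have "(\<integral>\<^sup>+a. \<integral>\<^sup>+b. C a b \<partial>lborel \<partial>lborel) = integral\<^sup>N lborel F"
    unfolding C_def by (subst nn_integral_R3) auto
  also have "(\<integral>\<^sup>+a. \<integral>\<^sup>+c. B a c \<partial>lborel \<partial>lborel) = integral\<^sup>N lborel F"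
    unfolding B_def by (subst nn_integral_R3, simp) (intro nn_integral_cong lborel_pair.Fubini', measurable)
  also have "(\<integral>\<^sup>+b. \<integral>\<^sup>+c. A b c \<partial>lborel \<partial>lborel) = integral\<^sup>N lborel F"
  proof -
    have "(\<integral>\<^sup>+b. \<integral>\<^sup>+c. A b c \<partial>lborel \<partial>lborel) = (\<integral>\<^sup>+b. \<integral>\<^sup>+a. \<integral>\<^sup>+c. F (pt a b c) \<partial>lborel \<partial>lborel \<partial>lborel)"
      unfolding A_def by (intro nn_integral_cong lborel_pair.Fubini') measurable
    also have "\<dots> = (\<integral>\<^sup>+a. \<integral>\<^sup>+b. \<integral>\<^sup>+c. F (pt a b c) \<partial>lborel \<partial>lborel \<partial>lborel)"
      by (rule lborel_pair.Fubini') measurable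
    finally show ?thesis by (subst nn_integral_R3) auto
  qed
  finally show ?thesis by (simp add: F_def[abs_def] power3_eq_cube)
qed

text \<open>
  The \<open>L\<^sup>1\<close> inequality for \<open>f\<^sup>4\<close>, whose gradient is \<open>4 f\<^sup>3 \<nabla>f\<close>, together with Cauchy-Schwarz:
  with \<open>S = \<integral> f\<^sup>6\<close> and \<open>D = \<integral> |\<nabla>f|\<^sup>2\<close> this gives \<open>S\<^sup>4 \<le> 4\<^sup>6 (S D)\<^sup>3\<close>, and \<open>S\<^sup>3\<close> cancels.
\<close>

lemma sobolev_C1c:
  fixes f :: "R3 \<Rightarrow> real"
  assumes f: "C1c f"
  shows "(LBINT x. f x ^ 6) \<le> 4096 * (LBINT x. (norm (grad f x))\<^sup>2) ^ 3"
proof -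
  note c = C1cD[OF f]
  have f4: "C1c (\<lambda>x. f x ^ 4)"
    using C1c_mult[OF Ck_power[OF c(1), of 3] f] by (simp add: power_Suc2[symmetric] del: power_Suc)
  have g4: "grad (\<lambda>x. f x ^ 4) x = (4 * f x ^ 3) *\<^sub>R grad f x" for x
    by (rule gradI, rule has_derivative_compose_grad[OF c(5)]) (auto intro!: derivative_eq_intros)
  define S where "S = (LBINT x. f x ^ 6)"
  define D where "D = (LBINT x. (norm (grad f x))\<^sup>2)"
  define W where "W = (LBINT x. \<bar>f x ^ 3\<bar> * \<bar>norm (grad f x)\<bar>)"
  note bs = bounded_support_grad[OF c(4)]
  have b6: "bounded_support (\<lambda>x. f x ^ 6)"
    using c(4) unfolding bounded_support_def by (metis zero_power zero_less_numeral)
  have bg: "bounded_support (\<lambda>x. norm (grad f x))" "bounded_support (\<lambda>x. (norm (grad f x))\<^sup>2)"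
    using bs unfolding bounded_support_def by (metis norm_zero zero_power zero_less_numeral)+
  have i6: "integrable lborel (\<lambda>x. f x ^ 6)"
    by (intro bounded_support_integrable b6 continuous_intros c)
  have L3: "L2 (\<lambda>x. f x ^ 3)" 
    using i6 c(2) unfolding L2_def by (auto simp: power_mult[symmetric] intro!: borel_measurable_continuous_onI continuous_intros)
  have Lg: "L2 (\<lambda>x. norm (grad f x))" unfolding L2_def
    using bounded_support_integrable[OF continuous_on_power[OF continuous_on_norm[OF c(3)]] bg(2)] c(3)
    by (auto intro!: borel_measurable_continuous_onI continuous_intros)
  have W: "W\<^sup>2 \<le> S * D" unfolding W_def S_def D_def
    using Cauchy_Schwarz_integral[OF L3 Lg] by (simp add: power_mult[symmetric])
  have W0: "W \<ge> 0" "S \<ge> 0" "D \<ge> 0" unfolding W_def S_def D_def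
    by (auto intro!: integral_nonneg_AE simp: zero_le_even_power)
  have "sqrt \<bar>f x ^ 4\<bar> ^ 3 = f x ^ 6" for x
  proof -
    have "sqrt \<bar>f x ^ 4\<bar> = (f x)\<^sup>2" by (rule real_sqrt_unique) (simp_all add: power_mult[symmetric])
    then show ?thesis by (simp add: power_mult[symmetric])
  qed
  then have 1: "(\<integral>\<^sup>+x. ennreal (sqrt \<bar>f x ^ 4\<bar> ^ 3) \<partial>lborel) = ennreal S"
    unfolding S_def using nn_integral_eq_integral[OF i6] by (simp add: zero_le_even_power)
  have "integrable lborel (\<lambda>x. \<bar>f x ^ 3\<bar> * \<bar>norm (grad f x)\<bar>)"
    using L2_integrable_prod[OF L3 Lg] by simp
  then have i4: "integrable lborel (\<lambda>x. 4 * (\<bar>f x ^ 3\<bar> * \<bar>norm (grad f x)\<bar>))" by simp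
  have ng: "norm (grad (\<lambda>x. f x ^ 4) x) = 4 * (\<bar>f x ^ 3\<bar> * \<bar>norm (grad f x)\<bar>)" for x
    by (simp add: g4 abs_mult mult.assoc)
  have 2: "(\<integral>\<^sup>+x. ennreal (norm (grad (\<lambda>x. f x ^ 4) x)) \<partial>lborel) = ennreal (4 * W)"
    unfolding W_def ng using nn_integral_eq_integral[OF i4] by simp
  have "ennreal (S\<^sup>2) \<le> ennreal ((4 * W) ^ 3)"
    using gagliardo_nirenberg_sobolev_L1[OF f4] W0 unfolding 1 2 by (simp add: ennreal_power)
  then have "S\<^sup>2 \<le> (4 * W) ^ 3" using W0 by simp
  then have "(S\<^sup>2)\<^sup>2 \<le> ((4 * W) ^ 3)\<^sup>2" by (intro power_mono) auto
  also have "\<dots> = 4096 * (W\<^sup>2) ^ 3" by (simp add: power_mult_distrib power_mult[symmetric])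
  also have "\<dots> \<le> 4096 * (S * D) ^ 3" using W by (intro mult_left_mono power_mono) auto
  finally have "S ^ 3 * S \<le> S ^ 3 * (4096 * D ^ 3)"
    by (simp add: power_mult_distrib mult_ac power_mult[symmetric] power_Suc2[symmetric] eval_nat_numeral)
  \<comment> \<open>The factor S^3 can be cancelled unless S = 0, when the claim is trivial.\<close>
  moreover have ?thesis if "S = 0" using that W0 by (simp add: S_def D_def)
  ultimately show ?thesis using W0 unfolding S_def[symmetric] D_def[symmetric]
    by (cases "S = 0") (auto dest: mult_left_le_imp_le)
qed

section \<open>Limits of test functions in \<open>H\<^sup>1\<close>\<close>

lemma continuous_bounded_support_L2:
  fixes f :: "'a::euclidean_space \<Rightarrow> 'b::euclidean_space"
  assumes "continuous_on UNIV f" "bounded_support f"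
  shows "L2 f"
  unfolding L2_def
proof
  show "f \<in> borel_measurable borel" using assms(1) by (rule borel_measurable_continuous_onI)
  have "bounded_support (\<lambda>x. (norm (f x))\<^sup>2)"
    using assms(2) unfolding bounded_support_def by (metis norm_zero zero_power zero_less_numeral)
  then show "integrable lborel (\<lambda>x. (norm (f x))\<^sup>2)"
    by (intro bounded_support_integrable continuous_intros assms(1))
qed

lemma test_function_L2: "test_function f \<Longrightarrow> L2 f" "test_function f \<Longrightarrow> L2 (grad f)"
  by (intro continuous_bounded_support_L2 bounded_support_grad C1cD[OF test_functionD(3)]; assumption)+

text \<open>
  Bounded multipliers that converge almost everywhere act continuously on \<open>L\<^sup>2\<close>: the difference
  \<open>(k\<^sub>n - l) f\<close> is controlled by dominated convergence.
\<close>

lemma tendsto_L2_mult_pointwise: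
  fixes F :: "nat \<Rightarrow> 'a::euclidean_space \<Rightarrow> 'b::euclidean_space" and k :: "nat \<Rightarrow> 'a \<Rightarrow> real"
  assumes F: "tendsto_L2 F f"
    and [measurable]: "\<And>n. k n \<in> borel_measurable borel" "l \<in> borel_measurable borel"
    and K: "\<And>n x. \<bar>k n x\<bar> \<le> K" "\<And>x. \<bar>l x\<bar> \<le> K"
    and lim: "AE x in lborel. (\<lambda>n. k n x) \<longlonglongrightarrow> l x"
  shows "tendsto_L2 (\<lambda>n x. k n x *\<^sub>R F n x) (\<lambda>x. l x *\<^sub>R f x)"
proof (rule tendsto_L2_mono)
  note T = tendsto_L2D[OF F]
  have [measurable]: "f \<in> borel_measurable borel" "\<And>n. F n \<in> borel_measurable borel" using T by (auto simp: L2_def)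
  show "L2 (\<lambda>x. k n x *\<^sub>R F n x)" for n by (rule L2_bounded_scaleR[OF T(1) _ K(1)]) simp
  show "L2 (\<lambda>x. l x *\<^sub>R f x)" by (rule L2_bounded_scaleR[OF T(2) _ K(2)]) simp
  define A where "A n x = 2 * K\<^sup>2 * (norm (F n x - f x))\<^sup>2" for n x
  define B where "B n x = 2 * ((k n x - l x)\<^sup>2 * (norm (f x))\<^sup>2)" for n x
  have w: "integrable lborel (\<lambda>x. 8 * K\<^sup>2 * (norm (f x))\<^sup>2)" using L2_integrable[OF T(2)] by simp
  have kl: "(k n x - l x)\<^sup>2 \<le> 4 * K\<^sup>2" for n x
  proof -
    have "\<bar>k n x - l x\<bar> \<le> 2 * K" using K(1)[of n x] K(2)[of x] by linarith
    from power_mono[OF this, of 2] show ?thesis by (simp add: power_mult_distrib)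
  qed
  have Bw: "B n x \<le> 8 * K\<^sup>2 * (norm (f x))\<^sup>2" for n x
    using mult_right_mono[OF kl[of n x] zero_le_power2[of "norm (f x)"]] unfolding B_def by linarith
  have B0: "B n x \<ge> 0" for n x by (simp add: B_def)
  have [measurable]: "B n \<in> borel_measurable borel" for n unfolding B_def by measurable
  have iA: "integrable lborel (A n)" for n
    unfolding A_def using L2_integrable[OF L2_diff[OF T(1,2)]] by simp
  have iB: "integrable lborel (B n)" for n
    by (rule Bochner_Integration.integrable_bound[OF w]) (use Bw B0 in auto)
  show "integrable lborel (\<lambda>x. A n x + B n x)" for n using iA iB by simp
  show "(norm (k n x *\<^sub>R F n x - l x *\<^sub>R f x))\<^sup>2 \<le> A n x + B n x" for n x
  proof -
    have "k n x *\<^sub>R F n x - l x *\<^sub>R f x = k n x *\<^sub>R (F n x - f x) + (k n x - l x) *\<^sub>R f x"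
      by (simp add: algebra_simps)
    then have "(norm (k n x *\<^sub>R F n x - l x *\<^sub>R f x))\<^sup>2 \<le>
        2 * ((k n x)\<^sup>2 * (norm (F n x - f x))\<^sup>2) + 2 * ((k n x - l x)\<^sup>2 * (norm (f x))\<^sup>2)"
      using norm_sum_square_le[of "k n x *\<^sub>R (F n x - f x)" "(k n x - l x) *\<^sub>R f x"] by (simp add: power_mult_distrib)
    moreover have "(k n x)\<^sup>2 * (norm (F n x - f x))\<^sup>2 \<le> K\<^sup>2 * (norm (F n x - f x))\<^sup>2"
      using power_mono[OF K(1)[of n x], of 2] by (intro mult_right_mono) auto
    ultimately show ?thesis by (simp add: A_def B_def)
  qed
  have "(\<lambda>n. integral\<^sup>L lborel (B n)) \<longlonglongrightarrow> (\<integral>x. 0 \<partial>(lborel :: 'a measure))"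
  proof (rule integral_dominated_convergence[OF _ _ w])
    show "AE x in lborel. (\<lambda>n. B n x) \<longlonglongrightarrow> 0"
      using lim
    proof eventually_elim
      case (elim x)
      have "(\<lambda>n. 2 * ((k n x - l x)\<^sup>2 * (norm (f x))\<^sup>2)) \<longlonglongrightarrow> 2 * ((l x - l x)\<^sup>2 * (norm (f x))\<^sup>2)"
        by (intro tendsto_intros elim)
      then show ?case by (simp add: B_def)
    qed
  qed (use Bw B0 in auto)
  moreover have "(\<lambda>n. integral\<^sup>L lborel (A n)) \<longlonglongrightarrow> 0"
    unfolding A_def using tendsto_mult[OF tendsto_const[of "2 * K\<^sup>2"] T(3)] by simp
  ultimately have "(\<lambda>n. integral\<^sup>L lborel (A n) + integral\<^sup>L lborel (B n)) \<longlonglongrightarrow> 0 + 0"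
    by (intro tendsto_add) simp_all
  then show "(\<lambda>n. LBINT x. A n x + B n x) \<longlonglongrightarrow> 0" using iA iB by simp
qed

text \<open>
  Fatou's lemma, in the form in which uniform bounds pass to almost everywhere limits.
\<close>

lemma fatou_real:
  fixes F :: "nat \<Rightarrow> 'a \<Rightarrow> real"
  assumes [measurable]: "f \<in> borel_measurable M" and F: "\<And>n. integrable M (F n)" "\<And>n x. F n x \<ge> 0"
    and lim: "AE x in M. (\<lambda>n. F n x) \<longlonglongrightarrow> f x" and c: "\<And>n. integral\<^sup>L M (F n) \<le> c n" "c \<longlonglongrightarrow> C"
  shows "integrable M f" "integral\<^sup>L M f \<le> C"
proof -
  have [measurable]: "F n \<in> borel_measurable M" for n using F(1) by (rule borel_measurable_integrable)
  have c0: "c n \<ge> 0" for n using c(1)[of n] F(2) integral_nonneg_AE[of "F n" M] by (meson AE_I2 order_trans)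
  then have C0: "C \<ge> 0" using LIMSEQ_le_const[OF c(2)] by blast
  have f0: "AE x in M. f x \<ge> 0" using lim
    by eventually_elim (rule LIMSEQ_le_const, auto simp: F(2))
  have "(\<integral>\<^sup>+x. ennreal (f x) \<partial>M) = (\<integral>\<^sup>+x. liminf (\<lambda>n. ennreal (F n x)) \<partial>M)"
    by (rule nn_integral_cong_AE, use lim in eventually_elim)
       (rule sym, rule lim_imp_Liminf, auto intro: tendsto_ennrealI)
  also have "\<dots> \<le> liminf (\<lambda>n. \<integral>\<^sup>+x. ennreal (F n x) \<partial>M)"
    by (rule nn_integral_liminf) simp
  also have "\<dots> = liminf (\<lambda>n. ennreal (integral\<^sup>L M (F n)))"
    using nn_integral_eq_integral[OF F(1)] F(2) by simp
  also have "\<dots> \<le> liminf (\<lambda>n. ennreal (c n))"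
    using c(1) by (intro Liminf_mono always_eventually) (auto intro: ennreal_leI)
  also have "\<dots> = ennreal C" using c(2) by (intro lim_imp_Liminf tendsto_ennrealI) simp_all
  finally have le: "(\<integral>\<^sup>+x. ennreal (f x) \<partial>M) \<le> ennreal C" .
  show i: "integrable M f"
  proof (rule integrableI_bounded)
    have "(\<integral>\<^sup>+x. ennreal (norm (f x)) \<partial>M) = (\<integral>\<^sup>+x. ennreal (f x) \<partial>M)"
      by (rule nn_integral_cong_AE) (use f0 in eventually_elim, auto)
    then show "(\<integral>\<^sup>+x. ennreal (norm (f x)) \<partial>M) < \<infinity>" using le ennreal_less_top le_less_trans by fastforce
  qed simp
  show "integral\<^sup>L M f \<le> C" using le nn_integral_eq_integral[OF i f0] C0 by simp
qed

text \<open>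
  The closure of the test functions in \<open>H\<^sup>1\<close>, as pairs of a function and its gradient.  Everything that holds
  for test functions and is stable under \<open>L\<^sup>2\<close> limits holds for such pairs; this is easier to use than the weak
  formulation.
\<close>

definition sobolev_pair :: "(R3 \<Rightarrow> real) \<Rightarrow> (R3 \<Rightarrow> R3) \<Rightarrow> bool" where
  "sobolev_pair u G \<longleftrightarrow> (\<exists>\<psi>. (\<forall>n. test_function (\<psi> n)) \<and> tendsto_L2 \<psi> u \<and> tendsto_L2 (\<lambda>n. grad (\<psi> n)) G)"

lemma sobolev_pair_L2: "sobolev_pair u G \<Longrightarrow> L2 u" "sobolev_pair u G \<Longrightarrow> L2 G"
  unfolding sobolev_pair_def by (auto dest: tendsto_L2D(2))

lemma tendsto_L2_conv_weak:
  assumes "weak_gradient u G" "L2 G"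
  shows "tendsto_L2 (\<lambda>n. grad (conv (mollifier n) u)) G"
proof (rule tendsto_L2_vec)
  fix b :: R3 assume b: "b \<in> Basis"
  have "(\<lambda>n x. grad (conv (mollifier n) u) x \<bullet> b) = (\<lambda>n. conv (mollifier n) (\<lambda>y. G y \<bullet> b))"
    by (simp add: grad_conv_weak[OF _ assms(1) b] mollifier_smooth_kernel test_function_iff fun_eq_iff)
  moreover have "tendsto_L2 (\<lambda>n. conv (mollifier n) (\<lambda>y. G y \<bullet> b)) (\<lambda>y. G y \<bullet> b)"
    by (intro mollify_L2 L2_linear[where T="\<lambda>y. y \<bullet> b"] assms bounded_linear_inner_left)
  ultimately show "tendsto_L2 (\<lambda>n x. grad (conv (mollifier n) u) x \<bullet> b) (\<lambda>x. G x \<bullet> b)" by simp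
qed

text \<open>
  Mollify and cut off.  The cutoff contributes \<open>u \<nabla>(cutoff n)\<close> to the gradient, which tends to \<open>0\<close>
  because the cutoffs become flat.
\<close>

lemma weak_gradient_imp_sobolev_pair:
  assumes w: "weak_gradient u G" and u: "L2 u" and G: "L2 G"
  shows "sobolev_pair u G"
  unfolding sobolev_pair_def
proof (intro exI conjI allI)
  define v where "v n = conv (mollifier n) u" for n
  have vC: "Ck k (v n)" for n k unfolding v_def
    by (rule Ck_conv[OF mollifier_smooth_kernel]) (use w in \<open>simp add: weak_gradient_def\<close>)
  have cC: "Ck k (cutoff n :: R3 \<Rightarrow> real)" "bounded_support (cutoff n :: R3 \<Rightarrow> real)" for n k
    using cutoff_smooth_kernel[where 'a=R3, of n] unfolding smooth_kernel_def by auto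
  have dv: "v n differentiable at x" "cutoff n differentiable at x" for n x
    using vC[of 1 n] cC(1)[of 1 n] by auto
  have [measurable]: "(cutoff n :: R3 \<Rightarrow> real) \<in> borel_measurable borel"
     "(grad (cutoff n) :: R3 \<Rightarrow> R3) \<in> borel_measurable borel" for n
    using Ck_imp_continuous[OF cC(1)[of 0 n]] Ck_imp_continuous_grad[of 0, OF cC(1)[of "Suc 0" n]]
    by (auto intro: borel_measurable_continuous_onI)
  obtain K where K: "K > 0" "\<And>n x. \<bar>cutoff n (x::R3)\<bar> \<le> K" "\<And>n x. real (Suc n) * norm (grad (cutoff n) (x::R3)) \<le> K"
    using cutoff_bounds[where 'a=R3] by metis
  have K3: "norm (grad (cutoff n) (x::R3)) \<le> K" for n x
    using mult_right_mono[of 1 "real (Suc n)" "norm (grad (cutoff n) x)"] K(3)[of n x] by simp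
  define \<psi> where "\<psi> n x = cutoff n x * v n x" for n x
  show "test_function (\<psi> n)" for n unfolding \<psi>_def
    by (intro test_functionI Ck_mult cC vC bounded_support_mult1)
  have v: "tendsto_L2 v u" unfolding v_def by (rule mollify_L2[OF u])
  have gv: "tendsto_L2 (\<lambda>n. grad (v n)) G" unfolding v_def by (rule tendsto_L2_conv_weak[OF w G])
  have K1: "1 \<le> K"
    using LIMSEQ_le_const2[OF cutoff_tendsto[of "0::R3"]] K(2)[of _ 0] abs_ge_self order_trans by blast
  have "tendsto_L2 (\<lambda>n x. cutoff n x *\<^sub>R v n x) (\<lambda>x. 1 *\<^sub>R u x)"
    by (rule tendsto_L2_mult_pointwise[OF v _ _ K(2)]) (use K1 cutoff_tendsto in auto)
  then show "tendsto_L2 \<psi> u" by (simp add: \<psi>_def[abs_def])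
  have 1: "tendsto_L2 (\<lambda>n x. cutoff n x *\<^sub>R grad (v n) x) (\<lambda>x. 1 *\<^sub>R G x)"
    by (rule tendsto_L2_mult_pointwise[OF gv _ _ K(2)]) (use K1 cutoff_tendsto in auto)
  have 2: "tendsto_L2 (\<lambda>n x. v n x *\<^sub>R grad (cutoff n) x) (\<lambda>x. 0)"
  proof (rule tendsto_L2_vec)
    fix b :: R3 assume b: "b \<in> Basis"
    have le: "\<bar>grad (cutoff n) x \<bullet> b\<bar> \<le> norm (grad (cutoff n) x)" for n and x :: R3
      using Basis_le_norm[OF b] by simp
    have "tendsto_L2 (\<lambda>n x. (grad (cutoff n) x \<bullet> b) *\<^sub>R v n x) (\<lambda>x. 0 *\<^sub>R u x)"
    proof (rule tendsto_L2_mult_pointwise[OF v, where K=K])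
      show "\<bar>grad (cutoff n) x \<bullet> b\<bar> \<le> K" for n and x :: R3 using le K3 order_trans by blast
      have "(\<lambda>n. grad (cutoff n) x \<bullet> b) \<longlonglongrightarrow> 0" for x :: R3
        by (rule Lim_null_comparison[OF _ grad_cutoff_tendsto[of x]]) (use le in auto)
      then show "AE x::R3 in lborel. (\<lambda>n. grad (cutoff n) x \<bullet> b) \<longlonglongrightarrow> 0" by simp
    qed (use K in auto)
    then show "tendsto_L2 (\<lambda>n x. (v n x *\<^sub>R grad (cutoff n) x) \<bullet> b) (\<lambda>x. 0 \<bullet> b)"
      by (simp add: mult.commute)
  qed
  have "grad (\<psi> n) x = cutoff n x *\<^sub>R grad (v n) x + v n x *\<^sub>R grad (cutoff n) x" for n x
    unfolding \<psi>_def by (rule grad_mult[OF dv(2) dv(1)])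
  then have "(\<lambda>n. grad (\<psi> n)) = (\<lambda>n x. cutoff n x *\<^sub>R grad (v n) x + v n x *\<^sub>R grad (cutoff n) x)"
    by (simp add: fun_eq_iff)
  then show "tendsto_L2 (\<lambda>n. grad (\<psi> n)) G" using tendsto_L2_add[OF 1 2] by simp
qed

lemma test_function_sixth_int: "test_function \<psi> \<Longrightarrow> integrable lborel (\<lambda>x. \<psi> x ^ 6)"
proof -
  assume t: "test_function \<psi>"
  note c = C1cD[OF test_functionD(3)[OF t]]
  show ?thesis
  proof (rule bounded_support_integrable)
    show "continuous_on UNIV (\<lambda>x. \<psi> x ^ 6)" by (intro continuous_intros c)
    show "bounded_support (\<lambda>x. \<psi> x ^ 6)"
      using c(4) unfolding bounded_support_def by (metis zero_power zero_less_numeral)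
  qed
qed

lemma sobolev_inequality:
  assumes "sobolev_pair u G"
  shows "integrable lborel (\<lambda>x. u x ^ 6)" "(LBINT x. u x ^ 6) \<le> 4096 * (LBINT x. (norm (G x))\<^sup>2) ^ 3"
proof -
  obtain \<psi> where \<psi>: "\<And>n. test_function (\<psi> n)" "tendsto_L2 \<psi> u" "tendsto_L2 (\<lambda>n. grad (\<psi> n)) G"
    using assms unfolding sobolev_pair_def by blast
  obtain r where r: "strict_mono r" "AE x in lborel. (\<lambda>n. \<psi> (r n) x) \<longlonglongrightarrow> u x"
    using tendsto_L2_AE_subseq[OF \<psi>(2)] by blast
  note g = tendsto_L2_subseq[OF \<psi>(3) r(1)]
  have [measurable]: "u \<in> borel_measurable borel" using tendsto_L2D(2)[OF \<psi>(2)] by (simp add: L2_def)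
  have i: "integrable lborel (\<lambda>x. \<psi> n x ^ 6)" for n
    by (rule test_function_sixth_int[OF \<psi>(1)])
  have l: "AE x in lborel. (\<lambda>n. \<psi> (r n) x ^ 6) \<longlonglongrightarrow> u x ^ 6"
    using r(2) by eventually_elim (intro tendsto_intros)
  have "(\<lambda>n. 4096 * (LBINT x. grad (\<psi> (r n)) x \<bullet> grad (\<psi> (r n)) x) ^ 3) \<longlonglongrightarrow> 4096 * (LBINT x. G x \<bullet> G x) ^ 3"
    by (intro tendsto_intros tendsto_integral_inner g)
  then have c: "(\<lambda>n. 4096 * (LBINT x. (norm (grad (\<psi> (r n)) x))\<^sup>2) ^ 3) \<longlonglongrightarrow> 4096 * (LBINT x. (norm (G x))\<^sup>2) ^ 3"
    by (simp add: power2_norm_eq_inner)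
  show "integrable lborel (\<lambda>x. u x ^ 6)" "(LBINT x. u x ^ 6) \<le> 4096 * (LBINT x. (norm (G x))\<^sup>2) ^ 3"
    by (rule fatou_real[OF _ i _ l sobolev_C1c[OF test_functionD(3)[OF \<psi>(1)]] c]; simp add: zero_le_even_power)+
qed

lemma sobolev_pair_diff_test:
  assumes "sobolev_pair u G" "test_function \<psi>"
  shows "sobolev_pair (\<lambda>x. \<psi> x - u x) (\<lambda>x. grad \<psi> x - G x)"
proof -
  obtain \<eta> where \<eta>: "\<And>n. test_function (\<eta> n)" "tendsto_L2 \<eta> u" "tendsto_L2 (\<lambda>n. grad (\<eta> n)) G"
    using assms unfolding sobolev_pair_def by blast
  note neg = bounded_linear_minus[OF bounded_linear_ident]
  have "test_function (\<lambda>x. \<psi> x + - \<eta> n x)" for n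
    using test_functionD(1,2)[OF assms(2)] test_functionD(1,2)[OF \<eta>(1)[of n]] bounded_support_mult2[of "\<eta> n" "\<lambda>_. - 1"]
    by (intro test_functionI Ck_add Ck_uminus bounded_support_add) auto
  moreover have "tendsto_L2 (\<lambda>n x. \<psi> x + - \<eta> n x) (\<lambda>x. \<psi> x + - u x)"
    by (intro tendsto_L2_add tendsto_L2_const test_function_L2 assms(2) tendsto_L2_linear[OF \<eta>(2) neg])
  moreover have "tendsto_L2 (\<lambda>n x. grad \<psi> x + - grad (\<eta> n) x) (\<lambda>x. grad \<psi> x + - G x)"
    by (intro tendsto_L2_add tendsto_L2_const test_function_L2 assms(2) tendsto_L2_linear[OF \<eta>(3) neg])
  moreover have "grad (\<lambda>x. \<psi> x - \<eta> n x) = (\<lambda>x. grad \<psi> x + - grad (\<eta> n) x)" for n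
    using grad_diff[OF C1cD(5)[OF test_functionD(3)[OF assms(2)]] C1cD(5)[OF test_functionD(3)[OF \<eta>(1)[of n]]]] by (simp add: fun_eq_iff)
  ultimately show ?thesis unfolding sobolev_pair_def by (intro exI[of _ "\<lambda>n x. \<psi> x - \<eta> n x"]) simp
qed

text \<open>
  The Sobolev inequality applied to \<open>\<psi>\<^sub>n - u\<close> upgrades convergence of the gradients to convergence in
  \<open>L\<^sup>6\<close>.
\<close>

lemma sobolev_pair_approx_L6:
  assumes "sobolev_pair u G"
  obtains \<psi> where "\<And>n. test_function (\<psi> n)" "tendsto_L2 \<psi> u" "tendsto_L2 (\<lambda>n. grad (\<psi> n)) G"
    "(\<lambda>n. LBINT x. (\<psi> n x - u x) ^ 6) \<longlonglongrightarrow> 0" "\<And>n. integrable lborel (\<lambda>x. (\<psi> n x - u x) ^ 6)"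
proof -
  obtain \<psi> where \<psi>: "\<And>n. test_function (\<psi> n)" "tendsto_L2 \<psi> u" "tendsto_L2 (\<lambda>n. grad (\<psi> n)) G"
    using assms unfolding sobolev_pair_def by blast
  note p = sobolev_pair_diff_test[OF assms \<psi>(1)]
  have "(\<lambda>n. 4096 * (LBINT x. (norm (grad (\<psi> n) x - G x))\<^sup>2) ^ 3) \<longlonglongrightarrow> 4096 * 0 ^ 3"
    by (intro tendsto_intros tendsto_L2D(3)[OF \<psi>(3)])
  then have z: "(\<lambda>n. 4096 * (LBINT x. (norm (grad (\<psi> n) x - G x))\<^sup>2) ^ 3) \<longlonglongrightarrow> 0" by simp
  have "(\<lambda>n. LBINT x. (\<psi> n x - u x) ^ 6) \<longlonglongrightarrow> 0"
    by (rule tendsto_sandwich[OF _ _ tendsto_const z])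
       (auto intro!: always_eventually sobolev_inequality(2)[OF p] integral_nonneg_AE simp: zero_le_even_power)
  then show ?thesis using \<psi> sobolev_inequality(1)[OF p] that by blast
qed

text \<open>
  Composition with \<open>F\<close> keeps test functions test functions since \<open>F(0) = 0\<close>.  Along a subsequence that converges
  almost everywhere, \<open>F'(\<psi>\<^sub>n)\<close> is a bounded multiplier converging to \<open>F'(u)\<close>.
\<close>

lemma sobolev_pair_chain:
  fixes F :: "real \<Rightarrow> real"
  assumes p: "sobolev_pair u G" and F: "\<And>k. Ck k F" "F 0 = 0" and M: "\<And>s. \<bar>grad F s\<bar> \<le> M"
  shows "sobolev_pair (\<lambda>x. F (u x)) (\<lambda>x. grad F (u x) *\<^sub>R G x)"
proof -
  obtain \<eta> where \<eta>: "\<And>n. test_function (\<eta> n)" "tendsto_L2 \<eta> u" "tendsto_L2 (\<lambda>n. grad (\<eta> n)) G"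
    using p unfolding sobolev_pair_def by blast
  obtain r where r: "strict_mono r" "AE x in lborel. (\<lambda>n. \<eta> (r n) x) \<longlonglongrightarrow> u x"
    using tendsto_L2_AE_subseq[OF \<eta>(2)] by blast
  define \<psi> where "\<psi> n = \<eta> (r n)" for n
  have \<psi>: "\<And>n. test_function (\<psi> n)" "tendsto_L2 \<psi> u" "tendsto_L2 (\<lambda>n. grad (\<psi> n)) G"
    unfolding \<psi>_def using \<eta> r(1) by (auto intro: tendsto_L2_subseq)
  have dF: "F differentiable at s" for s using F(1)[of 1] by simp
  have cF: "continuous_on UNIV F" "continuous_on UNIV (grad F)"
    using Ck_imp_continuous[OF F(1)[of 0]] Ck_imp_continuous_grad[OF F(1)[of "Suc 0"]] by auto
  have [measurable]: "F \<in> borel_measurable borel" "grad F \<in> borel_measurable borel"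
    using cF borel_measurable_continuous_onI by blast+
  have [measurable]: "u \<in> borel_measurable borel" "\<And>n. \<psi> n \<in> borel_measurable borel"
    using \<psi>(2) by (auto simp: tendsto_L2_def L2_def)
  have lip: "\<bar>F s - F t\<bar> \<le> M * \<bar>s - t\<bar>" for s t
    using lipschitz_of_grad_bound[OF dF, of M s t] M by simp
  have M0: "M \<ge> 0" using M[of 0] by linarith
  have lip2: "(F s - F t)\<^sup>2 \<le> M\<^sup>2 * (s - t)\<^sup>2" for s t
    using power_mono[OF lip[of s t], of 2] by (simp add: power_mult_distrib)
  have test: "test_function (\<lambda>x. F (\<psi> n x))" for n
  proof (rule test_functionI)
    show "Ck k (\<lambda>x. F (\<psi> n x))" for k
      by (rule Ck_compose[OF F(1) test_functionD(1)[OF \<psi>(1)]])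
    show "bounded_support (\<lambda>x. F (\<psi> n x))"
      using test_functionD(2)[OF \<psi>(1)[of n]] F(2) unfolding bounded_support_def by metis
  qed
  have uL: "L2 u" using p by (rule sobolev_pair_L2)
  have FL: "L2 (\<lambda>x. F (u x))"
    by (rule L2_dominated[where g="\<lambda>x. M\<^sup>2 * (u x)\<^sup>2"])
       (use lip2[of _ 0] F(2) L2_integrable[OF uL] in auto)
  have 1: "tendsto_L2 (\<lambda>n x. F (\<psi> n x)) (\<lambda>x. F (u x))"
  proof (rule tendsto_L2_mono[where g="\<lambda>n x. M\<^sup>2 * (norm (\<psi> n x - u x))\<^sup>2"])
    show "(\<lambda>n. LBINT x. M\<^sup>2 * (norm (\<psi> n x - u x))\<^sup>2) \<longlonglongrightarrow> 0"
      using tendsto_mult[OF tendsto_const[of "M\<^sup>2"] tendsto_L2D(3)[OF \<psi>(2)]] by simp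
    show "integrable lborel (\<lambda>x. M\<^sup>2 * (norm (\<psi> n x - u x))\<^sup>2)" for n
      using L2_integrable[OF L2_diff[OF tendsto_L2D(1,2)[OF \<psi>(2)]], of n] by simp
  qed (use FL test test_function_L2 lip2 in auto)
  have 2: "tendsto_L2 (\<lambda>n x. grad F (\<psi> n x) *\<^sub>R grad (\<psi> n) x) (\<lambda>x. grad F (u x) *\<^sub>R G x)"
  proof (rule tendsto_L2_mult_pointwise[OF \<psi>(3), where K=M])
    show "AE x in lborel. (\<lambda>n. grad F (\<psi> n x)) \<longlonglongrightarrow> grad F (u x)"
      using r(2)
    proof eventually_elim
      case (elim x)
      have "isCont (grad F) (u x)" using cF(2) by (simp add: continuous_on_eq_continuous_at)
      from isCont_tendsto_compose[OF this elim] show ?case by (simp add: \<psi>_def)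
    qed
  qed (use M in auto)
  have "grad (\<lambda>x. F (\<psi> n x)) = (\<lambda>x. grad F (\<psi> n x) *\<^sub>R grad (\<psi> n) x)" for n
    using C1cD(5)[OF test_functionD(3)[OF \<psi>(1)[of n]]] dF by (simp add: fun_eq_iff grad_compose)
  then show ?thesis unfolding sobolev_pair_def using test 1 2
    by (intro exI[of _ "\<lambda>n x. F (\<psi> n x)"]) simp
qed

lemma sobolev_pair_by_parts:
  assumes p: "sobolev_pair u G" and g: "C1c g"
  shows "(LBINT x. (G x \<bullet> v) * g x) = - (LBINT x. u x * (grad g x \<bullet> v))"
proof -
  obtain \<psi> where \<psi>: "\<And>n. test_function (\<psi> n)" "tendsto_L2 \<psi> u" "tendsto_L2 (\<lambda>n. grad (\<psi> n)) G"
    using p unfolding sobolev_pair_def by blast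
  note c = C1cD[OF g]
  have L: "L2 g" "L2 (\<lambda>x. grad g x \<bullet> v)"
    by (auto intro!: continuous_bounded_support_L2 continuous_intros c bounded_support_inner1 bounded_support_grad)
  have "(\<lambda>n. LBINT x. (grad (\<psi> n) x \<bullet> v) * g x) \<longlonglongrightarrow> (LBINT x. (G x \<bullet> v) * g x)"
    by (intro tendsto_integral_mult tendsto_L2_const L tendsto_L2_linear[OF \<psi>(3)] bounded_linear_inner_left)
  moreover have "(\<lambda>n. - (LBINT x. \<psi> n x * (grad g x \<bullet> v))) \<longlonglongrightarrow> - (LBINT x. u x * (grad g x \<bullet> v))"
    by (intro tendsto_minus tendsto_integral_mult tendsto_L2_const L \<psi>(2))
  moreover have "(LBINT x. (grad (\<psi> n) x \<bullet> v) * g x) = - (LBINT x. \<psi> n x * (grad g x \<bullet> v))" for n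
    by (rule integral_by_parts[OF test_functionD(1)[OF \<psi>(1)] g])
  ultimately show ?thesis using LIMSEQ_unique by simp
qed

section \<open>Products of functions in \<open>L\<^sup>3\<close> and \<open>L\<^sup>6\<close>\<close>

text \<open>
  Hoelder's inequality with exponents \<open>3/2\<close> and \<open>3\<close>, in powers that avoid roots.  With
  \<open>X = \<integral> c\<^sup>2 b\<close> and \<open>Y = \<integral> b\<^sup>2 c\<close>, Cauchy-Schwarz gives \<open>X\<^sup>2 \<le> (\<integral> c\<^sup>3) Y\<close> and \<open>Y\<^sup>2 \<le> (\<integral> b\<^sup>3) X\<close>;
  eliminating \<open>Y\<close> gives the claim.
\<close>

lemma holder_3:
  fixes c b :: "'a::euclidean_space \<Rightarrow> real"
  assumes [measurable]: "c \<in> borel_measurable borel" "b \<in> borel_measurable borel"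
    and pos: "\<And>x. c x \<ge> 0" "\<And>x. b x \<ge> 0"
    and i: "integrable lborel (\<lambda>x. c x ^ 3)" "integrable lborel (\<lambda>x. b x ^ 3)"
  shows "integrable lborel (\<lambda>x. (c x)\<^sup>2 * b x)"
    "(LBINT x. (c x)\<^sup>2 * b x) ^ 3 \<le> (LBINT x. c x ^ 3)\<^sup>2 * (LBINT x. b x ^ 3)"
proof -
  have young: "s\<^sup>2 * t \<le> s ^ 3 + t ^ 3" if "s \<ge> 0" "t \<ge> 0" for s t :: real
  proof (cases "s \<le> t")
    case True
    then have "s\<^sup>2 * t \<le> t\<^sup>2 * t" using that by (intro mult_right_mono power_mono) auto
    then show ?thesis using that by (simp add: power3_eq_cube power2_eq_square add_increasing)
  next
    case False
    then have "s\<^sup>2 * t \<le> s\<^sup>2 * s" using that by (intro mult_left_mono) auto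
    then show ?thesis using that by (simp add: power3_eq_cube power2_eq_square add_increasing2)
  qed
  have i1: "integrable lborel (\<lambda>x. (c x)\<^sup>2 * b x)"
    by (rule Bochner_Integration.integrable_bound[OF Bochner_Integration.integrable_add[OF i]])
       (use young[OF pos(1) pos(2)] pos in auto)
  have i2: "integrable lborel (\<lambda>x. (b x)\<^sup>2 * c x)"
    by (rule Bochner_Integration.integrable_bound[OF Bochner_Integration.integrable_add[OF i(2,1)]])
       (use young[OF pos(2) pos(1)] pos in auto)
  define X where "X = (LBINT x. (c x)\<^sup>2 * b x)"
  define Y where "Y = (LBINT x. (b x)\<^sup>2 * c x)"
  define P where "P = (LBINT x. c x ^ 3)"
  define Q where "Q = (LBINT x. b x ^ 3)"
  have nn: "X \<ge> 0" "Y \<ge> 0" "P \<ge> 0" "Q \<ge> 0" unfolding X_def Y_def P_def Q_def using pos by auto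
  have step: "(LBINT x. (k x)\<^sup>2 * l x)\<^sup>2 \<le> (LBINT x. k x ^ 3) * (LBINT x. (l x)\<^sup>2 * k x)"
    if [measurable]: "k \<in> borel_measurable borel" "l \<in> borel_measurable borel"
      and p: "\<And>x. k x \<ge> 0" "\<And>x. l x \<ge> 0"
      and j: "integrable lborel (\<lambda>x. k x ^ 3)" "integrable lborel (\<lambda>x. (l x)\<^sup>2 * k x)" for k l :: "'a \<Rightarrow> real"
  proof -
    have s3: "sqrt (k x) ^ 3 = sqrt (k x) * k x" for x using p(1)[of x] by (simp add: power3_eq_cube)
    have e1: "(sqrt (k x) ^ 3)\<^sup>2 = k x ^ 3" for x
      unfolding s3 using p(1)[of x] by (simp add: power_mult_distrib power3_eq_cube power2_eq_square)
    have e2: "(sqrt (k x) * l x)\<^sup>2 = (l x)\<^sup>2 * k x" for x using p(1)[of x] by (simp add: power_mult_distrib)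
    have L: "L2 (\<lambda>x. sqrt (k x) ^ 3)" "L2 (\<lambda>x. sqrt (k x) * l x)"
      unfolding L2_def real_norm_def power2_abs e1 e2 using j by auto
    have "\<bar>sqrt (k x) ^ 3\<bar> * \<bar>sqrt (k x) * l x\<bar> = (k x)\<^sup>2 * l x" for x
      using p(1)[of x] p(2)[of x] by (simp add: s3 abs_mult power2_eq_square)
    then show ?thesis using Cauchy_Schwarz_integral[OF L] unfolding e1 e2 by simp
  qed
  have 1: "X\<^sup>2 \<le> P * Y" unfolding X_def Y_def P_def by (rule step) (use pos i i2 in auto)
  have 2: "Y\<^sup>2 \<le> Q * X" unfolding X_def Y_def Q_def by (rule step) (use pos i i1 in auto)
  have "X ^ 3 * X = (X\<^sup>2)\<^sup>2" by (simp add: power2_eq_square power3_eq_cube)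
  also have "\<dots> \<le> (P * Y)\<^sup>2" using 1 by (intro power_mono) auto
  also have "\<dots> \<le> P\<^sup>2 * (Q * X)" using 2 by (simp add: power_mult_distrib mult_left_mono)
  finally have "X ^ 3 * X \<le> P\<^sup>2 * Q * X" by (simp add: mult.assoc)
  then have "X ^ 3 \<le> P\<^sup>2 * Q" using nn by (cases "X = 0") (auto dest: mult_right_le_imp_le)
  then show "(LBINT x. (c x)\<^sup>2 * b x) ^ 3 \<le> (LBINT x. c x ^ 3)\<^sup>2 * (LBINT x. b x ^ 3)"
    unfolding X_def P_def Q_def .
  show "integrable lborel (\<lambda>x. (c x)\<^sup>2 * b x)" by (rule i1)
qed

lemma L3_mult_L6:
  fixes g h :: "'a::euclidean_space \<Rightarrow> real"
  assumes [measurable]: "g \<in> borel_measurable borel" "h \<in> borel_measurable borel"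
    and i: "integrable lborel (\<lambda>x. \<bar>g x\<bar> ^ 3)" "integrable lborel (\<lambda>x. h x ^ 6)"
  shows "L2 (\<lambda>x. g x * h x)" "(LBINT x. (g x * h x)\<^sup>2) ^ 3 \<le> (LBINT x. \<bar>g x\<bar> ^ 3)\<^sup>2 * (LBINT x. h x ^ 6)"
proof -
  have h6: "((h x)\<^sup>2) ^ 3 = h x ^ 6" for x by (simp add: power_mult[symmetric])
  have e: "(\<bar>g x\<bar>)\<^sup>2 * (h x)\<^sup>2 = (g x * h x)\<^sup>2" for x by (simp add: power_mult_distrib)
  have "integrable lborel (\<lambda>x. (\<bar>g x\<bar>)\<^sup>2 * (h x)\<^sup>2)"
    by (rule holder_3(1)) (use i h6 in auto)
  then show "L2 (\<lambda>x. g x * h x)" unfolding L2_def e by (simp add: power_mult_distrib)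
  have "(LBINT x. (\<bar>g x\<bar>)\<^sup>2 * (h x)\<^sup>2) ^ 3 \<le> (LBINT x. \<bar>g x\<bar> ^ 3)\<^sup>2 * (LBINT x. ((h x)\<^sup>2) ^ 3)"
    by (rule holder_3(2)) (use i h6 in auto)
  then show "(LBINT x. (g x * h x)\<^sup>2) ^ 3 \<le> (LBINT x. \<bar>g x\<bar> ^ 3)\<^sup>2 * (LBINT x. h x ^ 6)"
    unfolding e h6 .
qed

text \<open>
  Multiplication by an \<open>L\<^sup>3\<close> function maps \<open>L\<^sup>6\<close> continuously to \<open>L\<^sup>2\<close>.  All limits in the nonlinear terms of the
  system are taken in this form.
\<close>

lemma tendsto_L2_mult_L6:
  fixes g h :: "'a::euclidean_space \<Rightarrow> real"
  assumes g: "g \<in> borel_measurable borel" "integrable lborel (\<lambda>x. \<bar>g x\<bar> ^ 3)"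
    and h: "h \<in> borel_measurable borel" "integrable lborel (\<lambda>x. h x ^ 6)"
    and H: "\<And>n. H n \<in> borel_measurable borel" "\<And>n. integrable lborel (\<lambda>x. H n x ^ 6)"
       "\<And>n. integrable lborel (\<lambda>x. (H n x - h x) ^ 6)"
       "(\<lambda>n. LBINT x. (H n x - h x) ^ 6) \<longlonglongrightarrow> 0"
  shows "tendsto_L2 (\<lambda>n x. g x * H n x) (\<lambda>x. g x * h x)"
  unfolding tendsto_L2_def
proof (intro conjI allI L3_mult_L6 g h H)
  define J where "J n = (LBINT x. (norm (g x * H n x - g x * h x))\<^sup>2)" for n
  have J0: "0 \<le> J n" for n by (simp add: J_def)
  have le: "J n ^ 3 \<le> (LBINT x. \<bar>g x\<bar> ^ 3)\<^sup>2 * (LBINT x. (H n x - h x) ^ 6)" for n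
    using L3_mult_L6(2)[OF g(1) _ g(2) H(3)[of n]] g h H(1)[of n]
    by (simp add: J_def right_diff_distrib[symmetric])
  have lim: "(\<lambda>n. (LBINT x. \<bar>g x\<bar> ^ 3)\<^sup>2 * (LBINT x. (H n x - h x) ^ 6)) \<longlonglongrightarrow> 0"
    using tendsto_mult[OF tendsto_const H(4)] by simp
  have "(\<lambda>n. J n ^ 3) \<longlonglongrightarrow> 0"
    by (rule tendsto_sandwich[OF always_eventually always_eventually tendsto_const lim]) (simp_all add: le J0)
  then have "(\<lambda>n. root 3 (J n ^ 3)) \<longlonglongrightarrow> root 3 0" by (rule tendsto_real_root)
  then have "J \<longlonglongrightarrow> 0" by (simp add: odd_real_root_power_cancel)
  then show "(\<lambda>n. LBINT x. (norm (g x * H n x - g x * h x))\<^sup>2) \<longlonglongrightarrow> 0" by (simp add: J_def[abs_def])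
qed

lemma abs_power_interpolate: "\<bar>s::real\<bar> ^ k \<le> \<bar>s\<bar> ^ a + \<bar>s\<bar> ^ b" if "a \<le> k" "k \<le> b"
proof (cases "\<bar>s\<bar> \<le> 1")
  case True
  then have "\<bar>s\<bar> ^ k \<le> \<bar>s\<bar> ^ a" using that by (intro power_decreasing) auto
  then show ?thesis by (simp add: add_increasing2)
next
  case False
  then have "\<bar>s\<bar> ^ k \<le> \<bar>s\<bar> ^ b" using that by (intro power_increasing) auto
  then show ?thesis by (simp add: add_increasing)
qed

lemma sum_cubed_le: "(s + t) ^ 3 \<le> 4 * (s ^ 3 + t ^ 3)" if "s \<ge> 0" "t \<ge> 0" for s t :: real
proof -
  have "0 \<le> 3 * (s + t) * (s - t)\<^sup>2" using that by simp
  then show ?thesis by (simp add: power2_eq_square power3_eq_cube algebra_simps)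
qed

lemma sixth_power_sum: "(a + b :: real) ^ 6 \<le> 32 * (a ^ 6 + b ^ 6)"
proof -
  have "(a + b)\<^sup>2 \<le> 2 * (a\<^sup>2 + b\<^sup>2)" using zero_le_power2[of "a - b"] by (simp add: power2_sum power2_diff)
  then have "((a + b)\<^sup>2) ^ 3 \<le> (2 * (a\<^sup>2 + b\<^sup>2)) ^ 3" by (rule power_mono) simp
  also have "\<dots> = 8 * (a\<^sup>2 + b\<^sup>2) ^ 3" unfolding power_mult_distrib by simp
  also have "(a\<^sup>2 + b\<^sup>2) ^ 3 \<le> 4 * ((a\<^sup>2) ^ 3 + (b\<^sup>2) ^ 3)"
    by (rule sum_cubed_le) simp_all
  finally show ?thesis by (simp add: power_mult[symmetric])
qed

lemma sixth_power_diff_int: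
  assumes [measurable]: "f \<in> borel_measurable borel" "g \<in> borel_measurable borel"
    and i: "integrable lborel (\<lambda>x::R3. f x ^ 6)" "integrable lborel (\<lambda>x. g x ^ 6)"
  shows "integrable lborel (\<lambda>x. (f x - g x) ^ 6 :: real)"
proof (rule Bochner_Integration.integrable_bound)
  show "integrable lborel (\<lambda>x. 32 * (f x ^ 6 + g x ^ 6))" using i by simp
  show "AE x in lborel. norm ((f x - g x) ^ 6) \<le> norm (32 * (f x ^ 6 + g x ^ 6))"
    using sixth_power_sum[of "f _" "- g _"] by (intro AE_I2) (simp add: zero_le_even_power abs_of_nonneg)
qed simp

section \<open>Functions in \<open>D\<^sup>1\<^sup>,\<^sup>2\<close>\<close>

text \<open>
  A Borel representative \<open>\<phi>\<close> of an element of \<open>D\<^sup>1\<^sup>,\<^sup>2\<close> with the approximating test functions \<open>\<eta>\<^sub>n\<close> and the limit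
  \<open>G\<phi>\<close> of their gradients.
\<close>

locale d12_function =
  fixes \<phi> :: "R3 \<Rightarrow> real" and G\<phi> :: "R3 \<Rightarrow> R3" and \<eta> :: "nat \<Rightarrow> R3 \<Rightarrow> real"
  assumes \<phi>_meas [measurable]: "\<phi> \<in> borel_measurable borel"
    and \<phi>6: "integrable lborel (\<lambda>x. \<phi> x ^ 6)"
    and \<eta>_test: "\<And>n. test_function (\<eta> n)"
    and \<eta>_grad: "tendsto_L2 (\<lambda>n. grad (\<eta> n)) G\<phi>"
    and \<eta>_L6: "(\<lambda>n. LBINT x. (\<eta> n x - \<phi> x) ^ 6) \<longlonglongrightarrow> 0"
begin

lemma G\<phi>_L2: "L2 G\<phi>" using \<eta>_grad by (rule tendsto_L2D)

lemma G\<phi>_meas [measurable]: "G\<phi> \<in> borel_measurable borel" using G\<phi>_L2 by (simp add: L2_def)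

lemma \<eta>_meas [measurable]: "\<eta> n \<in> borel_measurable borel"
  using test_function_L2(1)[OF \<eta>_test] by (simp add: L2_def)

lemma \<eta>_mult_tendsto:
  assumes [measurable]: "g \<in> borel_measurable borel" and g: "integrable lborel (\<lambda>x. \<bar>g x\<bar> ^ 3)"
  shows "tendsto_L2 (\<lambda>n x. g x * \<eta> n x) (\<lambda>x. g x * \<phi> x)"
  by (rule tendsto_L2_mult_L6[OF assms \<phi>_meas \<phi>6 \<eta>_meas test_function_sixth_int[OF \<eta>_test]
        sixth_power_diff_int[OF \<eta>_meas \<phi>_meas test_function_sixth_int[OF \<eta>_test] \<phi>6] \<eta>_L6])

text \<open>
  Functions in \<open>D\<^sup>1\<^sup>,\<^sup>2\<close> need not be square integrable, hence need not form a \<open>sobolev_pair\<close> with their gradient; the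
  inequality is obtained directly from the approximating test functions, by Fatou's lemma.
\<close>

lemma sobolev_\<phi>: "(LBINT x. \<phi> x ^ 6) \<le> 4096 * (LBINT x. (norm (G\<phi> x))\<^sup>2) ^ 3"
proof -
  have i: "integrable lborel (\<lambda>x. (\<eta> n x - \<phi> x) ^ 6)" for n
    by (rule sixth_power_diff_int[OF \<eta>_meas \<phi>_meas test_function_sixth_int[OF \<eta>_test] \<phi>6])
  have "\<exists>r. strict_mono r \<and> (AE x in lborel. (\<lambda>n. (\<eta> (r n) x - \<phi> x) ^ 6) \<longlonglongrightarrow> 0)"
    by (rule tendsto_L1_AE_subseq) (use i \<eta>_L6 in \<open>auto simp: zero_le_even_power\<close>)
  then obtain r where r: "strict_mono r" "AE x in lborel. (\<lambda>n. (\<eta> (r n) x - \<phi> x) ^ 6) \<longlonglongrightarrow> 0" by blast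
  have l: "AE x in lborel. (\<lambda>n. \<eta> (r n) x ^ 6) \<longlonglongrightarrow> \<phi> x ^ 6"
    using r(2)
  proof eventually_elim
    case (elim x)
    have "(\<lambda>n. root 6 ((\<eta> (r n) x - \<phi> x) ^ 6)) \<longlonglongrightarrow> root 6 0" by (rule tendsto_real_root[OF elim])
    moreover have "root 6 (s ^ 6) = \<bar>s\<bar>" for s :: real
      using real_root_power_cancel[of 6 "\<bar>s\<bar>"] by (simp add: power_even_abs)
    ultimately have "(\<lambda>n. \<bar>\<eta> (r n) x - \<phi> x\<bar>) \<longlonglongrightarrow> 0" by simp
    then have "(\<lambda>n. \<eta> (r n) x) \<longlonglongrightarrow> \<phi> x" using LIM_zero_cancel tendsto_rabs_zero_iff by blast
    then show ?case by (intro tendsto_intros)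
  qed
  note g = tendsto_L2_subseq[OF \<eta>_grad r(1)]
  have "(\<lambda>n. 4096 * (LBINT x. grad (\<eta> (r n)) x \<bullet> grad (\<eta> (r n)) x) ^ 3) \<longlonglongrightarrow> 4096 * (LBINT x. G\<phi> x \<bullet> G\<phi> x) ^ 3"
    by (intro tendsto_intros tendsto_integral_inner g)
  then have c: "(\<lambda>n. 4096 * (LBINT x. (norm (grad (\<eta> (r n)) x))\<^sup>2) ^ 3) \<longlonglongrightarrow> 4096 * (LBINT x. (norm (G\<phi> x))\<^sup>2) ^ 3"
    by (simp add: power2_norm_eq_inner)
  show ?thesis
    by (rule fatou_real(2)[OF _ test_function_sixth_int[OF \<eta>_test] _ l sobolev_C1c[OF test_functionD(3)[OF \<eta>_test]] c])
       (simp_all add: zero_le_even_power)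
qed

lemma \<phi>_weak_gradient: "weak_gradient \<phi> G\<phi>"
  unfolding weak_gradient_def
proof (intro conjI ballI allI impI)
  show "loc_int (\<lambda>x. G\<phi> x \<bullet> b)" for b
    by (intro L2_loc_int L2_linear[OF G\<phi>_L2] bounded_linear_inner_left)
  show "loc_int \<phi>"
    unfolding loc_int_def
  proof (intro conjI allI)
    fix r
    have "integrable lborel (\<lambda>x::R3. \<bar>indicator (cball 0 r) x :: real\<bar> ^ 3)"
    proof -
      have "\<bar>indicator (cball 0 r) x :: real\<bar> ^ 3 = (norm (indicator (cball 0 r) x :: real))\<^sup>2" for x :: R3
        by (simp add: indicator_def)
      then show ?thesis using L2_integrable[OF indicator_ball_L2[of r]] by simp
    qed
    then have "L2 (\<lambda>x. indicator (cball 0 r) x * \<phi> x)" by (intro L3_mult_L6(1) \<phi>6 \<phi>_meas borel_measurable_indicator) simp_all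
    from integrable_mult_L2[OF indicator_ball_L2[of r] this]
    show "integrable lborel (\<lambda>x. indicator (cball 0 r) x * \<phi> x)" by (simp add: mult.assoc[symmetric] flip: indicator_inter_arith)
  qed simp
  fix \<psi> and b :: R3 assume t: "test_function \<psi>" and b: "b \<in> Basis"
  define k where "k x = grad \<psi> x \<bullet> b" for x
  have tk: "test_function k" unfolding k_def by (rule test_function_grad[OF t b])
  obtain r where r: "\<And>x. r \<le> norm x \<Longrightarrow> k x = 0" using test_functionD(2)[OF tk] unfolding bounded_support_def by blast
  have ik: "k x = indicator (cball 0 r) x * k x" for x using r[of x] by (cases "norm x \<le> r") auto
  have k3: "integrable lborel (\<lambda>x. \<bar>k x\<bar> ^ 3)"
  proof (rule bounded_support_integrable)
    show "continuous_on UNIV (\<lambda>x. \<bar>k x\<bar> ^ 3)" by (intro continuous_intros C1cD[OF test_functionD(3)[OF tk]])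
    show "bounded_support (\<lambda>x. \<bar>k x\<bar> ^ 3)" unfolding bounded_support_def using r by (intro exI[of _ r]) simp
  qed
  have km: "k \<in> borel_measurable borel" using test_function_L2(1)[OF tk] by (simp add: L2_def)
  \<comment> \<open>The products of k with the approximations converge in L^2; pairing them with the indicator of a ball containing the support of k recovers their integrals.\<close>
  have "(\<lambda>n. LBINT x. indicator (cball 0 r) x * (k x * \<eta> n x)) \<longlonglongrightarrow> (LBINT x. indicator (cball 0 r) x * (k x * \<phi> x))"
    by (intro tendsto_integral_mult tendsto_L2_const indicator_ball_L2 \<eta>_mult_tendsto km k3)
  then have 1: "(\<lambda>n. LBINT x. \<eta> n x * k x) \<longlonglongrightarrow> (LBINT x. \<phi> x * k x)"
    unfolding mult.assoc[symmetric] ik[symmetric] by (simp add: mult.commute)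
  have 2: "(\<lambda>n. - (LBINT x. \<psi> x * (grad (\<eta> n) x \<bullet> b))) \<longlonglongrightarrow> - (LBINT x. \<psi> x * (G\<phi> x \<bullet> b))"
    by (intro tendsto_minus tendsto_integral_mult tendsto_L2_const test_function_L2 t tendsto_L2_linear[OF \<eta>_grad] bounded_linear_inner_left)
  have "(LBINT x. \<eta> n x * k x) = - (LBINT x. \<psi> x * (grad (\<eta> n) x \<bullet> b))" for n
    using integral_by_parts[OF test_functionD(1)[OF \<eta>_test] test_functionD(3)[OF t], of n b]
    by (simp add: k_def mult.commute)
  with LIMSEQ_unique[OF 1] 2 show "(LBINT x. \<phi> x * (grad \<psi> x \<bullet> b)) = - (LBINT x. \<psi> x * (G\<phi> x \<bullet> b))"
    by (simp add: k_def)
qed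

end

section \<open>Energy identities for the system\<close>

text \<open>
  The situation of the theorem after all functions have been replaced by Borel representatives and the weak
  gradients identified.
\<close>

locale schroedinger_poisson = d12_function \<phi> G\<phi> \<eta>
  for \<phi> :: "R3 \<Rightarrow> real" and G\<phi> :: "R3 \<Rightarrow> R3" and \<eta> :: "nat \<Rightarrow> R3 \<Rightarrow> real" +
  fixes V u :: "R3 \<Rightarrow> real" and Gu :: "R3 \<Rightarrow> R3" and C1 C2 C3 :: real
  assumes C1_pos: "C1 > 0" and V_bounds: "\<And>x. C1 \<le> V x" "\<And>x. V x \<le> C2"
    and V_C1: "Ck 1 V"
    and V_radial: "\<And>x. 0 \<le> grad V x \<bullet> x" "\<And>x. grad V x \<bullet> x \<le> C3"
    and u_pair: "sobolev_pair u Gu"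
    and eq_u: "\<And>\<psi>. test_function \<psi> \<Longrightarrow>
       (LBINT x. Gu x \<bullet> grad \<psi> x + V x * u x * \<psi> x + \<phi> x * u x * \<psi> x) = (LBINT x. u x ^ 5 * \<psi> x)"
    and eq_\<phi>: "\<And>\<psi>. test_function \<psi> \<Longrightarrow> (LBINT x. G\<phi> x \<bullet> grad \<psi> x) = (LBINT x. (u x)\<^sup>2 * \<psi> x)"
begin

lemma V_abs: "\<bar>V x\<bar> \<le> C2"
  using V_bounds(1)[of x] V_bounds(2)[of x] C1_pos by linarith

lemma V_meas [measurable]: "V \<in> borel_measurable borel"
  using Ck_imp_continuous[OF V_C1] by (rule borel_measurable_continuous_onI)

lemma u_L2: "L2 u" and Gu_L2: "L2 Gu"
  using sobolev_pair_L2[OF u_pair] by auto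

lemma u_meas [measurable]: "u \<in> borel_measurable borel" and Gu_meas [measurable]: "Gu \<in> borel_measurable borel"
  using u_L2 Gu_L2 by (auto simp: L2_def)

lemma u2_int: "integrable lborel (\<lambda>x. (u x)\<^sup>2)" using L2_integrable[OF u_L2] by simp

lemma u6_int: "integrable lborel (\<lambda>x. u x ^ 6)" using sobolev_inequality[OF u_pair] by simp

lemma u_power_int: "2 \<le> k \<Longrightarrow> k \<le> 6 \<Longrightarrow> integrable lborel (\<lambda>x. \<bar>u x\<bar> ^ k)"
proof -
  assume k: "2 \<le> k" "k \<le> 6"
  have "integrable lborel (\<lambda>x. \<bar>u x\<bar> ^ 2 + \<bar>u x\<bar> ^ 6)" using u2_int u6_int by (simp add: power_even_abs)
  then show ?thesis
  proof (rule Bochner_Integration.integrable_bound)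
    have "norm (\<bar>u x\<bar> ^ k) \<le> norm (\<bar>u x\<bar> ^ 2 + \<bar>u x\<bar> ^ 6)" for x
      using order_trans[OF abs_power_interpolate[OF k, of "u x"] abs_ge_self] by simp
    then show "AE x in lborel. norm (\<bar>u x\<bar> ^ k) \<le> norm (\<bar>u x\<bar> ^ 2 + \<bar>u x\<bar> ^ 6)" by blast
  qed simp
qed

lemma u_square_L2: "L2 (\<lambda>x. (u x)\<^sup>2)"
  using u_power_int[of 4] unfolding L2_def by (auto simp: power_mult[symmetric] power_even_abs)

lemma u_cube_L2: "L2 (\<lambda>x. u x ^ 3)"
  using u6_int unfolding L2_def by (auto simp: power_mult[symmetric])

lemma \<phi>u_L2: "L2 (\<lambda>x. \<phi> x * u x)"
  using L3_mult_L6(1)[OF u_meas \<phi>_meas u_power_int[of 3] \<phi>6] by (simp add: mult.commute)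

lemma Vu_L2: "L2 (\<lambda>x. V x * u x)"
  by (rule L2_bounded_mult[OF u_L2 _ V_abs]) simp

lemma \<phi>u2_int: "integrable lborel (\<lambda>x. \<phi> x * (u x)\<^sup>2)"
  using integrable_mult_L2[OF \<phi>u_L2 u_L2] by (simp add: power2_eq_square mult.assoc)

text \<open>
  For \<open>\<psi>\<^sub>n \<rightarrow> w\<close> in \<open>L\<^sup>6\<close> the products \<open>u\<^sup>2 \<psi>\<^sub>n\<close> converge in \<open>L\<^sup>2\<close>, and \<open>u\<^sup>3\<close> lies in \<open>L\<^sup>2\<close>; so the critical term
  \<open>u\<^sup>5 \<psi>\<^sub>n\<close> passes to the limit.
\<close>

lemma eq_u_extended:
  assumes "sobolev_pair w Gw"
  shows "(LBINT x. Gu x \<bullet> Gw x) + (LBINT x. V x * u x * w x) + (LBINT x. \<phi> x * u x * w x)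
     = (LBINT x. u x ^ 5 * w x)"
proof -
  obtain \<psi> where \<psi>: "\<And>n. test_function (\<psi> n)" "tendsto_L2 \<psi> w" "tendsto_L2 (\<lambda>n. grad (\<psi> n)) Gw"
    "(\<lambda>n. LBINT x. (\<psi> n x - w x) ^ 6) \<longlonglongrightarrow> 0" "\<And>n. integrable lborel (\<lambda>x. (\<psi> n x - w x) ^ 6)"
  proof (rule sobolev_pair_approx_L6[OF assms])
    fix \<psi> assume "\<And>n. test_function (\<psi> n)" "tendsto_L2 \<psi> w" "tendsto_L2 (\<lambda>n. grad (\<psi> n)) Gw"
    "(\<lambda>n. LBINT x. (\<psi> n x - w x) ^ 6) \<longlonglongrightarrow> 0" "\<And>n. integrable lborel (\<lambda>x. (\<psi> n x - w x) ^ 6)"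
    then show thesis by (rule that)
  qed
  have [measurable]: "w \<in> borel_measurable borel" "\<And>n. \<psi> n \<in> borel_measurable borel"
    using tendsto_L2D[OF \<psi>(2)] by (auto simp: L2_def)
  have u6: "integrable lborel (\<lambda>x. \<bar>(u x)\<^sup>2\<bar> ^ 3)" using u6_int by (simp add: power_mult[symmetric])
  have T: "tendsto_L2 (\<lambda>n x. (u x)\<^sup>2 * \<psi> n x) (\<lambda>x. (u x)\<^sup>2 * w x)"
    by (rule tendsto_L2_mult_L6[OF _ u6 _ sobolev_inequality(1)[OF assms] _ test_function_sixth_int[OF \<psi>(1)] \<psi>(5) \<psi>(4)])
       simp_all
  have u5: "u x ^ 5 * t = u x ^ 3 * ((u x)\<^sup>2 * t)" for x t by (simp add: power2_eq_square power3_eq_cube eval_nat_numeral)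
  have "(\<lambda>n. (LBINT x. Gu x \<bullet> grad (\<psi> n) x) + (LBINT x. V x * u x * \<psi> n x) + (LBINT x. \<phi> x * u x * \<psi> n x))
     \<longlonglongrightarrow> (LBINT x. Gu x \<bullet> Gw x) + (LBINT x. V x * u x * w x) + (LBINT x. \<phi> x * u x * w x)"
    by (intro tendsto_add tendsto_integral_mult tendsto_integral_inner tendsto_L2_const Gu_L2 Vu_L2 \<phi>u_L2 \<psi>)
  moreover have "(\<lambda>n. LBINT x. u x ^ 5 * \<psi> n x) \<longlonglongrightarrow> (LBINT x. u x ^ 5 * w x)"
    unfolding u5 by (intro tendsto_integral_mult tendsto_L2_const u_cube_L2 T)
  moreover have "(LBINT x. Gu x \<bullet> grad (\<psi> n) x) + (LBINT x. V x * u x * \<psi> n x) + (LBINT x. \<phi> x * u x * \<psi> n x)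
     = (LBINT x. u x ^ 5 * \<psi> n x)" for n
    unfolding eq_u[OF \<psi>(1), symmetric]
    using integrable_inner_L2[OF Gu_L2 test_function_L2(2)[OF \<psi>(1)[of n]]]
      integrable_mult_L2[OF Vu_L2 test_function_L2(1)[OF \<psi>(1)[of n]]]
      integrable_mult_L2[OF \<phi>u_L2 test_function_L2(1)[OF \<psi>(1)[of n]]] by simp
  ultimately show ?thesis using LIMSEQ_unique by simp
qed

lemma nehari_u:
  "(LBINT x. (norm (Gu x))\<^sup>2) + (LBINT x. V x * (u x)\<^sup>2) + (LBINT x. \<phi> x * (u x)\<^sup>2) = (LBINT x. u x ^ 6)"
proof -
  have e1: "u x ^ 5 * u x = u x ^ 6" for x by (simp add: eval_nat_numeral)
  have e2: "V x * u x * u x = V x * (u x)\<^sup>2" "\<phi> x * u x * u x = \<phi> x * (u x)\<^sup>2" for x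
    by (simp_all add: power2_eq_square)
  show ?thesis using eq_u_extended[OF u_pair] unfolding e1 e2 power2_norm_eq_inner .
qed

lemma nehari_\<phi>: "(LBINT x. (norm (G\<phi> x))\<^sup>2) = (LBINT x. \<phi> x * (u x)\<^sup>2)"
proof -
  have T: "tendsto_L2 (\<lambda>n x. u x * \<eta> n x) (\<lambda>x. u x * \<phi> x)"
    by (rule \<eta>_mult_tendsto[OF u_meas u_power_int]) simp_all
  have e: "(u x)\<^sup>2 * t = u x * (u x * t)" for x t by (simp add: power2_eq_square)
  have "(\<lambda>n. LBINT x. G\<phi> x \<bullet> grad (\<eta> n) x) \<longlonglongrightarrow> (LBINT x. G\<phi> x \<bullet> G\<phi> x)"
    by (intro tendsto_integral_inner tendsto_L2_const G\<phi>_L2 \<eta>_grad)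
  moreover have "(\<lambda>n. LBINT x. (u x)\<^sup>2 * \<eta> n x) \<longlonglongrightarrow> (LBINT x. (u x)\<^sup>2 * \<phi> x)"
    unfolding e by (intro tendsto_integral_mult tendsto_L2_const u_L2 T)
  ultimately have "(LBINT x. G\<phi> x \<bullet> G\<phi> x) = (LBINT x. (u x)\<^sup>2 * \<phi> x)"
    using LIMSEQ_unique eq_\<phi>[OF \<eta>_test] by simp
  then show ?thesis by (simp add: power2_norm_eq_inner mult.commute)
qed

end

section \<open>Higher integrability\<close>

lemma Ck_id: "Ck k (\<lambda>s::real. s)"
  using Ck_inner_const[of k "1::real"] by simp

text \<open>
  A truncation of \<open>s\<^sup>3\<close> that is smooth and has a bounded derivative for \<open>d > 0\<close>, so that composing it with \<open>u\<close> gives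
  an admissible test function.  Its companion \<open>trunc_square\<close> is chosen such that
  \<open>(trunc_square d s)\<^sup>2 = s trunc_cube d s\<close> and \<open>trunc_square'\<^sup>2 \<le> 2 trunc_cube'\<close>, as for \<open>s\<^sup>2\<close> and \<open>s\<^sup>3\<close>.
\<close>

definition trunc_cube :: "real \<Rightarrow> real \<Rightarrow> real" where
  "trunc_cube d s = s ^ 3 * inverse (1 + d * s\<^sup>2)"

definition trunc_square :: "real \<Rightarrow> real \<Rightarrow> real" where
  "trunc_square d s = s\<^sup>2 * inverse (sqrt (1 + d * s\<^sup>2))"

context
  fixes d :: real
  assumes d: "d > 0"
begin

lemma one_plus_pos: "1 + d * s\<^sup>2 > 0"
  using d by (simp add: add_pos_nonneg)

lemma Ck_quadratic: "Ck k (\<lambda>s::real. 1 + d * s\<^sup>2)"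
  by (intro Ck_add Ck_const Ck_cmult Ck_power Ck_id)

lemma Ck_trunc_cube: "Ck k (trunc_cube d)"
proof -
  have ne: "1 + d * s\<^sup>2 \<noteq> 0" for s using one_plus_pos[of s] by simp
  have "Ck k (\<lambda>s. inverse (1 + d * s\<^sup>2))"
    by (intro Ck_inverse Ck_quadratic ne)
  then show ?thesis unfolding trunc_cube_def[abs_def] by (intro Ck_mult Ck_power Ck_id)
qed

lemma Ck_trunc_square: "Ck k (trunc_square d)"
proof -
  have ne: "sqrt (1 + d * s\<^sup>2) \<noteq> 0" for s using one_plus_pos[of s] by simp
  have "Ck k (\<lambda>s. inverse (sqrt (1 + d * s\<^sup>2)))"
    by (intro Ck_inverse Ck_sqrt Ck_quadratic one_plus_pos ne)
  then show ?thesis unfolding trunc_square_def[abs_def] by (intro Ck_mult Ck_power Ck_id)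
qed

lemma grad_trunc_cube: "grad (trunc_cube d) s = s\<^sup>2 * (3 + d * s\<^sup>2) / (1 + d * s\<^sup>2)\<^sup>2"
proof (rule grad_real)
  have ne: "1 + d * s\<^sup>2 \<noteq> 0" using one_plus_pos[of s] by simp
  have "(trunc_cube d has_real_derivative
     (3 * s\<^sup>2) * inverse (1 + d * s\<^sup>2) + s ^ 3 * (- (inverse (1 + d * s\<^sup>2) * (d * (2 * s)) * inverse (1 + d * s\<^sup>2)))) (at s)"
    unfolding trunc_cube_def[abs_def] using ne
    by (auto intro!: derivative_eq_intros simp: power2_eq_square)
  also have "(3 * s\<^sup>2) * inverse (1 + d * s\<^sup>2) + s ^ 3 * (- (inverse (1 + d * s\<^sup>2) * (d * (2 * s)) * inverse (1 + d * s\<^sup>2)))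
    = s\<^sup>2 * (3 + d * s\<^sup>2) / (1 + d * s\<^sup>2)\<^sup>2"
  proof -
    have "(3 * s\<^sup>2) * inverse q + s ^ 3 * (- (inverse q * (d * (2 * s)) * inverse q)) = (3 * s\<^sup>2 * q - 2 * d * s ^ 4) / q\<^sup>2"
      if "q \<noteq> 0" for q :: real
      using that by (simp add: field_simps eval_nat_numeral)
    from this[OF ne] show ?thesis by (simp add: algebra_simps eval_nat_numeral)
  qed
  finally show "(trunc_cube d has_real_derivative s\<^sup>2 * (3 + d * s\<^sup>2) / (1 + d * s\<^sup>2)\<^sup>2) (at s)" .
qed

lemma grad_trunc_square: "grad (trunc_square d) s = s * (2 + d * s\<^sup>2) / sqrt (1 + d * s\<^sup>2) ^ 3"
proof (rule grad_real)
  define q where "q = sqrt (1 + d * s\<^sup>2)"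
  have q: "q > 0" "q\<^sup>2 = 1 + d * s\<^sup>2" using one_plus_pos[of s] by (auto simp: q_def)
  have D: "((\<lambda>s. sqrt (1 + d * s\<^sup>2)) has_real_derivative (d * (2 * s)) * (inverse q / 2)) (at s)"
  proof -
    have "((\<lambda>s. 1 + d * s\<^sup>2) has_real_derivative d * (2 * s)) (at s)"
      by (auto intro!: derivative_eq_intros)
    from DERIV_chain2[OF DERIV_real_sqrt[OF one_plus_pos] this] show ?thesis by (simp add: q_def mult.commute)
  qed
  have "(trunc_square d has_real_derivative
     (2 * s) * inverse q + s\<^sup>2 * (- (inverse q * ((d * (2 * s)) * (inverse q / 2)) * inverse q))) (at s)"
  proof -
    have P: "((\<lambda>s::real. s\<^sup>2) has_real_derivative 2 * s) (at s)" by (auto intro!: derivative_eq_intros)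
    have "((\<lambda>s. inverse (sqrt (1 + d * s\<^sup>2))) has_real_derivative - (inverse q * ((d * (2 * s)) * (inverse q / 2)) * inverse q)) (at s)"
      using DERIV_inverse'[OF D] q by (simp add: q_def)
    from DERIV_mult[OF P this] show ?thesis
      unfolding trunc_square_def[abs_def] q_def by (simp only: mult.commute[of "s\<^sup>2"])
  qed
  also have "(2 * s) * inverse q + s\<^sup>2 * (- (inverse q * ((d * (2 * s)) * (inverse q / 2)) * inverse q))
      = s * (2 * q\<^sup>2 - d * s\<^sup>2) / q ^ 3"
    using q(1) by (simp add: field_simps power2_eq_square power3_eq_cube)
  also have "2 * q\<^sup>2 - d * s\<^sup>2 = 2 + d * s\<^sup>2" using q(2) by simp
  finally show "(trunc_square d has_real_derivative s * (2 + d * s\<^sup>2) / sqrt (1 + d * s\<^sup>2) ^ 3) (at s)"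
    unfolding q_def .
qed

lemma grad_trunc_cube_bound: "\<bar>grad (trunc_cube d) s\<bar> \<le> 3 / d"
proof -
  define y where "y = d * s\<^sup>2"
  have y: "y \<ge> 0" using d by (simp add: y_def)
  have s: "s\<^sup>2 = y / d" using d by (simp add: y_def)
  have "y * (3 + y) \<le> 3 * (1 + y)\<^sup>2" using y by (simp add: power2_eq_square algebra_simps)
  moreover have "(1 + y)\<^sup>2 > 0" using y by simp
  ultimately have "y * (3 + y) / (1 + y)\<^sup>2 \<le> 3" by (simp add: pos_divide_le_eq)
  then have "(y * (3 + y) / (1 + y)\<^sup>2) / d \<le> 3 / d" using d by (intro divide_right_mono) auto
  moreover have e: "grad (trunc_cube d) s = (y * (3 + y) / (1 + y)\<^sup>2) / d"
    unfolding grad_trunc_cube y_def[symmetric] by (simp add: s)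
  moreover have "grad (trunc_cube d) s \<ge> 0" unfolding e using y d by simp
  ultimately show "\<bar>grad (trunc_cube d) s\<bar> \<le> 3 / d" by simp
qed

lemma grad_trunc_square_le: "(grad (trunc_square d) s)\<^sup>2 \<le> 2 * grad (trunc_cube d) s"
proof -
  define y where "y = d * s\<^sup>2"
  have y: "y \<ge> 0" using d by (simp add: y_def)
  have q6: "(sqrt (1 + y) ^ 3)\<^sup>2 = (1 + y) ^ 3"
  proof -
    have "(r ^ 3)\<^sup>2 = (r\<^sup>2) ^ 3" for r :: real by (simp add: power_mult[symmetric])
    then have "(sqrt (1 + y) ^ 3)\<^sup>2 = ((sqrt (1 + y))\<^sup>2) ^ 3" .
    also have "(sqrt (1 + y))\<^sup>2 = 1 + y" using y by simp
    finally show ?thesis .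
  qed
  have "(grad (trunc_square d) s)\<^sup>2 = s\<^sup>2 * ((2 + y)\<^sup>2 / (1 + y) ^ 3)"
    unfolding grad_trunc_square y_def[symmetric] power_divide power_mult_distrib q6 by simp
  also have "(2 + y)\<^sup>2 / (1 + y) ^ 3 \<le> 2 * ((3 + y) / (1 + y)\<^sup>2)"
  proof -
    have "(2 + y)\<^sup>2 \<le> 2 * (3 + y) * (1 + y)" using y by (simp add: power2_eq_square algebra_simps)
    then have "(2 + y)\<^sup>2 / (1 + y) ^ 3 \<le> 2 * (3 + y) * (1 + y) / (1 + y) ^ 3" using y by (intro divide_right_mono) auto
    also have "\<dots> = 2 * ((3 + y) / (1 + y)\<^sup>2)" using y by (simp add: power3_eq_cube power2_eq_square)
    finally show ?thesis .
  qed
  finally have "(grad (trunc_square d) s)\<^sup>2 \<le> s\<^sup>2 * (2 * ((3 + y) / (1 + y)\<^sup>2))" by (simp add: mult_left_mono)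
  also have "\<dots> = 2 * grad (trunc_cube d) s"
    unfolding grad_trunc_cube y_def[symmetric] by (simp only: times_divide_eq_right mult_ac)
  finally show ?thesis .
qed

lemma grad_trunc_square_bound: "\<bar>grad (trunc_square d) s\<bar> \<le> sqrt (6 / d)"
proof -
  have "(grad (trunc_square d) s)\<^sup>2 \<le> 6 / d"
    using grad_trunc_square_le[of s] grad_trunc_cube_bound[of s] by simp
  then show ?thesis using real_le_rsqrt real_sqrt_le_mono real_sqrt_abs by metis
qed

lemma trunc_square_power2: "(trunc_square d s)\<^sup>2 = s * trunc_cube d s"
proof -
  define Q where "Q = 1 + d * s\<^sup>2"
  have "(inverse (sqrt Q))\<^sup>2 = inverse Q" using one_plus_pos[of s] by (simp add: Q_def power_inverse)
  then show ?thesis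
    unfolding trunc_square_def trunc_cube_def Q_def[symmetric] power_mult_distrib by (simp add: eval_nat_numeral)
qed

lemma trunc_square_le: "(trunc_square d s)\<^sup>2 \<le> s ^ 4" "(trunc_square d s)\<^sup>2 \<le> s\<^sup>2 / d"
proof -
  define y where "y = d * s\<^sup>2"
  have y: "y \<ge> 0" using d by (simp add: y_def)
  have e: "(trunc_square d s)\<^sup>2 = s ^ 4 / (1 + y)"
    unfolding trunc_square_power2 trunc_cube_def y_def[symmetric] by (simp add: divide_inverse eval_nat_numeral)
  show "(trunc_square d s)\<^sup>2 \<le> s ^ 4"
    unfolding e using y by (simp add: divide_le_eq mult_left_le zero_le_even_power algebra_simps)
  have "s ^ 4 = s\<^sup>2 * (y / d)" using d by (simp add: y_def eval_nat_numeral)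
  then have "s ^ 4 / (1 + y) = (s\<^sup>2 / d) * (y / (1 + y))" by simp
  also have "\<dots> \<le> (s\<^sup>2 / d) * 1" using y d by (intro mult_left_mono) auto
  finally show "(trunc_square d s)\<^sup>2 \<le> s\<^sup>2 / d" unfolding e by simp
qed

end

lemma trunc_square_tendsto: "(\<lambda>n. trunc_square (inverse (real (Suc n))) s) \<longlonglongrightarrow> s\<^sup>2"
proof -
  have "(\<lambda>n. s\<^sup>2 * inverse (sqrt (1 + inverse (real (Suc n)) * s\<^sup>2))) \<longlonglongrightarrow> s\<^sup>2 * inverse (sqrt (1 + 0 * s\<^sup>2))"
    by (intro tendsto_intros LIMSEQ_inverse_real_of_nat) simp
  then show ?thesis by (simp add: trunc_square_def)
qed

context schroedinger_poisson
begin

text \<open>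
  Testing the first equation with \<open>trunc_cube d u \<approx> u\<^sup>3\<close> bounds the gradient of \<open>h = trunc_square d u \<approx> u\<^sup>2\<close>
  by \<open>2 \<integral> (1 + c\<^sup>2) h\<^sup>2\<close> with \<open>c = u\<^sup>2 + \<phi>\<^sup>2\<close> in \<open>L\<^sup>3\<close>.  Where \<open>c \<le> K\<close> this is at most \<open>2 (1 + K\<^sup>2) \<integral> u\<^sup>4\<close>.  Where
  \<open>c > K\<close>, Hoelder's and Sobolev's inequalities bound it by a multiple of \<open>\<integral> |\<nabla>h|\<^sup>2\<close> that is small for large \<open>K\<close>
  and can be absorbed.  The resulting bound on \<open>\<integral> h\<^sup>6\<close> does not depend on \<open>d\<close>, and \<open>h\<^sup>6 \<rightarrow> u\<^sup>1\<^sup>2\<close> as \<open>d \<rightarrow> 0\<close>.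
\<close>

lemma brezis_kato: "integrable lborel (\<lambda>x. u x ^ 12)"
proof -
  define c where "c x = (u x)\<^sup>2 + (\<phi> x)\<^sup>2" for x
  have c0: "c x \<ge> 0" for x by (simp add: c_def)
  have [measurable]: "c \<in> borel_measurable borel" unfolding c_def by measurable
  have c3: "integrable lborel (\<lambda>x. c x ^ 3)"
  proof (rule Bochner_Integration.integrable_bound)
    show "integrable lborel (\<lambda>x. 4 * (u x ^ 6 + \<phi> x ^ 6))" using u6_int \<phi>6 by simp
    have "c x ^ 3 \<le> 4 * (u x ^ 6 + \<phi> x ^ 6)" for x
      using sum_cubed_le[of "(u x)\<^sup>2" "(\<phi> x)\<^sup>2"] by (simp add: c_def power_mult[symmetric])
    then have "norm (c x ^ 3) \<le> norm (4 * (u x ^ 6 + \<phi> x ^ 6))" for x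
      using c0[of x] order_trans[OF _ abs_ge_self] by simp
    then show "AE x in lborel. norm (c x ^ 3) \<le> norm (4 * (u x ^ 6 + \<phi> x ^ 6))" by blast
  qed simp
  \<comment> \<open>The part of c above the level K; its integral in the third power tends to 0 as K grows.\<close>
  define cK where "cK K x = (if c x \<le> real K then 0 else c x)" for K x
  have [measurable]: "cK K \<in> borel_measurable borel" for K unfolding cK_def by measurable
  have cK0: "cK K x \<ge> 0" "cK K x \<le> c x" for K x using c0[of x] by (auto simp: cK_def)
  have cK3: "integrable lborel (\<lambda>x. cK K x ^ 3)" for K
    by (rule Bochner_Integration.integrable_bound[OF c3]) (use c0 cK0 in \<open>auto intro!: power_mono\<close>)
  have "(\<lambda>K. LBINT x. cK K x ^ 3) \<longlonglongrightarrow> (\<integral>x. 0 \<partial>(lborel :: R3 measure))"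
  proof (rule integral_dominated_convergence[OF _ _ c3])
    show "AE x in lborel. (\<lambda>K. cK K x ^ 3) \<longlonglongrightarrow> 0"
    proof (intro AE_I2)
      fix x
      obtain N where N: "c x \<le> real N" using real_arch_simple by blast
      have "eventually (\<lambda>K. 0 = cK K x ^ 3) sequentially"
        unfolding eventually_sequentially using N by (intro exI[of _ N]) (auto simp: cK_def)
      then show "(\<lambda>K. cK K x ^ 3) \<longlonglongrightarrow> 0" by (rule Lim_transform_eventually[OF tendsto_const])
    qed
    show "AE x in lborel. norm (cK K x ^ 3) \<le> c x ^ 3" for K
      using cK0 by (intro AE_I2) (simp add: power_mono)
  qed auto
  \<comment> \<open>The constant is chosen such that 4096 / 512^2 = (1/4)^3, where 4096 is the constant in the Sobolev inequality.\<close>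
  then have "eventually (\<lambda>K. (LBINT x. cK K x ^ 3) < 1 / 512) sequentially"
    by (intro order_tendstoD) auto
  then obtain K where K: "(LBINT x. cK K x ^ 3) < 1 / 512"
    by (auto simp: eventually_sequentially)
  define M where "M = 4 * (1 + (real K)\<^sup>2) * (LBINT x. u x ^ 4)"
  have u4: "integrable lborel (\<lambda>x. u x ^ 4)" using u_power_int[of 4] by (simp add: power_even_abs)
  have main: "integrable lborel (\<lambda>x. trunc_square d (u x) ^ 6) \<and> (LBINT x. trunc_square d (u x) ^ 6) \<le> 4096 * M ^ 3"
    if d: "d > 0" for d
  proof -
    define h where "h x = trunc_square d (u x)" for x
    define Gh where "Gh x = grad (trunc_square d) (u x) *\<^sub>R Gu x" for x
    have ph: "sobolev_pair h Gh" unfolding h_def Gh_def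
      by (rule sobolev_pair_chain[OF u_pair Ck_trunc_square[OF d] _ grad_trunc_square_bound[OF d]])
         (simp add: trunc_square_def)
    have pw: "sobolev_pair (\<lambda>x. trunc_cube d (u x)) (\<lambda>x. grad (trunc_cube d) (u x) *\<^sub>R Gu x)"
      by (rule sobolev_pair_chain[OF u_pair Ck_trunc_cube[OF d] _ grad_trunc_cube_bound[OF d]])
         (simp add: trunc_cube_def)
    have wL: "L2 (\<lambda>x. trunc_cube d (u x))" using sobolev_pair_L2(1)[OF pw] .
    have [measurable]: "h \<in> borel_measurable borel" using sobolev_pair_L2(1)[OF ph] by (simp add: L2_def)
    have [measurable]: "(\<lambda>x. trunc_cube d (u x)) \<in> borel_measurable borel" using wL by (simp add: L2_def)
    have h2: "(h x)\<^sup>2 = u x * trunc_cube d (u x)" for x unfolding h_def by (rule trunc_square_power2[OF d])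
    have h6: "((h x)\<^sup>2) ^ 3 = h x ^ 6" for x by (simp add: power_mult[symmetric])
    note S = sobolev_inequality[OF ph]
    have ih2: "integrable lborel (\<lambda>x. (h x)\<^sup>2)" using L2_integrable[OF sobolev_pair_L2(1)[OF ph]] by simp
    have ih2u: "integrable lborel (\<lambda>x. u x ^ 4 * (h x)\<^sup>2)"
    proof (rule Bochner_Integration.integrable_bound)
      show "integrable lborel (\<lambda>x. u x ^ 6 / d)" using u6_int by simp
      have "u x ^ 4 * (h x)\<^sup>2 \<le> u x ^ 4 * ((u x)\<^sup>2 / d)" for x
        unfolding h_def by (intro mult_left_mono trunc_square_le(2)[OF d]) (simp add: zero_le_even_power)
      then have "u x ^ 4 * (h x)\<^sup>2 \<le> u x ^ 6 / d" for x by (simp add: power_add[symmetric])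
      then show "AE x in lborel. norm (u x ^ 4 * (h x)\<^sup>2) \<le> norm (u x ^ 6 / d)"
        using d by (intro AE_I2) (simp add: zero_le_even_power abs_mult)
    qed simp
    have ic: "integrable lborel (\<lambda>x. (c x)\<^sup>2 * (h x)\<^sup>2)"
      by (rule holder_3(1)) (use c0 c3 S(1) h6 in auto)
    have icK: "integrable lborel (\<lambda>x. (cK K x)\<^sup>2 * (h x)\<^sup>2)"
      and X3: "(LBINT x. (cK K x)\<^sup>2 * (h x)\<^sup>2) ^ 3 \<le> (LBINT x. cK K x ^ 3)\<^sup>2 * (LBINT x. ((h x)\<^sup>2) ^ 3)"
      by (rule holder_3; use cK0 cK3 S(1) h6 in simp)+
    define D where "D = (LBINT x. (norm (Gh x))\<^sup>2)"
    define X where "X = (LBINT x. (cK K x)\<^sup>2 * (h x)\<^sup>2)"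
    have D0: "D \<ge> 0" by (simp add: D_def)
    have "(LBINT x. cK K x ^ 3)\<^sup>2 \<le> (1 / 512)\<^sup>2"
      using K cK0(1) by (intro power_mono) (auto intro!: integral_nonneg_AE)
    moreover have "(LBINT x. h x ^ 6) \<le> 4096 * D ^ 3" using S(2) by (simp add: D_def)
    ultimately have "(LBINT x. cK K x ^ 3)\<^sup>2 * (LBINT x. h x ^ 6) \<le> (1 / 512)\<^sup>2 * (4096 * D ^ 3)"
      by (intro mult_mono) (auto intro!: integral_nonneg_AE simp: zero_le_even_power)
    with X3 have "X ^ 3 \<le> (1 / 512)\<^sup>2 * (4096 * D ^ 3)" unfolding X_def h6 by (rule order_trans)
    also have "\<dots> = (D / 4) ^ 3" by (simp add: power_divide power2_eq_square)
    finally have "X ^ 3 \<le> (D / 4) ^ 3" .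
    then have X: "X \<le> D / 4"
      using D0 power_strict_mono[of "D / 4" X 3] by (meson divide_nonneg_nonneg not_le zero_le_numeral zero_less_numeral)
    \<comment> \<open>The truncated cube of u as a test function; the potential term has a good sign and |phi| is at most 1 + phi^4.\<close>
    have energy: "(LBINT x. grad (trunc_cube d) (u x) * (norm (Gu x))\<^sup>2) \<le> (LBINT x. (1 + (c x)\<^sup>2) * (h x)\<^sup>2)"
    proof -
      have e1: "Gu x \<bullet> (grad (trunc_cube d) (u x) *\<^sub>R Gu x) = grad (trunc_cube d) (u x) * (norm (Gu x))\<^sup>2" for x
        by (simp add: power2_norm_eq_inner)
      have e2: "V x * u x * trunc_cube d (u x) = V x * (h x)\<^sup>2" "\<phi> x * u x * trunc_cube d (u x) = \<phi> x * (h x)\<^sup>2"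
         "u x ^ 5 * trunc_cube d (u x) = u x ^ 4 * (h x)\<^sup>2" for x
        unfolding h2 by (simp_all add: eval_nat_numeral)
      have iV: "integrable lborel (\<lambda>x. V x * (h x)\<^sup>2)" and i\<phi>: "integrable lborel (\<lambda>x. \<phi> x * (h x)\<^sup>2)"
        unfolding e2[symmetric] by (intro integrable_mult_L2 Vu_L2 \<phi>u_L2 wL)+
      have "(LBINT x. grad (trunc_cube d) (u x) * (norm (Gu x))\<^sup>2)
          = (LBINT x. u x ^ 4 * (h x)\<^sup>2 - V x * (h x)\<^sup>2 - \<phi> x * (h x)\<^sup>2)"
        using eq_u_extended[OF pw] unfolding e1 e2 using iV i\<phi> ih2u by simp
      also have "\<dots> \<le> (LBINT x. (1 + (c x)\<^sup>2) * (h x)\<^sup>2)"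
      proof (rule integral_mono)
        show "integrable lborel (\<lambda>x. u x ^ 4 * (h x)\<^sup>2 - V x * (h x)\<^sup>2 - \<phi> x * (h x)\<^sup>2)" using iV i\<phi> ih2u by simp
        show "integrable lborel (\<lambda>x. (1 + (c x)\<^sup>2) * (h x)\<^sup>2)" using ic ih2 by (simp add: distrib_right)
        fix x
        have "u x ^ 4 - V x - \<phi> x \<le> 1 + (c x)\<^sup>2"
        proof -
          have "- \<phi> x \<le> 1 + ((\<phi> x)\<^sup>2)\<^sup>2"
          proof (cases "\<bar>\<phi> x\<bar> \<le> 1")
            case True then show ?thesis using zero_le_power2[of "(\<phi> x)\<^sup>2"] by linarith
          next
            case False
            then have "\<bar>\<phi> x\<bar> ^ 1 \<le> \<bar>\<phi> x\<bar> ^ 4" by (intro power_increasing) auto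
            then show ?thesis by (simp add: power_even_abs power_mult[symmetric])
          qed
          moreover have "(c x)\<^sup>2 = u x ^ 4 + 2 * ((u x)\<^sup>2 * (\<phi> x)\<^sup>2) + ((\<phi> x)\<^sup>2)\<^sup>2"
            unfolding c_def power2_sum by (simp add: power_mult[symmetric])
          moreover have "0 \<le> (u x)\<^sup>2 * (\<phi> x)\<^sup>2" by simp
          ultimately show ?thesis using V_bounds(1)[of x] C1_pos by linarith
        qed
        then have "(u x ^ 4 - V x - \<phi> x) * (h x)\<^sup>2 \<le> (1 + (c x)\<^sup>2) * (h x)\<^sup>2" by (intro mult_right_mono) auto
        then show "u x ^ 4 * (h x)\<^sup>2 - V x * (h x)\<^sup>2 - \<phi> x * (h x)\<^sup>2 \<le> (1 + (c x)\<^sup>2) * (h x)\<^sup>2"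
          by (simp add: left_diff_distrib)
      qed
      finally show ?thesis .
    qed
    have iG: "integrable lborel (\<lambda>x. grad (trunc_cube d) (u x) * (norm (Gu x))\<^sup>2)"
      using integrable_inner_L2[OF Gu_L2 sobolev_pair_L2(2)[OF pw]] by (simp add: power2_norm_eq_inner)
    have "D \<le> (LBINT x. 2 * (grad (trunc_cube d) (u x) * (norm (Gu x))\<^sup>2))"
      unfolding D_def
    proof (rule integral_mono)
      show "integrable lborel (\<lambda>x. (norm (Gh x))\<^sup>2)" using L2_integrable[OF sobolev_pair_L2(2)[OF ph]] .
      show "integrable lborel (\<lambda>x. 2 * (grad (trunc_cube d) (u x) * (norm (Gu x))\<^sup>2))" using iG by simp
      show "(norm (Gh x))\<^sup>2 \<le> 2 * (grad (trunc_cube d) (u x) * (norm (Gu x))\<^sup>2)" for x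
        using mult_right_mono[OF grad_trunc_square_le[OF d, of "u x"], of "(norm (Gu x))\<^sup>2"]
        by (simp add: Gh_def power_mult_distrib)
    qed
    also have "\<dots> \<le> 2 * (LBINT x. (1 + (c x)\<^sup>2) * (h x)\<^sup>2)" using energy by simp
    also have "(LBINT x. (1 + (c x)\<^sup>2) * (h x)\<^sup>2) \<le> (LBINT x. (1 + (real K)\<^sup>2) * u x ^ 4 + (cK K x)\<^sup>2 * (h x)\<^sup>2)"
    proof (rule integral_mono)
      show "integrable lborel (\<lambda>x. (1 + (c x)\<^sup>2) * (h x)\<^sup>2)" using ic ih2 by (simp add: distrib_right)
      show "integrable lborel (\<lambda>x. (1 + (real K)\<^sup>2) * u x ^ 4 + (cK K x)\<^sup>2 * (h x)\<^sup>2)" using icK u4 by simp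
      fix x
      have "(c x)\<^sup>2 \<le> (real K)\<^sup>2 + (cK K x)\<^sup>2"
        using c0[of x] power_mono[of "c x" "real K" 2] by (auto simp: cK_def)
      then have "(1 + (c x)\<^sup>2) * (h x)\<^sup>2 \<le> (1 + (real K)\<^sup>2 + (cK K x)\<^sup>2) * (h x)\<^sup>2" by (intro mult_right_mono) auto
      also have "\<dots> = (1 + (real K)\<^sup>2) * (h x)\<^sup>2 + (cK K x)\<^sup>2 * (h x)\<^sup>2" by (simp add: distrib_right)
      also have "(1 + (real K)\<^sup>2) * (h x)\<^sup>2 \<le> (1 + (real K)\<^sup>2) * u x ^ 4"
        unfolding h_def by (intro mult_left_mono trunc_square_le(1)[OF d]) (simp add: add_nonneg_nonneg)
      finally show "(1 + (c x)\<^sup>2) * (h x)\<^sup>2 \<le> (1 + (real K)\<^sup>2) * u x ^ 4 + (cK K x)\<^sup>2 * (h x)\<^sup>2" by simp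
    qed
    also have "\<dots> = (1 + (real K)\<^sup>2) * (LBINT x. u x ^ 4) + X" using icK u4 by (simp add: X_def)
    finally have "D \<le> 2 * ((1 + (real K)\<^sup>2) * (LBINT x. u x ^ 4)) + 2 * X" by simp
    then have "D \<le> M" using X unfolding M_def by linarith
    then have "4096 * D ^ 3 \<le> 4096 * M ^ 3" using D0 by (intro mult_left_mono power_mono) auto
    with S show ?thesis unfolding h_def D_def by linarith
  qed
  show ?thesis
  proof (rule fatou_real(1))
    show "integrable lborel (\<lambda>x. trunc_square (inverse (real (Suc n))) (u x) ^ 6)"
      "(LBINT x. trunc_square (inverse (real (Suc n))) (u x) ^ 6) \<le> 4096 * M ^ 3" for n
      using main[of "inverse (real (Suc n))"] by auto
    show "AE x in lborel. (\<lambda>n. trunc_square (inverse (real (Suc n))) (u x) ^ 6) \<longlonglongrightarrow> u x ^ 12"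
    proof (intro AE_I2)
      fix x
      show "(\<lambda>n. trunc_square (inverse (real (Suc n))) (u x) ^ 6) \<longlonglongrightarrow> u x ^ 12"
        using tendsto_power[OF trunc_square_tendsto[of "u x"], of 6] by (simp add: power_mult[symmetric])
    qed
  qed (auto simp: zero_le_even_power)
qed

lemma u_quintic_L2: "L2 (\<lambda>x. u x ^ 5)"
proof (rule L2_dominated)
  show "integrable lborel (\<lambda>x. \<bar>u x\<bar> ^ 2 + \<bar>u x\<bar> ^ 12)" using u2_int brezis_kato by (simp add: power_even_abs)
  show "(norm (u x ^ 5))\<^sup>2 \<le> \<bar>u x\<bar> ^ 2 + \<bar>u x\<bar> ^ 12" for x
    using abs_power_interpolate[of 2 10 12 "u x"] by (simp add: power_mult[symmetric] power_even_abs)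
qed simp

end

section \<open>The stress-energy identity\<close>

lemma grad_inner_eq:
  assumes "(f has_derivative L) (at x)"
  shows "grad f x \<bullet> v = L v"
proof -
  have "f differentiable at x" using assms by (auto simp: differentiable_def)
  from has_derivative_unique[OF grad_has_derivative[OF this] assms] show ?thesis
    by (metis inner_commute)
qed

definition divergence :: "('a::euclidean_space \<Rightarrow> 'a) \<Rightarrow> 'a \<Rightarrow> real" where
  "divergence X x = (\<Sum>b\<in>Basis. grad (\<lambda>x. X x \<bullet> b) x \<bullet> b)"

text \<open>
  The quadratic form \<open>w \<mapsto> DX(w, w)\<close> of the Jacobian of \<open>X\<close>.
\<close>

definition jacobian_form :: "('a::euclidean_space \<Rightarrow> 'a) \<Rightarrow> 'a \<Rightarrow> 'a \<Rightarrow> real" where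
  "jacobian_form X x w = (\<Sum>b\<in>Basis. (w \<bullet> b) * (grad (\<lambda>x. X x \<bullet> b) x \<bullet> w))"

lemma field_has_derivative:
  fixes g :: "'a::euclidean_space \<Rightarrow> 'a"
  assumes "\<And>b. b \<in> Basis \<Longrightarrow> (\<lambda>x. g x \<bullet> b) differentiable at x"
  shows "(g has_derivative (\<lambda>h. \<Sum>c\<in>Basis. (h \<bullet> grad (\<lambda>x. g x \<bullet> c) x) *\<^sub>R c)) (at x)"
  unfolding has_derivative_componentwise_within[of g]
proof
  fix b :: 'a assume b: "b \<in> Basis"
  have "(\<Sum>c\<in>Basis. (h \<bullet> grad (\<lambda>x. g x \<bullet> c) x) *\<^sub>R c) \<bullet> b = h \<bullet> grad (\<lambda>x. g x \<bullet> b) x" for h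
    using b by (simp add: inner_sum_left inner_Basis if_distrib sum.delta cong: if_cong)
  then show "((\<lambda>x. g x \<bullet> b) has_derivative (\<lambda>h. (\<Sum>c\<in>Basis. (h \<bullet> grad (\<lambda>x. g x \<bullet> c) x) *\<^sub>R c) \<bullet> b)) (at x)"
    using grad_has_derivative[OF assms[OF b]] by simp
qed

text \<open>
  The integrand is the divergence of \<open>g (X \<bullet> g) - |g|\<^sup>2 X / 2\<close>, the stress-energy tensor of \<open>g\<close> contracted with
  \<open>X\<close>: the two terms with second derivatives, \<open>X \<bullet> Dg(g)\<close> and \<open>g \<bullet> Dg(X)\<close>, cancel by the symmetry of \<open>Dg\<close>.
\<close>

lemma stress_energy_smooth:
  fixes g X :: "'a::euclidean_space \<Rightarrow> 'a"
  assumes g: "\<And>b. b \<in> Basis \<Longrightarrow> Ck 1 (\<lambda>x. g x \<bullet> b)"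
    and X: "\<And>b. b \<in> Basis \<Longrightarrow> C1c (\<lambda>x. X x \<bullet> b)"
    and sym: "\<And>b c x. b \<in> Basis \<Longrightarrow> c \<in> Basis \<Longrightarrow> grad (\<lambda>x. g x \<bullet> b) x \<bullet> c = grad (\<lambda>x. g x \<bullet> c) x \<bullet> b"
  shows "(LBINT x. divergence g x * (X x \<bullet> g x) + jacobian_form X x (g x) - (g x \<bullet> g x) * divergence X x / 2) = 0"
proof -
  \<comment> \<open>The component in direction b of the field whose divergence is integrated.\<close>
  define h where "h b x = (g x \<bullet> b) * (X x \<bullet> g x) - 1 / 2 * ((g x \<bullet> g x) * (X x \<bullet> b))" for b x
  have C: "C1c (h b)" if b: "b \<in> Basis" for b
  proof -
    have e: "h b = (\<lambda>x. (g x \<bullet> b) * (\<Sum>c\<in>Basis. (g x \<bullet> c) * (X x \<bullet> c)) + (- (1/2) * (\<Sum>c\<in>Basis. (g x \<bullet> c) * (g x \<bullet> c))) * (X x \<bullet> b))"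
      by (simp add: h_def fun_eq_iff euclidean_inner[of "X _" "g _"] euclidean_inner[of "g _" "g _"] mult.commute)
    have s: "C1c (\<lambda>x. \<Sum>c\<in>Basis. (g x \<bullet> c) * (X x \<bullet> c))"
    proof -
      have "C1c (\<lambda>x. \<Sum>c\<in>I. (g x \<bullet> c) * (X x \<bullet> c))" if "I \<subseteq> Basis" "finite I" for I
        using that(2,1)
      proof (induction I)
        case empty
        show ?case unfolding C1c_def bounded_support_def by (simp only: sum.empty) (intro conjI Ck_const, simp)
      next
        case (insert c I)
        then have "C1c (\<lambda>x. (g x \<bullet> c) * (X x \<bullet> c) + (\<Sum>c\<in>I. (g x \<bullet> c) * (X x \<bullet> c)))"
          by (intro C1c_add C1c_mult g X) auto
        then show ?case using insert.hyps by simp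
      qed
      then show ?thesis by simp
    qed
    show ?thesis unfolding e
      by (intro C1c_add C1c_mult g X s Ck_cmult Ck_sum Ck_mult b)
  qed
  have "(LBINT x. (\<Sum>b\<in>Basis. grad (h b) x \<bullet> b)) = (\<Sum>b\<in>Basis. LBINT x. grad (h b) x \<bullet> b)"
  proof (rule Bochner_Integration.integral_sum)
    fix b :: 'a assume b: "b \<in> Basis"
    note c = C1cD[OF C[OF b]]
    show "integrable lborel (\<lambda>x. grad (h b) x \<bullet> b)"
      by (intro bounded_support_integrable bounded_support_inner1 bounded_support_grad continuous_intros c)
  qed
  also have "\<dots> = 0" using integral_grad_eq_0[OF C] by simp
  finally have Z: "(LBINT x. (\<Sum>b\<in>Basis. grad (h b) x \<bullet> b)) = 0" .
  have "(\<Sum>b\<in>Basis. grad (h b) x \<bullet> b) = divergence g x * (X x \<bullet> g x) + jacobian_form X x (g x) - (g x \<bullet> g x) * divergence X x / 2" for x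
  proof -
    define A where "A w = (\<Sum>c\<in>Basis. (w \<bullet> grad (\<lambda>x. g x \<bullet> c) x) *\<^sub>R c)" for w
    define B where "B w = (\<Sum>c\<in>Basis. (w \<bullet> grad (\<lambda>x. X x \<bullet> c) x) *\<^sub>R c)" for w
    have A: "(g has_derivative A) (at x)" unfolding A_def
      using g by (intro field_has_derivative) simp
    have B: "(X has_derivative B) (at x)" unfolding B_def
      using X C1cD(5) by (intro field_has_derivative) blast
    have D: "(h b has_derivative (\<lambda>w. (A w \<bullet> b) * (X x \<bullet> g x) + (g x \<bullet> b) * (B w \<bullet> g x + X x \<bullet> A w)
        - ((g x \<bullet> A w) * (X x \<bullet> b) + (g x \<bullet> g x) * (B w \<bullet> b) / 2))) (at x)" for b
      using has_derivative_diff[OF has_derivative_mult[OF has_derivative_inner_left[OF A, of b] has_derivative_inner[OF B A]]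
          has_derivative_mult_right[OF has_derivative_mult[OF has_derivative_inner[OF A A] has_derivative_inner_left[OF B, of b]], of "1/2"]]
      unfolding h_def by (rule has_derivative_eq_rhs) (simp add: fun_eq_iff inner_commute algebra_simps)
    have Ab: "A w \<bullet> c = w \<bullet> grad (\<lambda>x. g x \<bullet> c) x" and Bb: "B w \<bullet> c = w \<bullet> grad (\<lambda>x. X x \<bullet> c) x"
      if "c \<in> Basis" for w c
      using that by (simp_all add: A_def B_def inner_sum_left inner_Basis if_distrib sum.delta cong: if_cong)
    have linA: "linear A" and linB: "linear B"
      using A B by (auto intro: has_derivative_linear)
    have 1: "(\<Sum>b\<in>Basis. A b \<bullet> b) = divergence g x" and 2: "(\<Sum>b\<in>Basis. B b \<bullet> b) = divergence X x"
      unfolding divergence_def by (intro sum.cong refl, simp only: Ab Bb, rule inner_commute)+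
    have rep: "(\<Sum>b\<in>Basis. (w \<bullet> b) * (z \<bullet> L b)) = z \<bullet> L w" if "linear L" for L :: "'a \<Rightarrow> 'a" and w z
    proof -
      have "L w = L (\<Sum>b\<in>Basis. (w \<bullet> b) *\<^sub>R b)" by (simp add: euclidean_representation)
      also have "\<dots> = (\<Sum>b\<in>Basis. (w \<bullet> b) *\<^sub>R L b)" using that by (simp add: linear_sum linear_cmul)
      finally show ?thesis by (simp add: inner_sum_right)
    qed
    have 3: "(\<Sum>b\<in>Basis. (g x \<bullet> b) * (B b \<bullet> g x)) = jacobian_form X x (g x)"
    proof -
      have "(\<Sum>b\<in>Basis. (g x \<bullet> b) * (B b \<bullet> g x)) = g x \<bullet> B (g x)"
        using rep[OF linB, of "g x" "g x"] by (simp add: inner_commute)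
      also have "\<dots> = jacobian_form X x (g x)"
        by (simp add: B_def jacobian_form_def inner_sum_right inner_commute mult.commute)
      finally show ?thesis .
    qed
    have 4: "X x \<bullet> A (g x) = g x \<bullet> A (X x)"
    proof -
      have e: "z \<bullet> A w = (\<Sum>c\<in>Basis. \<Sum>b\<in>Basis. (z \<bullet> c) * (w \<bullet> b) * (grad (\<lambda>x. g x \<bullet> c) x \<bullet> b))" for z w
        unfolding A_def inner_sum_right inner_scaleR_right
        by (subst euclidean_inner[of w]) (simp add: sum_distrib_left sum_distrib_right mult_ac)
      have "X x \<bullet> A (g x) = (\<Sum>c\<in>Basis. \<Sum>b\<in>Basis. (X x \<bullet> c) * (g x \<bullet> b) * (grad (\<lambda>x. g x \<bullet> b) x \<bullet> c))"
        unfolding e by (intro sum.cong refl) (simp add: sym)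
      also have "\<dots> = (\<Sum>b\<in>Basis. \<Sum>c\<in>Basis. (g x \<bullet> b) * (X x \<bullet> c) * (grad (\<lambda>x. g x \<bullet> b) x \<bullet> c))"
        by (subst sum.swap) (simp add: mult.commute)
      finally show ?thesis unfolding e .
    qed
    have "(\<Sum>b\<in>Basis. grad (h b) x \<bullet> b) = (\<Sum>b\<in>Basis. (A b \<bullet> b) * (X x \<bullet> g x) + ((g x \<bullet> b) * (B b \<bullet> g x) + (g x \<bullet> b) * (X x \<bullet> A b))
        - ((X x \<bullet> b) * (g x \<bullet> A b) + (g x \<bullet> g x) * (B b \<bullet> b) / 2))"
      using grad_inner_eq[OF D] by (intro sum.cong refl) (simp add: distrib_left mult.commute)
    also have "\<dots> = (\<Sum>b\<in>Basis. A b \<bullet> b) * (X x \<bullet> g x) + ((\<Sum>b\<in>Basis. (g x \<bullet> b) * (B b \<bullet> g x)) + (\<Sum>b\<in>Basis. (g x \<bullet> b) * (X x \<bullet> A b)))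
        - ((\<Sum>b\<in>Basis. (X x \<bullet> b) * (g x \<bullet> A b)) + (g x \<bullet> g x) * (\<Sum>b\<in>Basis. B b \<bullet> b) / 2)"
      by (simp add: sum.distrib sum_subtractf sum_distrib_right sum_distrib_left sum_divide_distrib)
    also have "\<dots> = divergence g x * (X x \<bullet> g x) + jacobian_form X x (g x) - (g x \<bullet> g x) * divergence X x / 2"
      unfolding 1 2 3 rep[OF linA] 4 by simp
    finally show ?thesis .
  qed
  with Z show ?thesis by simp
qed

text \<open>
  The Hessian of a radial function of this form is a combination of \<open>x x\<^sup>T\<close> and the identity.  Derivatives of a
  convolution fall on the kernel, so all mollified functions inherit the symmetry.
\<close>

lemma radial_second_derivative_symmetric:
  fixes b c :: "'a::euclidean_space" and a s :: real
  defines "k \<equiv> \<lambda>x::'a. a * flat 1 (1 - s * (x \<bullet> x))"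
  shows "grad (\<lambda>x. grad k x \<bullet> b) x \<bullet> c = grad (\<lambda>x. grad k x \<bullet> c) x \<bullet> b"
proof -
  define q r :: "real poly" where "q = [:0, 0, 1:] * (1 - pderiv 1)" and "r = [:0, 0, 1:] * (q - pderiv q)"
  have D: "((\<lambda>x::'a. flat p (1 - s * (x \<bullet> x))) has_derivative (\<lambda>h. h \<bullet> (-2 * s * flat ([:0, 0, 1:] * (p - pderiv p)) (1 - s * (x \<bullet> x))) *\<^sub>R x)) (at x)" for p x
  proof -
    have "((\<lambda>x. 1 - s * (x \<bullet> x)) has_derivative (\<lambda>h. - (2 * s * (h \<bullet> x)))) (at x)"
      by (auto intro!: derivative_eq_intros simp: inner_commute)
    from diff_chain_at[OF this flat_has_derivative[unfolded has_field_derivative_def]]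
    show ?thesis by (simp add: o_def algebra_simps)
  qed
  have g: "grad k = (\<lambda>x::'a. (-2 * a * s * flat q (1 - s * (x \<bullet> x))) *\<^sub>R x)"
  proof
    fix x
    show "grad k x = (-2 * a * s * flat q (1 - s * (x \<bullet> x))) *\<^sub>R x"
    proof (rule gradI)
      show "(k has_derivative (\<lambda>h. h \<bullet> (-2 * a * s * flat q (1 - s * (x \<bullet> x))) *\<^sub>R x)) (at x)"
        unfolding k_def using has_derivative_mult_right[OF D[of 1 x], of a] unfolding q_def
        by (simp add: mult_ac)
    qed
  qed
  have "grad (\<lambda>x::'a. grad k x \<bullet> b) x = (4 * a * s * s * flat r (1 - s * (x \<bullet> x)) * (x \<bullet> b)) *\<^sub>R x - (2 * a * s * flat q (1 - s * (x \<bullet> x))) *\<^sub>R b" for b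
  proof (rule gradI)
    show "((\<lambda>x. grad k x \<bullet> b) has_derivative (\<lambda>h. h \<bullet> ((4 * a * s * s * flat r (1 - s * (x \<bullet> x)) * (x \<bullet> b)) *\<^sub>R x - (2 * a * s * flat q (1 - s * (x \<bullet> x))) *\<^sub>R b))) (at x)"
      unfolding g inner_scaleR_left
      by (rule derivative_eq_intros D[of q, folded r_def] refl)+ (simp add: algebra_simps)
  qed
  then show ?thesis by (simp add: inner_diff_left) (simp add: inner_commute algebra_simps)
qed

lemma mollifier_second_derivative_symmetric:
  "grad (\<lambda>x. grad (mollifier n) x \<bullet> b) x \<bullet> c = grad (\<lambda>x. grad (mollifier n) x \<bullet> c) x \<bullet> b"
proof -
  have "mollifier n = (\<lambda>x::'a. (1 / (\<integral>y. bump (real (Suc n) *\<^sub>R y) \<partial>(lborel :: 'a measure))) * flat 1 (1 - (real (Suc n))\<^sup>2 * (x \<bullet> x)))"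
    by (simp add: mollifier_def bump_def fun_eq_iff power2_eq_square mult.assoc)
  then show ?thesis by (simp only: radial_second_derivative_symmetric)
qed

lemma C1c_bounds:
  assumes "C1c f"
  obtains K where "\<And>x. \<bar>f x\<bar> \<le> K" "\<And>x. \<bar>grad f x \<bullet> v\<bar> \<le> K" "f \<in> borel_measurable borel" "(\<lambda>x. grad f x \<bullet> v) \<in> borel_measurable borel"
proof -
  note c = C1cD[OF assms]
  obtain K1 where 1: "\<And>x. norm (f x) \<le> K1" using bounded_support_bound[OF c(2,4)] by metis
  have cg: "continuous_on UNIV (\<lambda>x. grad f x \<bullet> v)" by (intro continuous_intros c)
  obtain K2 where 2: "\<And>x. norm (grad f x \<bullet> v) \<le> K2"
    using bounded_support_bound[OF cg bounded_support_inner1[OF bounded_support_grad[OF c(4)]]] by metis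
  show ?thesis
  proof (rule that[of "max K1 K2"])
    show "\<bar>f x\<bar> \<le> max K1 K2" "\<bar>grad f x \<bullet> v\<bar> \<le> max K1 K2" for x
      using 1[of x] 2[of x] by auto
  qed (intro borel_measurable_continuous_onI c(2) cg)+
qed

lemma tendsto_L2_C1c_mult:
  fixes F :: "nat \<Rightarrow> 'a::euclidean_space \<Rightarrow> real"
  assumes "tendsto_L2 F f" "C1c k"
  shows "tendsto_L2 (\<lambda>n x. k x * F n x) (\<lambda>x. k x * f x)" "tendsto_L2 (\<lambda>n x. (grad k x \<bullet> v) * F n x) (\<lambda>x. (grad k x \<bullet> v) * f x)"
proof -
  obtain K where K: "\<And>x. \<bar>k x\<bar> \<le> K" "\<And>x. \<bar>grad k x \<bullet> v\<bar> \<le> K" "k \<in> borel_measurable borel" "(\<lambda>x. grad k x \<bullet> v) \<in> borel_measurable borel"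
    by (rule C1c_bounds[OF assms(2), of v]) blast
  show "tendsto_L2 (\<lambda>n x. k x * F n x) (\<lambda>x. k x * f x)" by (rule tendsto_L2_bounded_mult[OF assms(1) K(3) K(1)])
  show "tendsto_L2 (\<lambda>n x. (grad k x \<bullet> v) * F n x) (\<lambda>x. (grad k x \<bullet> v) * f x)" by (rule tendsto_L2_bounded_mult[OF assms(1) K(4) K(2)])
qed

lemma L2_C1c_mult:
  fixes f :: "'a::euclidean_space \<Rightarrow> real"
  assumes "L2 f" "C1c k"
  shows "L2 (\<lambda>x. k x * f x)" "L2 (\<lambda>x. (grad k x \<bullet> v) * f x)"
  using tendsto_L2_C1c_mult[OF tendsto_L2_const[OF assms(1)] assms(2)] tendsto_L2D(2) by blast+

lemma field_tendsto:
  fixes X :: "'a::euclidean_space \<Rightarrow> 'a"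
  assumes X: "\<And>b. b \<in> Basis \<Longrightarrow> C1c (\<lambda>x. X x \<bullet> b)" and F: "tendsto_L2 F f"
  shows "tendsto_L2 (\<lambda>n x. X x \<bullet> F n x) (\<lambda>x. X x \<bullet> f x)"
    "(\<lambda>n. LBINT x. jacobian_form X x (F n x)) \<longlonglongrightarrow> (LBINT x. jacobian_form X x (f x))"
    "(\<lambda>n. LBINT x. (F n x \<bullet> F n x) * divergence X x) \<longlonglongrightarrow> (LBINT x. (f x \<bullet> f x) * divergence X x)"
proof -
  have Fb: "tendsto_L2 (\<lambda>n x. F n x \<bullet> b) (\<lambda>x. f x \<bullet> b)" for b
    by (rule tendsto_L2_linear[OF F bounded_linear_inner_left])
  have "tendsto_L2 (\<lambda>n x. \<Sum>b\<in>Basis. (X x \<bullet> b) * (F n x \<bullet> b)) (\<lambda>x. \<Sum>b\<in>Basis. (X x \<bullet> b) * (f x \<bullet> b))"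
    by (intro tendsto_L2_sum tendsto_L2_C1c_mult(1) Fb X)
  then show "tendsto_L2 (\<lambda>n x. X x \<bullet> F n x) (\<lambda>x. X x \<bullet> f x)" by (simp add: euclidean_inner[symmetric])
  have Jb: "tendsto_L2 (\<lambda>n x. grad (\<lambda>x. X x \<bullet> b) x \<bullet> F n x) (\<lambda>x. grad (\<lambda>x. X x \<bullet> b) x \<bullet> f x)" if b: "b \<in> Basis" for b
  proof -
    have "tendsto_L2 (\<lambda>n x. \<Sum>c\<in>Basis. (grad (\<lambda>x. X x \<bullet> b) x \<bullet> c) * (F n x \<bullet> c)) (\<lambda>x. \<Sum>c\<in>Basis. (grad (\<lambda>x. X x \<bullet> b) x \<bullet> c) * (f x \<bullet> c))"
      by (intro tendsto_L2_sum tendsto_L2_C1c_mult(2) Fb X b)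
    then show ?thesis by (simp add: euclidean_inner[symmetric])
  qed
  have "(\<lambda>n. \<Sum>b\<in>Basis. LBINT x. (F n x \<bullet> b) * (grad (\<lambda>x. X x \<bullet> b) x \<bullet> F n x))
     \<longlonglongrightarrow> (\<Sum>b\<in>Basis. LBINT x. (f x \<bullet> b) * (grad (\<lambda>x. X x \<bullet> b) x \<bullet> f x))"
    by (intro tendsto_sum tendsto_integral_mult Fb Jb)
  moreover have J: "(\<Sum>b\<in>Basis. LBINT x. (k x \<bullet> b) * (grad (\<lambda>x. X x \<bullet> b) x \<bullet> k x)) = (LBINT x. jacobian_form X x (k x))"
    if k: "(\<exists>n. k = F n) \<or> k = f" for k
  proof -
    have "integrable lborel (\<lambda>x. (k x \<bullet> b) * (grad (\<lambda>x. X x \<bullet> b) x \<bullet> k x))" if "b \<in> Basis" for b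
      using k tendsto_L2D(1,2)[OF Fb[of b]] tendsto_L2D(1,2)[OF Jb[OF that]] by (auto intro: integrable_mult_L2)
    then show ?thesis unfolding jacobian_form_def by (subst Bochner_Integration.integral_sum) auto
  qed
  moreover have "(\<Sum>b\<in>Basis. LBINT x. (F n x \<bullet> b) * (grad (\<lambda>x. X x \<bullet> b) x \<bullet> F n x)) = (LBINT x. jacobian_form X x (F n x))" for n
    by (rule J) blast
  ultimately show "(\<lambda>n. LBINT x. jacobian_form X x (F n x)) \<longlonglongrightarrow> (LBINT x. jacobian_form X x (f x))" by simp
  have dX: "tendsto_L2 (\<lambda>n x. divergence X x *\<^sub>R F n x) (\<lambda>x. divergence X x *\<^sub>R f x)"
  proof (rule tendsto_L2_vec)
    fix b :: 'a
    have "tendsto_L2 (\<lambda>n x. \<Sum>c\<in>Basis. (grad (\<lambda>x. X x \<bullet> c) x \<bullet> c) * (F n x \<bullet> b)) (\<lambda>x. \<Sum>c\<in>Basis. (grad (\<lambda>x. X x \<bullet> c) x \<bullet> c) * (f x \<bullet> b))"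
      by (intro tendsto_L2_sum tendsto_L2_C1c_mult(2) Fb X)
    then show "tendsto_L2 (\<lambda>n x. (divergence X x *\<^sub>R F n x) \<bullet> b) (\<lambda>x. (divergence X x *\<^sub>R f x) \<bullet> b)"
      by (simp add: divergence_def sum_distrib_right)
  qed
  have "(\<lambda>n. LBINT x. F n x \<bullet> (divergence X x *\<^sub>R F n x)) \<longlonglongrightarrow> (LBINT x. f x \<bullet> (divergence X x *\<^sub>R f x))"
    by (rule tendsto_integral_inner[OF F dX])
  then show "(\<lambda>n. LBINT x. (F n x \<bullet> F n x) * divergence X x) \<longlonglongrightarrow> (LBINT x. (f x \<bullet> f x) * divergence X x)"
    by (simp add: mult.commute)
qed

lemma field_integrable:
  fixes X :: "'a::euclidean_space \<Rightarrow> 'a"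
  assumes X: "\<And>b. b \<in> Basis \<Longrightarrow> C1c (\<lambda>x. X x \<bullet> b)" and f: "L2 f"
  shows "L2 (\<lambda>x. X x \<bullet> f x)" "integrable lborel (\<lambda>x. jacobian_form X x (f x))"
    "integrable lborel (\<lambda>x. (f x \<bullet> f x) * divergence X x)"
proof -
  have fb: "L2 (\<lambda>x. f x \<bullet> b)" for b
    by (rule L2_linear[OF f bounded_linear_inner_left])
  show "L2 (\<lambda>x. X x \<bullet> f x)" using field_tendsto(1)[OF X tendsto_L2_const[OF f]] by (rule tendsto_L2D(2))
  have Jb: "L2 (\<lambda>x. grad (\<lambda>x. X x \<bullet> b) x \<bullet> f x)" if b: "b \<in> Basis" for b
  proof -
    have "L2 (\<lambda>x. \<Sum>c\<in>Basis. (grad (\<lambda>x. X x \<bullet> b) x \<bullet> c) * (f x \<bullet> c))"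
      by (intro L2_sum L2_C1c_mult(2) fb X b)
    then show ?thesis by (simp add: euclidean_inner[symmetric])
  qed
  show "integrable lborel (\<lambda>x. jacobian_form X x (f x))"
    unfolding jacobian_form_def by (intro Bochner_Integration.integrable_sum integrable_mult_L2 fb Jb)
  have "integrable lborel (\<lambda>x. \<Sum>c\<in>Basis. \<Sum>b\<in>Basis. ((grad (\<lambda>x. X x \<bullet> b) x \<bullet> b) * (f x \<bullet> c)) * (f x \<bullet> c))"
    by (intro Bochner_Integration.integrable_sum integrable_mult_L2 fb L2_C1c_mult(2) X)
  moreover have "(\<Sum>c\<in>Basis. \<Sum>b\<in>Basis. ((grad (\<lambda>x. X x \<bullet> b) x \<bullet> b) * (f x \<bullet> c)) * (f x \<bullet> c)) = (f x \<bullet> f x) * divergence X x" for x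
    unfolding divergence_def by (subst euclidean_inner[of "f x" "f x"]) (simp add: sum_distrib_right sum_distrib_left mult_ac, rule sum.swap)
  ultimately show "integrable lborel (\<lambda>x. (f x \<bullet> f x) * divergence X x)" by simp
qed

text \<open>
  The identity obtained formally by testing \<open>-\<Delta>v = f\<close> with \<open>X \<bullet> \<nabla>v\<close>.  For the mollified function it holds
  classically, with \<open>-\<Delta>(\<rho> * v) = \<rho> * f\<close>.  Every term is continuous in \<open>\<nabla>v\<close> and \<open>f\<close> with respect to \<open>L\<^sup>2\<close>, so
  square integrability of \<open>f\<close> replaces regularity of \<open>v\<close>.
\<close>

lemma stress_energy:
  fixes X :: "R3 \<Rightarrow> R3"
  assumes w: "weak_gradient v G" and G: "L2 G" and f: "L2 f"
    and eq: "\<And>\<psi>. test_function \<psi> \<Longrightarrow> (LBINT x. G x \<bullet> grad \<psi> x) = (LBINT x. f x * \<psi> x)"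
    and X: "\<And>b. b \<in> Basis \<Longrightarrow> C1c (\<lambda>x. X x \<bullet> b)"
  shows "(LBINT x. f x * (X x \<bullet> G x)) = (LBINT x. jacobian_form X x (G x)) - (LBINT x. (G x \<bullet> G x) * divergence X x) / 2"
proof -
  define g where "g n = grad (conv (mollifier n) v)" for n
  have lv: "loc_int v" and lG: "\<And>b. b \<in> Basis \<Longrightarrow> loc_int (\<lambda>x. G x \<bullet> b)" using w by (auto simp: weak_gradient_def)
  note sk = mollifier_smooth_kernel[where 'a=R3]
  note c1 = smooth_kernel_C1c[OF sk]
  have t: "test_function (mollifier n)" for n using sk by (simp add: test_function_iff)
  have gb: "g n x \<bullet> b = conv (mollifier n) (\<lambda>y. G y \<bullet> b) x" if "b \<in> Basis" for n x b
    unfolding g_def by (rule grad_conv_weak[OF t w that])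
  have gb': "g n x \<bullet> b = conv (\<lambda>z. grad (mollifier n) z \<bullet> b) v x" if "b \<in> Basis" for n x b
    unfolding g_def by (rule grad_conv[OF c1 lv that])
  have gC: "Ck 1 (\<lambda>x. g n x \<bullet> b)" if "b \<in> Basis" for n b
    using Ck_conv[OF sk lG[OF that], of 1 n] gb[OF that] by (simp only:)
  have sym: "grad (\<lambda>x. g n x \<bullet> b) x \<bullet> c = grad (\<lambda>x. g n x \<bullet> c) x \<bullet> b" if b: "b \<in> Basis" and c: "c \<in> Basis" for n x b c
  proof -
    have e: "grad (\<lambda>x. g n x \<bullet> b) x \<bullet> c = conv (\<lambda>z. grad (\<lambda>z. grad (mollifier n) z \<bullet> b) z \<bullet> c) v x"
      if b: "b \<in> Basis" and c: "c \<in> Basis" for b c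
      using grad_conv[OF smooth_kernel_C1c[OF smooth_kernel_grad[OF sk b]] lv c] gb'[OF b] by simp
    show ?thesis unfolding e[OF b c] e[OF c b] mollifier_second_derivative_symmetric[of n b _ c] ..
  qed
  have div: "divergence (g n) x = - conv (mollifier n) f x" for n x
  proof -
    have i: "integrable lborel (\<lambda>y. (grad (mollifier n) (x - y) \<bullet> b) * (G y \<bullet> b))" if "b \<in> Basis" for b
      using conv_integrable[OF lG[OF that], of "\<lambda>z. grad (mollifier n) z \<bullet> b"] C1cD[OF smooth_kernel_C1c[OF smooth_kernel_grad[OF sk that]]]
      by simp
    have "divergence (g n) x = (\<Sum>b\<in>Basis. conv (\<lambda>z. grad (mollifier n) z \<bullet> b) (\<lambda>y. G y \<bullet> b) x)"
      unfolding divergence_def using grad_conv[OF c1 lG] gb by (intro sum.cong refl) simp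
    also have "\<dots> = (LBINT y. (\<Sum>b\<in>Basis. (grad (mollifier n) (x - y) \<bullet> b) * (G y \<bullet> b)))"
      unfolding conv_def by (rule Bochner_Integration.integral_sum[symmetric]) (rule i)
    also have "\<dots> = (LBINT y. - (G y \<bullet> grad (\<lambda>y. mollifier n (x - y)) y))"
    proof -
      have "grad (\<lambda>y. mollifier n (x - y)) y = - grad (mollifier n) (x - y)" for y
        using C1cD(5)[OF c1] by (intro gradI has_derivative_reflect)
      then show ?thesis unfolding euclidean_inner[symmetric] by (simp add: inner_commute)
    qed
    also have "\<dots> = - (LBINT y. G y \<bullet> grad (\<lambda>y. mollifier n (x - y)) y)" by (rule Bochner_Integration.integral_minus)
    also have "\<dots> = - (LBINT y. f y * mollifier n (x - y))"
      using eq[OF test_function_reflect[OF t]] by simp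
    finally show ?thesis by (simp add: conv_def mult.commute)
  qed
  have gT: "tendsto_L2 g G" unfolding g_def by (rule tendsto_L2_conv_weak[OF w G])
  have fT: "tendsto_L2 (\<lambda>n. conv (mollifier n) f) f" by (rule mollify_L2[OF f])
  note L = tendsto_L2D(1)[OF gT] tendsto_L2D(1)[OF fT]
  have id: "(LBINT x. conv (mollifier n) f x * (X x \<bullet> g n x))
      = (LBINT x. jacobian_form X x (g n x)) - (LBINT x. (g n x \<bullet> g n x) * divergence X x) / 2" for n
  proof -
    have i: "integrable lborel (\<lambda>x. conv (mollifier n) f x * (X x \<bullet> g n x))"
      by (intro integrable_mult_L2 L field_integrable(1)[OF X])
    have "0 = (LBINT x. - (conv (mollifier n) f x * (X x \<bullet> g n x)) + jacobian_form X x (g n x) - (g n x \<bullet> g n x) * divergence X x / 2)"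
      using stress_energy_smooth[OF gC X sym, of n] by (simp add: div)
    then show ?thesis using i field_integrable(2,3)[OF X L(1)[of n]] by simp
  qed
  have "(\<lambda>n. LBINT x. conv (mollifier n) f x * (X x \<bullet> g n x)) \<longlonglongrightarrow> (LBINT x. f x * (X x \<bullet> G x))"
    by (intro tendsto_integral_mult fT field_tendsto(1)[OF X gT])
  moreover have "(\<lambda>n. (LBINT x. jacobian_form X x (g n x)) - (LBINT x. (g n x \<bullet> g n x) * divergence X x) / 2)
     \<longlonglongrightarrow> (LBINT x. jacobian_form X x (G x)) - (LBINT x. (G x \<bullet> G x) * divergence X x) / 2"
    by (intro tendsto_diff tendsto_divide tendsto_const field_tendsto(2,3)[OF X gT]) simp_all
  ultimately show ?thesis unfolding id by (rule LIMSEQ_unique)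
qed

section \<open>Integration by parts for powers\<close>

text \<open>
  The chain rule \<open>\<nabla>(u\<^sup>p) = p u\<^sup>p\<^sup>-\<^sup>1 \<nabla>u\<close>, for powers that are not Lipschitz functions: it holds for
  \<open>s\<^sup>p / (1 + d s\<^sup>p)\<close>, whose derivative \<open>p s\<^sup>p\<^sup>-\<^sup>1 / (1 + d s\<^sup>p)\<^sup>2\<close> is bounded, and dominated convergence gives the limit
  \<open>d \<rightarrow> 0\<close>.
\<close>

lemma power_by_parts:
  assumes p: "sobolev_pair u G" and ev: "even p" "p > 0"
    and up: "integrable lborel (\<lambda>x. u x ^ p)" and uG: "L2 (\<lambda>x. u x ^ (p - 1))"
    and g: "C1c g"
  shows "(LBINT x. real p * u x ^ (p - 1) * (G x \<bullet> v) * g x) = - (LBINT x. u x ^ p * (grad g x \<bullet> v))"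
proof -
  have [measurable]: "u \<in> borel_measurable borel" "G \<in> borel_measurable borel"
    using sobolev_pair_L2[OF p] by (auto simp: L2_def)
  obtain K where K: "\<And>x. \<bar>g x\<bar> \<le> K" "\<And>x. \<bar>grad g x \<bullet> v\<bar> \<le> K"
    and [measurable]: "g \<in> borel_measurable borel" "(\<lambda>x. grad g x \<bullet> v) \<in> borel_measurable borel"
    by (rule C1c_bounds[OF g, of v]) blast
  define d where "d n = inverse (real (Suc n))" for n
  have d: "d n > 0" for n by (simp add: d_def)
  have d0: "d \<longlonglongrightarrow> 0" unfolding d_def by (rule LIMSEQ_inverse_real_of_nat)
  define F where "F n s = s ^ p * inverse (1 + d n * s ^ p)" for n s
  have sp: "s ^ p \<ge> 0" for s :: real using ev by (simp add: zero_le_even_power)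
  have pos: "1 + d n * s ^ p \<ge> 1" for n s using d[of n] sp[of s] by simp
  have ne: "1 + d n * s ^ p \<noteq> 0" for n s using pos[of n s] by simp
  have CF: "Ck k (F n)" for k n
    unfolding F_def[abs_def] by (intro Ck_mult Ck_power Ck_inverse Ck_add Ck_const Ck_cmult Ck_id ne)
  have gF: "grad (F n) s = real p * s ^ (p - 1) / (1 + d n * s ^ p)\<^sup>2" for n s
  proof (rule grad_real)
    have P: "((\<lambda>s. s ^ p) has_real_derivative real p * s ^ (p - 1)) (at s)"
      using DERIV_pow[of p s] by simp
    have Q: "((\<lambda>s. 1 + d n * s ^ p) has_real_derivative d n * (real p * s ^ (p - 1))) (at s)"
      using DERIV_add[OF DERIV_const[of 1] DERIV_cmult[OF P, of "d n"]] by simp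
    from DERIV_mult[OF P DERIV_inverse'[OF Q ne]]
    have "(F n has_real_derivative real p * s ^ (p - 1) * inverse (1 + d n * s ^ p)
        + - (inverse (1 + d n * s ^ p) * (d n * (real p * s ^ (p - 1))) * inverse (1 + d n * s ^ p)) * s ^ p) (at s)"
      unfolding F_def[abs_def] .
    also have "real p * s ^ (p - 1) * inverse (1 + d n * s ^ p)
        + - (inverse (1 + d n * s ^ p) * (d n * (real p * s ^ (p - 1))) * inverse (1 + d n * s ^ p)) * s ^ p
        = real p * s ^ (p - 1) / (1 + d n * s ^ p)\<^sup>2"
    proof -
      have "a * inverse q + - (inverse q * (e * a) * inverse q) * t = a / q\<^sup>2" if "q = 1 + e * t" "q \<noteq> 0" for a q e t :: real
      proof -
        have "a * inverse q + - (inverse q * (e * a) * inverse q) * t = (a * q - e * a * t) / q\<^sup>2"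
          using that(2) by (simp add: field_simps power2_eq_square)
        also have "a * q - e * a * t = a" using that(1) by (simp add: algebra_simps)
        finally show ?thesis .
      qed
      from this[OF refl ne] show ?thesis .
    qed
    finally show "(F n has_real_derivative real p * s ^ (p - 1) / (1 + d n * s ^ p)\<^sup>2) (at s)" .
  qed
  have sq: "(1 + d n * s ^ p)\<^sup>2 \<ge> 1 + d n * s ^ p" for n s
    using mult_left_mono[OF pos[of n s], of "1 + d n * s ^ p"] pos[of n s] by (simp add: power2_eq_square)
  have bd1: "\<bar>grad (F n) s\<bar> \<le> real p * \<bar>s ^ (p - 1)\<bar>" for n s
  proof -
    have "(1 + d n * s ^ p)\<^sup>2 \<ge> 1" using sq[of n s] pos[of n s] by linarith
    then have "real p * \<bar>s ^ (p - 1)\<bar> / (1 + d n * s ^ p)\<^sup>2 \<le> real p * \<bar>s ^ (p - 1)\<bar> / 1"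
      by (intro divide_left_mono) auto
    then show ?thesis by (simp add: gF abs_mult)
  qed
  have bd2: "\<bar>grad (F n) s\<bar> \<le> real p * (1 + 1 / d n)" for n s
  proof -
    have "\<bar>s\<bar> ^ (p - 1) \<le> \<bar>s\<bar> ^ 0 + \<bar>s\<bar> ^ p" by (rule abs_power_interpolate) simp_all
    then have "\<bar>s ^ (p - 1)\<bar> \<le> 1 + s ^ p" using ev by (simp add: power_abs power_even_abs)
    also have "\<dots> \<le> (1 + 1 / d n) * (1 + d n * s ^ p)" using d[of n] sp[of s] by (simp add: field_simps)
    also have "\<dots> \<le> (1 + 1 / d n) * (1 + d n * s ^ p)\<^sup>2" using sq[of n s] d[of n] by (intro mult_left_mono) auto
    finally have "\<bar>s ^ (p - 1)\<bar> / (1 + d n * s ^ p)\<^sup>2 \<le> 1 + 1 / d n"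
      using pos[of n s] by (simp add: pos_divide_le_eq)
    then have "real p * (\<bar>s ^ (p - 1)\<bar> / (1 + d n * s ^ p)\<^sup>2) \<le> real p * (1 + 1 / d n)" by (intro mult_left_mono) auto
    then show ?thesis by (simp add: gF abs_mult)
  qed
  have bdF: "\<bar>F n s\<bar> \<le> s ^ p" for n s
  proof -
    have "s ^ p / (1 + d n * s ^ p) \<le> s ^ p / 1" using pos[of n s] sp[of s] by (intro divide_left_mono) auto
    moreover have "0 \<le> s ^ p / (1 + d n * s ^ p)" using pos[of n s] sp[of s] by (intro divide_nonneg_nonneg) auto
    ultimately show ?thesis by (simp add: F_def divide_inverse)
  qed
  have [measurable]: "F n \<in> borel_measurable borel" "grad (F n) \<in> borel_measurable borel" for n
    using Ck_imp_continuous[OF CF[of 0 n]] Ck_imp_continuous_grad[OF CF[of "Suc 0" n]]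
    by (auto intro: borel_measurable_continuous_onI)
  have F0: "F n 0 = 0" for n using ev by (simp add: F_def)
  have pn: "sobolev_pair (\<lambda>x. F n (u x)) (\<lambda>x. grad (F n) (u x) *\<^sub>R G x)" for n
    by (rule sobolev_pair_chain[OF p CF F0 bd2])
  have id: "(LBINT x. grad (F n) (u x) * (G x \<bullet> v) * g x) = - (LBINT x. F n (u x) * (grad g x \<bullet> v))" for n
    using sobolev_pair_by_parts[OF pn g, of n v] by simp
  have tend: "(\<lambda>n. 1 + d n * s ^ p) \<longlonglongrightarrow> 1" for s
    using tendsto_add[OF tendsto_const[of 1] tendsto_mult[OF d0 tendsto_const[of "s ^ p"]]] by simp
  have 1: "(\<lambda>n. LBINT x. grad (F n) (u x) * (G x \<bullet> v) * g x) \<longlonglongrightarrow> (LBINT x. real p * u x ^ (p - 1) * (G x \<bullet> v) * g x)"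
  proof (rule integral_dominated_convergence)
    have "L2 (\<lambda>x. G x \<bullet> v)" by (rule L2_linear[OF sobolev_pair_L2(2)[OF p] bounded_linear_inner_left])
    from L2_integrable_prod[OF uG this]
    show "integrable lborel (\<lambda>x. real p * K * (norm (u x ^ (p - 1)) * norm (G x \<bullet> v)))" by simp
    show "AE x in lborel. norm (grad (F n) (u x) * (G x \<bullet> v) * g x) \<le> real p * K * (norm (u x ^ (p - 1)) * norm (G x \<bullet> v))" for n
    proof (intro AE_I2)
      fix x
      have "\<bar>grad (F n) (u x)\<bar> * \<bar>G x \<bullet> v\<bar> * \<bar>g x\<bar> \<le> (real p * \<bar>u x ^ (p - 1)\<bar>) * \<bar>G x \<bullet> v\<bar> * K"
        by (intro mult_mono bd1 K) auto
      then show "norm (grad (F n) (u x) * (G x \<bullet> v) * g x) \<le> real p * K * (norm (u x ^ (p - 1)) * norm (G x \<bullet> v))"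
        by (simp add: abs_mult mult_ac)
    qed
    show "AE x in lborel. (\<lambda>n. grad (F n) (u x) * (G x \<bullet> v) * g x) \<longlonglongrightarrow> real p * u x ^ (p - 1) * (G x \<bullet> v) * g x"
    proof (intro AE_I2)
      fix x
      have "(\<lambda>n. real p * u x ^ (p - 1) / (1 + d n * u x ^ p)\<^sup>2 * (G x \<bullet> v) * g x) \<longlonglongrightarrow> real p * u x ^ (p - 1) / 1\<^sup>2 * (G x \<bullet> v) * g x"
        by (intro tendsto_intros tend) simp
      then show "(\<lambda>n. grad (F n) (u x) * (G x \<bullet> v) * g x) \<longlonglongrightarrow> real p * u x ^ (p - 1) * (G x \<bullet> v) * g x"
        by (simp add: gF)
    qed
  qed measurable
  have 2: "(\<lambda>n. LBINT x. F n (u x) * (grad g x \<bullet> v)) \<longlonglongrightarrow> (LBINT x. u x ^ p * (grad g x \<bullet> v))"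
  proof (rule integral_dominated_convergence)
    show "integrable lborel (\<lambda>x. u x ^ p * K)" using up by simp
    show "AE x in lborel. norm (F n (u x) * (grad g x \<bullet> v)) \<le> u x ^ p * K" for n
    proof (intro AE_I2)
      fix x
      have "\<bar>F n (u x)\<bar> * \<bar>grad g x \<bullet> v\<bar> \<le> u x ^ p * K" by (intro mult_mono bdF K sp) auto
      then show "norm (F n (u x) * (grad g x \<bullet> v)) \<le> u x ^ p * K" by (simp add: abs_mult)
    qed
    show "AE x in lborel. (\<lambda>n. F n (u x) * (grad g x \<bullet> v)) \<longlonglongrightarrow> u x ^ p * (grad g x \<bullet> v)"
    proof (intro AE_I2)
      fix x
      have "(\<lambda>n. u x ^ p * inverse (1 + d n * u x ^ p) * (grad g x \<bullet> v)) \<longlonglongrightarrow> u x ^ p * inverse 1 * (grad g x \<bullet> v)"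
        by (intro tendsto_intros tend) simp
      then show "(\<lambda>n. F n (u x) * (grad g x \<bullet> v)) \<longlonglongrightarrow> u x ^ p * (grad g x \<bullet> v)" by (simp add: F_def)
    qed
  qed measurable
  from LIMSEQ_unique[OF 1, of "- (LBINT x. u x ^ p * (grad g x \<bullet> v))"] tendsto_minus[OF 2]
  show ?thesis unfolding id by simp
qed

lemma cutoff_field:
  fixes n :: nat
  defines "X \<equiv> \<lambda>x::'a::euclidean_space. cutoff n x *\<^sub>R x"
  shows "b \<in> Basis \<Longrightarrow> C1c (\<lambda>x. X x \<bullet> b)"
    "divergence X x = real DIM('a) * cutoff n x + grad (cutoff n) x \<bullet> x"
    "jacobian_form X x w = cutoff n x * (w \<bullet> w) + (w \<bullet> x) * (grad (cutoff n) x \<bullet> w)"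
proof -
  note c = smooth_kernel_C1c[OF cutoff_smooth_kernel[where 'a='a, of n]]
  have e: "(\<lambda>x. X x \<bullet> b) = (\<lambda>x. (x \<bullet> b) * cutoff n x)" for b by (simp add: X_def mult.commute)
  show "C1c (\<lambda>x. X x \<bullet> b)" unfolding e by (intro C1c_mult Ck_inner_const c)
  have gr: "grad (\<lambda>x. X x \<bullet> b) x = (x \<bullet> b) *\<^sub>R grad (cutoff n) x + cutoff n x *\<^sub>R b" for b x
  proof -
    have l: "((\<lambda>x::'a. x \<bullet> b) has_derivative (\<lambda>h. h \<bullet> b)) (at x)" by (auto intro!: derivative_eq_intros)
    have "grad (\<lambda>x::'a. x \<bullet> b) x = b" by (rule gradI[OF l])
    moreover have "(\<lambda>x::'a. x \<bullet> b) differentiable at x" using l differentiable_def by blast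
    ultimately show ?thesis unfolding e using C1cD(5)[OF c] by (simp add: grad_mult)
  qed
  have "divergence X x = (\<Sum>b\<in>Basis. (grad (cutoff n) x \<bullet> b) * (x \<bullet> b)) + (\<Sum>b\<in>(Basis::'a set). cutoff n x)"
    unfolding divergence_def gr by (simp add: inner_add_left sum.distrib mult.commute)
  then show "divergence X x = real DIM('a) * cutoff n x + grad (cutoff n) x \<bullet> x"
    by (simp add: euclidean_inner[symmetric])
  have "jacobian_form X x w = (\<Sum>b\<in>Basis. (w \<bullet> b) * (x \<bullet> b)) * (grad (cutoff n) x \<bullet> w) + cutoff n x * (\<Sum>b\<in>Basis. (w \<bullet> b) * (w \<bullet> b))"
  proof -
    have "(w \<bullet> b) * (((x \<bullet> b) *\<^sub>R grad (cutoff n) x + cutoff n x *\<^sub>R b) \<bullet> w)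
        = ((w \<bullet> b) * (x \<bullet> b)) * (grad (cutoff n) x \<bullet> w) + cutoff n x * ((w \<bullet> b) * (w \<bullet> b))" for b
      by (simp add: inner_add_left inner_commute[of b w] algebra_simps)
    then show ?thesis unfolding jacobian_form_def gr by (simp add: sum.distrib sum_distrib_left sum_distrib_right)
  qed
  then show "jacobian_form X x w = cutoff n x * (w \<bullet> w) + (w \<bullet> x) * (grad (cutoff n) x \<bullet> w)"
    by (simp add: euclidean_inner[symmetric])
qed

context schroedinger_poisson
begin

lemma u_weak_gradient: "weak_gradient u Gu"
  unfolding weak_gradient_def
proof (intro conjI ballI allI impI)
  show "loc_int u" by (rule L2_loc_int[OF u_L2])
  show "loc_int (\<lambda>x. Gu x \<bullet> b)" for b
    by (intro L2_loc_int L2_linear[OF Gu_L2] bounded_linear_inner_left)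
  fix \<psi> and b :: R3 assume "test_function \<psi>"
  then show "(LBINT x. u x * (grad \<psi> x \<bullet> b)) = - (LBINT x. \<psi> x * (Gu x \<bullet> b))"
    using sobolev_pair_by_parts[OF u_pair test_functionD(3), of \<psi> b] by (simp add: mult.commute)
qed

end

section \<open>The Pohozaev identity\<close>

lemma field_power_by_parts:
  fixes Y :: "R3 \<Rightarrow> R3"
  assumes p: "sobolev_pair u G" and ev: "even p" "p > 0"
    and up: "integrable lborel (\<lambda>x. u x ^ p)" and uG: "L2 (\<lambda>x. u x ^ (p - 1))"
    and Y: "\<And>b. b \<in> Basis \<Longrightarrow> C1c (\<lambda>x. Y x \<bullet> b)"
  shows "real p * (LBINT x. u x ^ (p - 1) * (Y x \<bullet> G x)) = - (LBINT x. u x ^ p * divergence Y x)"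
    "integrable lborel (\<lambda>x. u x ^ p * divergence Y x)"
proof -
  have Gb: "L2 (\<lambda>x. G x \<bullet> b)" for b by (rule L2_linear[OF sobolev_pair_L2(2)[OF p] bounded_linear_inner_left])
  have i: "integrable lborel (\<lambda>x. u x ^ (p - 1) * ((Y x \<bullet> b) * (G x \<bullet> b)))" if "b \<in> Basis" for b
    by (intro integrable_mult_L2 uG L2_C1c_mult(1) Gb Y that)
  have j: "integrable lborel (\<lambda>x. u x ^ p * (grad (\<lambda>x. Y x \<bullet> b) x \<bullet> b))" if b: "b \<in> Basis" for b
  proof -
    obtain K where K: "\<And>x. \<bar>Y x \<bullet> b\<bar> \<le> K" "\<And>x. \<bar>grad (\<lambda>x. Y x \<bullet> b) x \<bullet> b\<bar> \<le> K"
      and m: "(\<lambda>x. Y x \<bullet> b) \<in> borel_measurable borel" "(\<lambda>x. grad (\<lambda>x. Y x \<bullet> b) x \<bullet> b) \<in> borel_measurable borel"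
      by (rule C1c_bounds[OF Y[OF b], of b]) blast
    show ?thesis
    proof (rule Bochner_Integration.integrable_bound)
      show "integrable lborel (\<lambda>x. u x ^ p * K)" using up by simp
      have "\<bar>u x ^ p\<bar> * \<bar>grad (\<lambda>x. Y x \<bullet> b) x \<bullet> b\<bar> \<le> \<bar>u x ^ p\<bar> * \<bar>K\<bar>" for x
        using K(2)[of x] by (intro mult_left_mono) auto
      then show "AE x in lborel. norm (u x ^ p * (grad (\<lambda>x. Y x \<bullet> b) x \<bullet> b)) \<le> norm (u x ^ p * K)"
        by (simp add: abs_mult)
      show "(\<lambda>x. u x ^ p * (grad (\<lambda>x. Y x \<bullet> b) x \<bullet> b)) \<in> borel_measurable lborel"
        using borel_measurable_times[OF borel_measurable_integrable[OF up], of "\<lambda>x. grad (\<lambda>x. Y x \<bullet> b) x \<bullet> b"] m(2) by simp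
    qed
  qed
  have e1: "u x ^ (p - 1) * (Y x \<bullet> G x) = (\<Sum>b\<in>Basis. u x ^ (p - 1) * ((Y x \<bullet> b) * (G x \<bullet> b)))" for x
    by (subst euclidean_inner[of "Y x"]) (simp add: sum_distrib_left)
  have e2: "u x ^ p * divergence Y x = (\<Sum>b\<in>Basis. u x ^ p * (grad (\<lambda>x. Y x \<bullet> b) x \<bullet> b))" for x
    by (simp add: divergence_def sum_distrib_left)
  show "integrable lborel (\<lambda>x. u x ^ p * divergence Y x)"
    unfolding e2 by (intro Bochner_Integration.integrable_sum j)
  have "real p * (LBINT x. u x ^ (p - 1) * (Y x \<bullet> G x))
      = (\<Sum>b\<in>Basis. real p * (LBINT x. u x ^ (p - 1) * ((Y x \<bullet> b) * (G x \<bullet> b))))"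
    unfolding e1 using i by (subst Bochner_Integration.integral_sum) (auto simp: sum_distrib_left)
  also have "\<dots> = (\<Sum>b\<in>Basis. - (LBINT x. u x ^ p * (grad (\<lambda>x. Y x \<bullet> b) x \<bullet> b)))"
  proof (rule sum.cong[OF refl])
    fix b :: R3 assume b: "b \<in> Basis"
    have "real p * (LBINT x. u x ^ (p - 1) * ((Y x \<bullet> b) * (G x \<bullet> b))) = (LBINT x. real p * (u x ^ (p - 1) * ((Y x \<bullet> b) * (G x \<bullet> b))))"
      by simp
    also have "\<dots> = (LBINT x. real p * u x ^ (p - 1) * (G x \<bullet> b) * (Y x \<bullet> b))" by (simp add: mult_ac)
    also have "\<dots> = - (LBINT x. u x ^ p * (grad (\<lambda>x. Y x \<bullet> b) x \<bullet> b))"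
      by (rule power_by_parts[OF p ev up uG Y[OF b]])
    finally show "real p * (LBINT x. u x ^ (p - 1) * ((Y x \<bullet> b) * (G x \<bullet> b))) = - (LBINT x. u x ^ p * (grad (\<lambda>x. Y x \<bullet> b) x \<bullet> b))" .
  qed
  also have "\<dots> = - (LBINT x. u x ^ p * divergence Y x)"
    unfolding e2 using j by (subst Bochner_Integration.integral_sum) (auto simp: sum_negf)
  finally show "real p * (LBINT x. u x ^ (p - 1) * (Y x \<bullet> G x)) = - (LBINT x. u x ^ p * divergence Y x)" .
qed

lemma divergence_scaled:
  fixes X :: "'a::euclidean_space \<Rightarrow> 'a"
  assumes k: "Ck 1 k" and X: "\<And>b. b \<in> Basis \<Longrightarrow> C1c (\<lambda>x. X x \<bullet> b)"
  shows "b \<in> Basis \<Longrightarrow> C1c (\<lambda>x. (k x *\<^sub>R X x) \<bullet> b)"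
    "divergence (\<lambda>x. k x *\<^sub>R X x) x = k x * divergence X x + grad k x \<bullet> X x"
proof -
  show "b \<in> Basis \<Longrightarrow> C1c (\<lambda>x. (k x *\<^sub>R X x) \<bullet> b)" by (simp add: C1c_mult[OF k X])
  have "grad (\<lambda>x. (k x *\<^sub>R X x) \<bullet> b) x = k x *\<^sub>R grad (\<lambda>x. X x \<bullet> b) x + (X x \<bullet> b) *\<^sub>R grad k x" if "b \<in> Basis" for b
    using k C1cD(5)[OF X[OF that]] by (simp add: grad_mult)
  then have "divergence (\<lambda>x. k x *\<^sub>R X x) x = (\<Sum>b\<in>Basis. k x * (grad (\<lambda>x. X x \<bullet> b) x \<bullet> b) + (grad k x \<bullet> b) * (X x \<bullet> b))"
    unfolding divergence_def by (intro sum.cong refl) (simp add: inner_add_left mult.commute)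
  also have "\<dots> = k x * divergence X x + grad k x \<bullet> X x"
    unfolding euclidean_inner[of "grad k x" "X x"] by (simp add: sum.distrib divergence_def sum_distrib_left)
  finally show "divergence (\<lambda>x. k x *\<^sub>R X x) x = k x * divergence X x + grad k x \<bullet> X x" .
qed

context schroedinger_poisson
begin

context
  fixes X :: "R3 \<Rightarrow> R3"
  assumes X: "\<And>b. b \<in> Basis \<Longrightarrow> C1c (\<lambda>x. X x \<bullet> b)"
begin

lemma uX_L2: "L2 (\<lambda>x. X x \<bullet> Gu x)"
  using field_integrable(1)[OF X Gu_L2] .

lemma power_term: "6 * (LBINT x. u x ^ 5 * (X x \<bullet> Gu x)) = - (LBINT x. u x ^ 6 * divergence X x)"
  using field_power_by_parts(1)[OF u_pair _ _ u6_int _ X] u_quintic_L2 by simp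

lemma potential_term: "2 * (LBINT x. V x * u x * (X x \<bullet> Gu x))
    = - (LBINT x. (u x)\<^sup>2 * (V x * divergence X x + grad V x \<bullet> X x))"
proof -
  have "real 2 * (LBINT x. u x ^ (2 - 1) * ((V x *\<^sub>R X x) \<bullet> Gu x)) = - (LBINT x. u x ^ 2 * divergence (\<lambda>x. V x *\<^sub>R X x) x)"
    by (rule field_power_by_parts(1)[OF u_pair]) (use u2_int u_L2 divergence_scaled(1)[OF V_C1 X] in simp_all)
  then show ?thesis by (simp add: divergence_scaled(2)[OF V_C1 X] mult_ac)
qed

lemma divergence_L2_mult:
  assumes "tendsto_L2 F f"
  shows "tendsto_L2 (\<lambda>n x. divergence X x * F n x) (\<lambda>x. divergence X x * f x)"
proof -
  have "tendsto_L2 (\<lambda>n x. \<Sum>c\<in>Basis. (grad (\<lambda>x. X x \<bullet> c) x \<bullet> c) * F n x) (\<lambda>x. \<Sum>c\<in>Basis. (grad (\<lambda>x. X x \<bullet> c) x \<bullet> c) * f x)"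
    by (intro tendsto_L2_sum tendsto_L2_C1c_mult(2) assms X)
  then show ?thesis by (simp add: divergence_def sum_distrib_right)
qed

text \<open>
  Since \<open>u \<nabla>u = \<nabla>(u\<^sup>2)/2\<close>, integration by parts moves the derivative to \<open>\<phi> X\<close>.  As \<open>\<phi>\<close> is only weakly
  differentiable, this is done for the approximations \<open>\<eta>\<^sub>n\<close>; the terms converge because \<open>u \<eta>\<^sub>n \<rightarrow> u \<phi>\<close> in \<open>L\<^sup>2\<close>.
\<close>

lemma coupling_term: "2 * (LBINT x. \<phi> x * u x * (X x \<bullet> Gu x))
    = - (LBINT x. \<phi> x * (u x)\<^sup>2 * divergence X x) - (LBINT x. (u x)\<^sup>2 * (X x \<bullet> G\<phi> x))"
proof -
  have T: "tendsto_L2 (\<lambda>n x. u x * \<eta> n x) (\<lambda>x. u x * \<phi> x)"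
    by (rule \<eta>_mult_tendsto[OF u_meas u_power_int]) simp_all
  have id: "2 * (LBINT x. (u x * \<eta> n x) * (X x \<bullet> Gu x))
     = - (LBINT x. u x * (divergence X x * (u x * \<eta> n x))) - (LBINT x. (u x)\<^sup>2 * (X x \<bullet> grad (\<eta> n) x))" for n
  proof -
    note t1 = test_functionD(1)[OF \<eta>_test, of 1 n]
    have "real 2 * (LBINT x. u x ^ (2 - 1) * ((\<eta> n x *\<^sub>R X x) \<bullet> Gu x)) = - (LBINT x. u x ^ 2 * divergence (\<lambda>x. \<eta> n x *\<^sub>R X x) x)"
      by (rule field_power_by_parts(1)[OF u_pair]) (use u2_int u_L2 divergence_scaled(1)[OF t1 X] in simp_all)
    then have a: "2 * (LBINT x. (u x * \<eta> n x) * (X x \<bullet> Gu x)) = - (LBINT x. (u x)\<^sup>2 * (\<eta> n x * divergence X x + grad (\<eta> n) x \<bullet> X x))"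
      by (simp add: divergence_scaled(2)[OF t1 X] mult.assoc)
    have i: "integrable lborel (\<lambda>x. u x * (divergence X x * (u x * \<eta> n x)))"
      using tendsto_L2D(1)[OF divergence_L2_mult[OF T]] by (intro integrable_mult_L2 u_L2)
    have j: "integrable lborel (\<lambda>x. (u x)\<^sup>2 * (X x \<bullet> grad (\<eta> n) x))"
      by (intro integrable_mult_L2 u_square_L2 field_integrable(1)[OF X] test_function_L2 \<eta>_test)
    have "(u x)\<^sup>2 * (\<eta> n x * divergence X x + grad (\<eta> n) x \<bullet> X x)
        = u x * (divergence X x * (u x * \<eta> n x)) + (u x)\<^sup>2 * (X x \<bullet> grad (\<eta> n) x)" for x
      by (simp add: power2_eq_square algebra_simps inner_commute)
    then show ?thesis using a i j by simp
  qed
  have "(\<lambda>n. 2 * (LBINT x. (u x * \<eta> n x) * (X x \<bullet> Gu x))) \<longlonglongrightarrow> 2 * (LBINT x. (u x * \<phi> x) * (X x \<bullet> Gu x))"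
    by (intro tendsto_mult tendsto_const tendsto_integral_mult T tendsto_L2_const uX_L2)
  moreover have "(\<lambda>n. - (LBINT x. u x * (divergence X x * (u x * \<eta> n x))) - (LBINT x. (u x)\<^sup>2 * (X x \<bullet> grad (\<eta> n) x)))
     \<longlonglongrightarrow> - (LBINT x. u x * (divergence X x * (u x * \<phi> x))) - (LBINT x. (u x)\<^sup>2 * (X x \<bullet> G\<phi> x))"
    by (intro tendsto_diff tendsto_minus tendsto_integral_mult tendsto_L2_const u_L2 u_square_L2 divergence_L2_mult T field_tendsto(1)[OF X \<eta>_grad])
  ultimately have "2 * (LBINT x. (u x * \<phi> x) * (X x \<bullet> Gu x))
     = - (LBINT x. u x * (divergence X x * (u x * \<phi> x))) - (LBINT x. (u x)\<^sup>2 * (X x \<bullet> G\<phi> x))"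
    unfolding id by (rule LIMSEQ_unique)
  then show ?thesis by (simp add: power2_eq_square mult_ac)
qed

text \<open>
  The stress-energy identity for \<open>u\<close>, with the three terms of \<open>f = u\<^sup>5 - V u - \<phi> u\<close> integrated by parts.  The
  coupling leaves \<open>\<integral> u\<^sup>2 X \<bullet> \<nabla>\<phi>\<close>, which is the left-hand side of the stress-energy identity for
  \<open>\<phi>\<close>.
\<close>

lemma pohozaev_field:
  "- (LBINT x. u x ^ 6 * divergence X x) / 6 + (LBINT x. (u x)\<^sup>2 * (V x * divergence X x + grad V x \<bullet> X x)) / 2
    + (LBINT x. \<phi> x * (u x)\<^sup>2 * divergence X x) / 2
    + ((LBINT x. jacobian_form X x (G\<phi> x)) - (LBINT x. (G\<phi> x \<bullet> G\<phi> x) * divergence X x) / 2) / 2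
   = (LBINT x. jacobian_form X x (Gu x)) - (LBINT x. (Gu x \<bullet> Gu x) * divergence X x) / 2"
proof -
  define f where "f x = u x ^ 5 - V x * u x - \<phi> x * u x" for x
  have fL: "L2 f" unfolding f_def by (intro L2_diff u_quintic_L2 Vu_L2 \<phi>u_L2)
  have eqf: "(LBINT x. Gu x \<bullet> grad \<psi> x) = (LBINT x. f x * \<psi> x)" if t: "test_function \<psi>" for \<psi>
  proof -
    note L = test_function_L2[OF t]
    note i = integrable_mult_L2[OF Vu_L2 L(1)] integrable_mult_L2[OF \<phi>u_L2 L(1)] integrable_mult_L2[OF u_quintic_L2 L(1)]
      integrable_inner_L2[OF Gu_L2 L(2)]
    have "(LBINT x. Gu x \<bullet> grad \<psi> x) + (LBINT x. V x * u x * \<psi> x) + (LBINT x. \<phi> x * u x * \<psi> x) = (LBINT x. u x ^ 5 * \<psi> x)"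
      using eq_u[OF t] i by simp
    then show ?thesis unfolding f_def left_diff_distrib using i by simp
  qed
  have P1: "(LBINT x. f x * (X x \<bullet> Gu x)) = (LBINT x. jacobian_form X x (Gu x)) - (LBINT x. (Gu x \<bullet> Gu x) * divergence X x) / 2"
    by (rule stress_energy[OF u_weak_gradient Gu_L2 fL eqf X])
  have P2: "(LBINT x. (u x)\<^sup>2 * (X x \<bullet> G\<phi> x)) = (LBINT x. jacobian_form X x (G\<phi> x)) - (LBINT x. (G\<phi> x \<bullet> G\<phi> x) * divergence X x) / 2"
    by (rule stress_energy[OF \<phi>_weak_gradient G\<phi>_L2 u_square_L2 eq_\<phi> X])
  note j = integrable_mult_L2[OF Vu_L2 uX_L2] integrable_mult_L2[OF \<phi>u_L2 uX_L2] integrable_mult_L2[OF u_quintic_L2 uX_L2]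
  have P0: "(LBINT x. f x * (X x \<bullet> Gu x)) = (LBINT x. u x ^ 5 * (X x \<bullet> Gu x)) - (LBINT x. V x * u x * (X x \<bullet> Gu x))
     - (LBINT x. \<phi> x * u x * (X x \<bullet> Gu x))"
    unfolding f_def left_diff_distrib using j by simp
  have combine: "- a / 6 + b / 2 + c / 2 + (d - e / 2) / 2 = g - h / 2"
    if "F = i - j - k" "F = g - h / 2" "P = d - e / 2" "6 * i = - a" "2 * j = - b" "2 * k = - c - P"
    for a b c d e g h i j k F P :: real
    using that by (simp add: field_simps)
  show ?thesis by (rule combine[OF P0 P1 P2 power_term potential_term coupling_term])
qed

end

lemma cutoff_tendsto_integral:
  fixes w :: "R3 \<Rightarrow> real" and k :: "nat \<Rightarrow> R3 \<Rightarrow> real"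
  assumes w: "integrable lborel w" and m: "\<And>n. (\<lambda>x. k n x) \<in> borel_measurable borel" "l \<in> borel_measurable borel"
    and b: "\<And>n x. \<bar>k n x\<bar> \<le> K * w x" and t: "\<And>x. (\<lambda>n. k n x) \<longlonglongrightarrow> l x"
  shows "(\<lambda>n. LBINT x. k n x) \<longlonglongrightarrow> (LBINT x. l x)"
  by (rule integral_dominated_convergence[where w="\<lambda>x. K * w x"]) (use assms in auto)

text \<open>
  The fields \<open>X\<^sub>n = (cutoff n) x\<close> converge to the generator \<open>x\<close> of the dilations with \<open>div X\<^sub>n \<rightarrow> 3\<close> and
  \<open>DX\<^sub>n \<rightarrow> id\<close> boundedly, and \<open>\<nabla>V \<bullet> X\<^sub>n\<close> is bounded because \<open>\<nabla>V \<bullet> x\<close> is.  All remaining factors are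
  integrable, so dominated convergence applies.
\<close>

lemma pohozaev:
  "- (LBINT x. u x ^ 6) / 2 + 3 / 2 * (LBINT x. V x * (u x)\<^sup>2) + (LBINT x. (u x)\<^sup>2 * (grad V x \<bullet> x)) / 2
    + 3 / 2 * (LBINT x. \<phi> x * (u x)\<^sup>2) - (LBINT x. (norm (G\<phi> x))\<^sup>2) / 4
   = - (LBINT x. (norm (Gu x))\<^sup>2) / 2"
proof -
  define X where "X n x = cutoff n x *\<^sub>R x" for n and x :: R3
  note cf = cutoff_field[where 'a=R3, folded X_def]
  obtain K where K: "K > 0" "\<And>n x. \<bar>cutoff n (x::R3)\<bar> \<le> K" "\<And>n x. real (Suc n) * norm (grad (cutoff n) (x::R3)) \<le> K"
    "\<And>n x. norm x * norm (grad (cutoff n) (x::R3)) \<le> K" by (rule cutoff_bounds[where 'a=R3]) blast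
  have [measurable]: "(cutoff n :: R3 \<Rightarrow> real) \<in> borel_measurable borel" "(grad (cutoff n) :: R3 \<Rightarrow> R3) \<in> borel_measurable borel" for n
    using C1cD(2,3)[OF smooth_kernel_C1c[OF cutoff_smooth_kernel[where 'a=R3, of n]]] borel_measurable_continuous_onI by blast+
  have [measurable]: "(\<lambda>x. grad V x) \<in> borel_measurable borel"
    using Ck_imp_continuous_grad[of 0 V] V_C1 by (intro borel_measurable_continuous_onI) simp
  have ct: "(\<lambda>n. cutoff n x) \<longlonglongrightarrow> 1" for x :: R3 by (rule cutoff_tendsto)
  have gt: "(\<lambda>n. grad (cutoff n) x \<bullet> w) \<longlonglongrightarrow> 0" for x w :: R3
  proof (rule Lim_null_comparison)
    show "\<forall>\<^sub>F n in sequentially. norm (grad (cutoff n) x \<bullet> w) \<le> norm (grad (cutoff n) x) * norm w"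
      by (intro always_eventually allI) (simp add: Cauchy_Schwarz_ineq2)
    show "(\<lambda>n. norm (grad (cutoff n) x) * norm w) \<longlonglongrightarrow> 0"
      using tendsto_mult[OF grad_cutoff_tendsto[of x] tendsto_const[of "norm w"]] by simp
  qed
  have gx: "\<bar>grad (cutoff n) x \<bullet> x\<bar> \<le> K" for n and x :: R3
    using Cauchy_Schwarz_ineq2[of "grad (cutoff n) x" x] K(4)[of x n] by (simp add: mult.commute)
  have div: "divergence (X n) x = 3 * cutoff n x + grad (cutoff n) x \<bullet> x" for n x
    using cf(2)[of n x] by simp
  have divm [measurable]: "(\<lambda>x. divergence (X n) x) \<in> borel_measurable borel" for n unfolding div by measurable
  have divb: "\<bar>divergence (X n) x\<bar> \<le> 4 * K" for n x
    unfolding div using K(2)[of n x] gx[of n x] by linarith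
  have divt: "(\<lambda>n. divergence (X n) x) \<longlonglongrightarrow> 3" for x
    unfolding div using tendsto_add[OF tendsto_mult[OF tendsto_const[of 3] ct[of x]] gt[of x x]] by simp
  have jac: "jacobian_form (X n) x w = cutoff n x * (w \<bullet> w) + (w \<bullet> x) * (grad (cutoff n) x \<bullet> w)" for n x w
    by (rule cf(3))
  have jacb: "\<bar>jacobian_form (X n) x w\<bar> \<le> (2 * K) * (norm w)\<^sup>2" for n x w
  proof -
    have "\<bar>cutoff n x * (w \<bullet> w)\<bar> \<le> K * (norm w)\<^sup>2"
      unfolding abs_mult using K(2)[of n x] by (intro mult_mono) (auto simp: power2_norm_eq_inner)
    moreover have "\<bar>(w \<bullet> x) * (grad (cutoff n) x \<bullet> w)\<bar> \<le> (norm w * norm x) * (norm (grad (cutoff n) x) * norm w)"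
      unfolding abs_mult by (intro mult_mono Cauchy_Schwarz_ineq2) auto
    moreover have "(norm w * norm x) * (norm (grad (cutoff n) x) * norm w) = (norm x * norm (grad (cutoff n) x)) * (norm w)\<^sup>2"
      by (simp add: power2_eq_square)
    moreover have "(norm x * norm (grad (cutoff n) x)) * (norm w)\<^sup>2 \<le> K * (norm w)\<^sup>2" using K(4)[of x n] by (intro mult_right_mono) auto
    ultimately show ?thesis unfolding jac by linarith
  qed
  have jact: "(\<lambda>n. jacobian_form (X n) x w) \<longlonglongrightarrow> w \<bullet> w" for x w
    unfolding jac using tendsto_add[OF tendsto_mult[OF ct[of x] tendsto_const[of "w \<bullet> w"]] tendsto_mult[OF tendsto_const[of "w \<bullet> x"] gt[of x w]]] by simp
  have divlim: "(\<lambda>n. LBINT x. w x * divergence (X n) x) \<longlonglongrightarrow> (LBINT x. w x * 3)" if w: "integrable lborel w" for w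
  proof (rule cutoff_tendsto_integral[where w="\<lambda>x. \<bar>w x\<bar>" and K="4 * K"])
    have [measurable]: "w \<in> borel_measurable borel" using borel_measurable_integrable[OF w] by simp
    show "(\<lambda>x. w x * divergence (X n) x) \<in> borel_measurable borel" "(\<lambda>x. w x * 3) \<in> borel_measurable borel" for n by measurable
    show "\<bar>w x * divergence (X n) x\<bar> \<le> 4 * K * \<bar>w x\<bar>" for n x
      using mult_left_mono[OF divb[of n x], of "\<bar>w x\<bar>"] by (simp add: abs_mult mult_ac)
    show "(\<lambda>n. w x * divergence (X n) x) \<longlonglongrightarrow> w x * 3" for x by (intro tendsto_mult tendsto_const divt)
  qed (use w in simp)
  have jaclim: "(\<lambda>n. LBINT x. jacobian_form (X n) x (G x)) \<longlonglongrightarrow> (LBINT x. G x \<bullet> G x)" if G: "L2 G" for G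
  proof (rule cutoff_tendsto_integral[OF L2_integrable[OF G] _ _ jacb jact])
    have [measurable]: "G \<in> borel_measurable borel" using G by (simp add: L2_def)
    show "(\<lambda>x. jacobian_form (X n) x (G x)) \<in> borel_measurable borel" "(\<lambda>x. G x \<bullet> G x) \<in> borel_measurable borel" for n
      unfolding jac by measurable
  qed
  have iV: "integrable lborel (\<lambda>x. V x * (u x)\<^sup>2)"
    using integrable_mult_L2[OF Vu_L2 u_L2] by (simp add: power2_eq_square mult.assoc)
  have iVr: "integrable lborel (\<lambda>x. (u x)\<^sup>2 * (grad V x \<bullet> x))"
  proof (rule Bochner_Integration.integrable_bound)
    show "integrable lborel (\<lambda>x. C3 * (u x)\<^sup>2)" using u2_int by simp
    show "AE x in lborel. norm ((u x)\<^sup>2 * (grad V x \<bullet> x)) \<le> norm (C3 * (u x)\<^sup>2)"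
    proof (intro AE_I2)
      fix x
      have "\<bar>grad V x \<bullet> x\<bar> \<le> \<bar>C3\<bar>" using V_radial[of x] by linarith
      then show "norm ((u x)\<^sup>2 * (grad V x \<bullet> x)) \<le> norm (C3 * (u x)\<^sup>2)"
        by (simp add: abs_mult mult.commute mult_right_mono)
    qed
  qed measurable
  have Vlim: "(\<lambda>n. LBINT x. (u x)\<^sup>2 * (V x * divergence (X n) x + grad V x \<bullet> X n x))
     \<longlonglongrightarrow> (LBINT x. (u x)\<^sup>2 * (V x * 3 + grad V x \<bullet> x))"
  proof (rule cutoff_tendsto_integral[where w="\<lambda>x. (u x)\<^sup>2" and K="C2 * (4 * K) + K * C3"])
    show "integrable lborel (\<lambda>x. (u x)\<^sup>2)" by (rule u2_int)
    show "(\<lambda>x. (u x)\<^sup>2 * (V x * divergence (X n) x + grad V x \<bullet> X n x)) \<in> borel_measurable borel"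
      "(\<lambda>x. (u x)\<^sup>2 * (V x * 3 + grad V x \<bullet> x)) \<in> borel_measurable borel" for n
      unfolding X_def[of n] div by measurable
    show "\<bar>(u x)\<^sup>2 * (V x * divergence (X n) x + grad V x \<bullet> X n x)\<bar> \<le> (C2 * (4 * K) + K * C3) * (u x)\<^sup>2" for n x
    proof -
      have "\<bar>V x * divergence (X n) x\<bar> \<le> C2 * (4 * K)"
        unfolding abs_mult using V_abs[of x] divb[of n x] by (intro mult_mono) (auto intro: order_trans[OF abs_ge_zero])
      moreover have "\<bar>grad V x \<bullet> X n x\<bar> \<le> K * C3"
        unfolding X_def inner_scaleR_right abs_mult using K(1,2) V_radial[of x] by (intro mult_mono) auto
      ultimately have "\<bar>V x * divergence (X n) x + grad V x \<bullet> X n x\<bar> \<le> C2 * (4 * K) + K * C3" by linarith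
      from mult_left_mono[OF this zero_le_power2[of "u x"]] show ?thesis by (simp add: abs_mult mult.commute)
    qed
    show "(\<lambda>n. (u x)\<^sup>2 * (V x * divergence (X n) x + grad V x \<bullet> X n x)) \<longlonglongrightarrow> (u x)\<^sup>2 * (V x * 3 + grad V x \<bullet> x)" for x
    proof -
      have "(\<lambda>n. cutoff n x * (grad V x \<bullet> x)) \<longlonglongrightarrow> 1 * (grad V x \<bullet> x)" by (intro tendsto_mult ct tendsto_const)
      then have "(\<lambda>n. grad V x \<bullet> X n x) \<longlonglongrightarrow> grad V x \<bullet> x" by (simp add: X_def)
      then show ?thesis by (intro tendsto_mult tendsto_add tendsto_const divt)
    qed
  qed
  have iGu: "integrable lborel (\<lambda>x. Gu x \<bullet> Gu x)" and iG\<phi>: "integrable lborel (\<lambda>x. G\<phi> x \<bullet> G\<phi> x)"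
    by (intro integrable_inner_L2 Gu_L2 G\<phi>_L2)+
  have L: "(\<lambda>n. - (LBINT x. u x ^ 6 * divergence (X n) x) / 6 + (LBINT x. (u x)\<^sup>2 * (V x * divergence (X n) x + grad V x \<bullet> X n x)) / 2
    + (LBINT x. \<phi> x * (u x)\<^sup>2 * divergence (X n) x) / 2
    + ((LBINT x. jacobian_form (X n) x (G\<phi> x)) - (LBINT x. (G\<phi> x \<bullet> G\<phi> x) * divergence (X n) x) / 2) / 2)
    \<longlonglongrightarrow> - (LBINT x. u x ^ 6 * 3) / 6 + (LBINT x. (u x)\<^sup>2 * (V x * 3 + grad V x \<bullet> x)) / 2
    + (LBINT x. \<phi> x * (u x)\<^sup>2 * 3) / 2
    + ((LBINT x. G\<phi> x \<bullet> G\<phi> x) - (LBINT x. (G\<phi> x \<bullet> G\<phi> x) * 3) / 2) / 2"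
    by (intro tendsto_add tendsto_diff tendsto_minus tendsto_divide tendsto_const divlim Vlim jaclim u6_int \<phi>u2_int iG\<phi> G\<phi>_L2) simp_all
  have R: "(\<lambda>n. (LBINT x. jacobian_form (X n) x (Gu x)) - (LBINT x. (Gu x \<bullet> Gu x) * divergence (X n) x) / 2)
    \<longlonglongrightarrow> (LBINT x. Gu x \<bullet> Gu x) - (LBINT x. (Gu x \<bullet> Gu x) * 3) / 2"
    by (intro tendsto_diff tendsto_divide tendsto_const divlim jaclim iGu Gu_L2) simp_all
  have eq: "- (LBINT x. u x ^ 6 * 3) / 6 + (LBINT x. (u x)\<^sup>2 * (V x * 3 + grad V x \<bullet> x)) / 2
    + (LBINT x. \<phi> x * (u x)\<^sup>2 * 3) / 2
    + ((LBINT x. G\<phi> x \<bullet> G\<phi> x) - (LBINT x. (G\<phi> x \<bullet> G\<phi> x) * 3) / 2) / 2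
    = (LBINT x. Gu x \<bullet> Gu x) - (LBINT x. (Gu x \<bullet> Gu x) * 3) / 2"
  proof (rule LIMSEQ_unique[OF L])
    have "C1c (\<lambda>x. X n x \<bullet> b)" if "b \<in> Basis" for n b using cf(1)[OF that] .
    from pohozaev_field[OF this] R show "(\<lambda>n. - (LBINT x. u x ^ 6 * divergence (X n) x) / 6 + (LBINT x. (u x)\<^sup>2 * (V x * divergence (X n) x + grad V x \<bullet> X n x)) / 2
      + (LBINT x. \<phi> x * (u x)\<^sup>2 * divergence (X n) x) / 2
      + ((LBINT x. jacobian_form (X n) x (G\<phi> x)) - (LBINT x. (G\<phi> x \<bullet> G\<phi> x) * divergence (X n) x) / 2) / 2)
      \<longlonglongrightarrow> (LBINT x. Gu x \<bullet> Gu x) - (LBINT x. (Gu x \<bullet> Gu x) * 3) / 2"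
      by (simp only:)
  qed
  have eV: "(LBINT x. (u x)\<^sup>2 * (V x * 3 + grad V x \<bullet> x)) = 3 * (LBINT x. V x * (u x)\<^sup>2) + (LBINT x. (u x)\<^sup>2 * (grad V x \<bullet> x))"
  proof -
    have "(u x)\<^sup>2 * (V x * 3 + grad V x \<bullet> x) = 3 * (V x * (u x)\<^sup>2) + (u x)\<^sup>2 * (grad V x \<bullet> x)" for x by (simp add: algebra_simps)
    then show ?thesis using iV iVr by simp
  qed
  show ?thesis using eq unfolding eV power2_norm_eq_inner by (simp add: add_divide_distrib)
qed

text \<open>
  In the combination of the Pohozaev identity with the two energy identities the terms \<open>\<integral> |\<nabla>u|\<^sup>2\<close> and
  \<open>\<integral> u\<^sup>6\<close> disappear, and \<open>\<integral> V u\<^sup>2 + \<integral> u\<^sup>2 (\<nabla>V \<bullet> x) / 2 + 3/4 \<integral> |\<nabla>\<phi>|\<^sup>2 = 0\<close> remains, a sum of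
  nonnegative terms.
\<close>

lemma solution_vanishes: "AE x in lborel. u x = 0" "AE x in lborel. \<phi> x = 0"
proof -
  let ?P = "LBINT x. \<phi> x * (u x)\<^sup>2"
  have iV: "integrable lborel (\<lambda>x. V x * (u x)\<^sup>2)"
    using integrable_mult_L2[OF Vu_L2 u_L2] by (simp add: power2_eq_square mult.assoc)
  have V0: "0 \<le> V x * (u x)\<^sup>2" for x using V_bounds(1)[of x] C1_pos by simp
  have P: "0 \<le> (LBINT x. V x * (u x)\<^sup>2)" "0 \<le> (LBINT x. (u x)\<^sup>2 * (grad V x \<bullet> x))" "0 \<le> (LBINT x. (norm (G\<phi> x))\<^sup>2)"
    using V0 V_radial(1) by (auto intro!: integral_nonneg_AE)
  have "(LBINT x. V x * (u x)\<^sup>2) + (LBINT x. (u x)\<^sup>2 * (grad V x \<bullet> x)) / 2 + 3 / 4 * (LBINT x. (norm (G\<phi> x))\<^sup>2) = 0"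
    using pohozaev nehari_u nehari_\<phi> by linarith
  then have z: "(LBINT x. V x * (u x)\<^sup>2) = 0" "(LBINT x. (norm (G\<phi> x))\<^sup>2) = 0" using P by linarith+
  have "AE x in lborel. V x * (u x)\<^sup>2 = 0"
    using integral_nonneg_eq_0_iff_AE[OF iV] V0 z(1) by simp
  then show "AE x in lborel. u x = 0"
  proof eventually_elim
    case (elim x) then show ?case using V_bounds(1)[of x] C1_pos by auto
  qed
  have "(LBINT x. \<phi> x ^ 6) = 0"
    using sobolev_\<phi> unfolding z(2) by (simp add: antisym integral_nonneg_AE zero_le_even_power)
  then have "AE x in lborel. \<phi> x ^ 6 = 0"
    using integral_nonneg_eq_0_iff_AE[OF \<phi>6] by (simp add: zero_le_even_power)
  then show "AE x in lborel. \<phi> x = 0" by simp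
qed

end

section \<open>Borel representatives and the theorem\<close>

lemma borel_imp_lebesgue: "f \<in> borel_measurable borel \<Longrightarrow> f \<in> borel_measurable lebesgue"
  by (rule measurable_completion) simp

lemma integral_lebesgue_lborel:
  fixes f f' :: "'a::euclidean_space \<Rightarrow> 'b::{banach,second_countable_topology}"
  assumes "f \<in> borel_measurable lebesgue" "f' \<in> borel_measurable borel" "AE x in lborel. f x = f' x"
  shows "integral\<^sup>L lebesgue f = integral\<^sup>L lborel f'" "integrable lebesgue f \<longleftrightarrow> integrable lborel f'"
proof -
  have m: "f' \<in> borel_measurable lborel" "f' \<in> borel_measurable lebesgue"
    by (simp_all add: assms(2) borel_imp_lebesgue)
  have ae: "AE x in lebesgue. f x = f' x" using assms(3) by (rule AE_completion)
  show "integral\<^sup>L lebesgue f = integral\<^sup>L lborel f'"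
    using integral_cong_AE[OF assms(1) m(2) ae] integral_completion[OF m(1)] by simp
  show "integrable lebesgue f \<longleftrightarrow> integrable lborel f'"
    using integrable_cong_AE[OF assms(1) m(2) ae] integrable_completion[OF m(1)] by simp
qed

lemma borel_version:
  fixes f :: "'a::euclidean_space \<Rightarrow> 'b::euclidean_space"
  assumes "f \<in> borel_measurable lebesgue"
  obtains f' where "f' \<in> borel_measurable borel" "AE x in lborel. f x = f' x"
proof -
  have "\<exists>g. g \<in> borel_measurable lborel \<and> (AE x in lborel. f x \<bullet> b = g x)" for b
  proof -
    have "(\<lambda>x. f x \<bullet> b) \<in> borel_measurable lebesgue" using assms by measurable
    then show ?thesis using completion_ex_borel_measurable_real by blast
  qed
  then obtain g where g: "\<And>b. g b \<in> borel_measurable lborel" "\<And>b. AE x in lborel. f x \<bullet> b = g b x" by metis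
  show ?thesis
  proof (rule that[of "\<lambda>x. \<Sum>b\<in>Basis. g b x *\<^sub>R b"])
    show "(\<lambda>x. \<Sum>b\<in>Basis. g b x *\<^sub>R b) \<in> borel_measurable borel"
      using g(1) by (intro borel_measurable_sum borel_measurable_scaleR borel_measurable_const) simp
    have "AE x in lborel. \<forall>b\<in>Basis. f x \<bullet> b = g b x"
      using g(2) by (intro AE_finite_allI) auto
    then show "AE x in lborel. f x = (\<Sum>b\<in>Basis. g b x *\<^sub>R b)"
    proof eventually_elim
      case (elim x)
      then show ?case by (subst euclidean_representation[of "f x", symmetric]) (auto intro!: sum.cong)
    qed
  qed
qed

lemma locally_integrable_measurable:
  fixes f :: "R3 \<Rightarrow> 'b::euclidean_space"
  assumes "locally_integrable f"
  shows "f \<in> borel_measurable lebesgue"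
proof (rule borel_measurable_LIMSEQ_metric)
  show "(\<lambda>x. indicator (cball 0 (real n)) x *\<^sub>R f x) \<in> borel_measurable lebesgue" for n
    using assms borel_measurable_integrable
    unfolding locally_integrable_def set_integrable_def by (metis compact_cball)
  show "(\<lambda>n. indicator (cball 0 (real n)) x *\<^sub>R f x) \<longlonglongrightarrow> f x" for x
  proof -
    obtain N where "norm x \<le> real N" using real_arch_simple by blast
    then have "eventually (\<lambda>n. f x = indicator (cball 0 (real n)) x *\<^sub>R f x) sequentially"
      unfolding eventually_sequentially by (intro exI[of _ N]) auto
    then show ?thesis by (rule Lim_transform_eventually[OF tendsto_const])
  qed
qed

lemma locally_integrable_loc_int:
  fixes f :: "R3 \<Rightarrow> 'b::euclidean_space"
  assumes "locally_integrable f" and f': "f' \<in> borel_measurable borel" "AE x in lborel. f x = f' x"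
  shows "loc_int (\<lambda>x. f' x \<bullet> b)"
  unfolding loc_int_def
proof (intro conjI allI)
  show "(\<lambda>x. f' x \<bullet> b) \<in> borel_measurable borel" using f' by measurable
  fix r
  have i: "integrable lebesgue (\<lambda>x. indicator (cball 0 r) x *\<^sub>R f x)"
    using assms(1) unfolding locally_integrable_def set_integrable_def by (metis compact_cball)
  have "integrable lborel (\<lambda>x. indicator (cball 0 r) x *\<^sub>R f' x)"
  proof (rule integral_lebesgue_lborel(2)[THEN iffD1, OF _ _ _ i])
    show "(\<lambda>x. indicator (cball 0 r) x *\<^sub>R f x) \<in> borel_measurable lebesgue" using i by (rule borel_measurable_integrable)
    show "(\<lambda>x. indicator (cball 0 r) x *\<^sub>R f' x) \<in> borel_measurable borel"
      by (intro borel_measurable_scaleR borel_measurable_indicator f') simp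
    show "AE x in lborel. indicator (cball 0 r) x *\<^sub>R f x = indicator (cball 0 r) x *\<^sub>R f' x"
      using f'(2) by eventually_elim simp
  qed
  from integrable_inner_left[OF this, of b]
  show "integrable lborel (\<lambda>x. indicator (cball 0 r) x * (f' x \<bullet> b))" by simp
qed

text \<open>
  The integrals agree because the functions agree almost everywhere; components may be taken inside the vector-valued
  integrals since both integrands are integrable.
\<close>

lemma has_weak_gradient_version:
  assumes w: "has_weak_gradient u G"
    and u': "u' \<in> borel_measurable borel" "AE x in lborel. u x = u' x"
    and G': "G' \<in> borel_measurable borel" "AE x in lborel. G x = G' x"
  shows "weak_gradient u' G'"
proof -
  have li: "locally_integrable u" "locally_integrable G" using w by (auto simp: has_weak_gradient_def)
  note m = li[THEN locally_integrable_measurable]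
  have lu: "loc_int u'" using locally_integrable_loc_int[OF li(1) u', of 1] by simp
  have lG: "loc_int (\<lambda>x. G' x \<bullet> b)" for b by (rule locally_integrable_loc_int[OF li(2) G'])
  show ?thesis
    unfolding weak_gradient_def
  proof (intro conjI ballI allI impI lu lG)
    fix \<psi> and b :: R3 assume t: "test_function \<psi>" and b: "b \<in> Basis"
    note c = C1cD[OF test_functionD(3)[OF t]]
    have mt: "\<psi> \<in> borel_measurable borel" "grad \<psi> \<in> borel_measurable borel"
      using c borel_measurable_continuous_onI by blast+
    then have mt': "\<psi> \<in> borel_measurable lebesgue" "grad \<psi> \<in> borel_measurable lebesgue"
      by (simp_all add: borel_imp_lebesgue)
    have iu: "integrable lborel (\<lambda>x. u' x *\<^sub>R grad \<psi> x)"
    proof -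
      have "integrable lborel (\<lambda>x. \<Sum>c\<in>Basis. ((grad \<psi> x \<bullet> c) * u' x) *\<^sub>R c)"
        by (intro Bochner_Integration.integrable_sum integrable_scaleR_left loc_int_integrable_mult[OF lu]
            continuous_intros c bounded_support_inner1 bounded_support_grad)
      moreover have "(\<Sum>c\<in>Basis. ((grad \<psi> x \<bullet> c) * u' x) *\<^sub>R c) = u' x *\<^sub>R grad \<psi> x" for x
      proof -
        have "(\<Sum>c\<in>Basis. ((grad \<psi> x \<bullet> c) * u' x) *\<^sub>R c) = u' x *\<^sub>R (\<Sum>c\<in>Basis. (grad \<psi> x \<bullet> c) *\<^sub>R c)"
          by (simp add: scaleR_sum_right mult.commute)
        then show ?thesis by (simp add: euclidean_representation)
      qed
      ultimately show ?thesis by simp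
    qed
    have iG: "integrable lborel (\<lambda>x. \<psi> x *\<^sub>R G' x)"
    proof -
      have "integrable lborel (\<lambda>x. \<Sum>c\<in>Basis. (\<psi> x * (G' x \<bullet> c)) *\<^sub>R c)"
        by (intro Bochner_Integration.integrable_sum integrable_scaleR_left loc_int_integrable_mult[OF lG] c)
      moreover have "(\<Sum>c\<in>Basis. (\<psi> x * (G' x \<bullet> c)) *\<^sub>R c) = \<psi> x *\<^sub>R G' x" for x
      proof -
        have "(\<Sum>c\<in>Basis. (\<psi> x * (G' x \<bullet> c)) *\<^sub>R c) = \<psi> x *\<^sub>R (\<Sum>c\<in>Basis. (G' x \<bullet> c) *\<^sub>R c)"
          by (simp add: scaleR_sum_right)
        then show ?thesis by (simp add: euclidean_representation)
      qed
      ultimately show ?thesis by simp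
    qed
    have "(LINT x|lebesgue. u x *\<^sub>R grad \<psi> x) = (LBINT x. u' x *\<^sub>R grad \<psi> x)"
      by (rule integral_lebesgue_lborel(1)[OF borel_measurable_scaleR[OF m(1) mt'(2)] borel_measurable_scaleR[OF u'(1) mt(2)]])
         (use u'(2) in eventually_elim, simp)
    moreover have "(LINT x|lebesgue. \<psi> x *\<^sub>R G x) = (LBINT x. \<psi> x *\<^sub>R G' x)"
      by (rule integral_lebesgue_lborel(1)[OF borel_measurable_scaleR[OF mt'(1) m(2)] borel_measurable_scaleR[OF mt(1) G'(1)]])
         (use G'(2) in eventually_elim, simp)
    ultimately have "(LBINT x. u' x *\<^sub>R grad \<psi> x) = - (LBINT x. \<psi> x *\<^sub>R G' x)"
      using w t by (simp add: has_weak_gradient_def)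
    then have "(LBINT x. u' x *\<^sub>R grad \<psi> x) \<bullet> b = - ((LBINT x. \<psi> x *\<^sub>R G' x) \<bullet> b)" by simp
    then show "(LBINT x. u' x * (grad \<psi> x \<bullet> b)) = - (LBINT x. \<psi> x * (G' x \<bullet> b))"
      unfolding integral_inner_left[OF iu, symmetric] integral_inner_left[OF iG, symmetric] inner_scaleR_left .
  qed
qed

lemma loc_int_diff: "loc_int f \<Longrightarrow> loc_int g \<Longrightarrow> loc_int (\<lambda>x. f x - g x)"
  by (auto simp: loc_int_def right_diff_distrib)

lemma weak_gradient_unique:
  assumes 1: "weak_gradient u G" and 2: "weak_gradient u G'"
  shows "AE x in lborel. G x = G' x"
proof -
  have "AE x in lborel. G x \<bullet> b - G' x \<bullet> b = 0" if b: "b \<in> Basis" for b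
  proof (rule integral_zero_imp_AE_zero)
    have l: "loc_int (\<lambda>x. G x \<bullet> b)" "loc_int (\<lambda>x. G' x \<bullet> b)" using 1 2 b by (auto simp: weak_gradient_def)
    then show "loc_int (\<lambda>x. G x \<bullet> b - G' x \<bullet> b)" by (rule loc_int_diff)
    fix \<psi> assume t: "test_function \<psi>"
    note c = C1cD[OF test_functionD(3)[OF t]]
    have e: "(LBINT x. \<psi> x * (W x \<bullet> b)) = - (LBINT x. u x * (grad \<psi> x \<bullet> b))" if "weak_gradient u W" for W
      using that t b by (simp add: weak_gradient_def)
    have "(LBINT x. \<psi> x * (G x \<bullet> b)) = (LBINT x. \<psi> x * (G' x \<bullet> b))"
      unfolding e[OF 1] e[OF 2] ..
    then show "(LBINT x. \<psi> x * (G x \<bullet> b - G' x \<bullet> b)) = 0"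
      using loc_int_integrable_mult[OF l(1) c(2,4)] loc_int_integrable_mult[OF l(2) c(2,4)] by (simp add: right_diff_distrib)
  qed
  then have "AE x in lborel. \<forall>b\<in>Basis. G x \<bullet> b - G' x \<bullet> b = 0" by (intro AE_finite_allI) auto
  then show ?thesis
  proof eventually_elim
    case (elim x)
    show ?case by (rule euclidean_eqI) (use elim in auto)
  qed
qed

lemma Lp_borel_version:
  fixes f :: "R3 \<Rightarrow> 'b::euclidean_space"
  assumes "f \<in> Lp p" "f' \<in> borel_measurable borel" "AE x in lborel. f x = f' x"
  shows "integrable lborel (\<lambda>x. norm (f' x) ^ p)"
proof -
  have m: "f \<in> borel_measurable lebesgue" "integrable lebesgue (\<lambda>x. norm (f x) ^ p)" using assms(1) by (auto simp: Lp_def)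
  show ?thesis
  proof (rule integral_lebesgue_lborel(2)[THEN iffD1, OF _ _ _ m(2)])
    show "(\<lambda>x. norm (f x) ^ p) \<in> borel_measurable lebesgue" using m(1) by measurable
    show "(\<lambda>x. norm (f' x) ^ p) \<in> borel_measurable borel" using assms(2) by measurable
    show "AE x in lborel. norm (f x) ^ p = norm (f' x) ^ p" using assms(3) by eventually_elim simp
  qed
qed

theorem theorem1p4:
  fixes V u \<phi> :: "R3 \<Rightarrow> real" and C1 C2 C3 :: real
  assumes "C1 > 0" and "C2 > 0" and "C3 > 0"
    and "\<And>x. C1 \<le> V x \<and> V x \<le> C2"
    and "Ck 1 V"
    and "\<And>x. 0 \<le> grad V x \<bullet> x \<and> grad V x \<bullet> x \<le> C3"
    and "u \<in> H1" and "\<phi> \<in> D12"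
    and "weak_solution V u \<phi>"
  shows "(AE x in lebesgue. u x = 0) \<and> (AE x in lebesgue. \<phi> x = 0)"
proof -
  have uLp: "u \<in> Lp 2" using assms(7) by (simp add: H1_def)
  obtain G where G: "has_weak_gradient u G" "G \<in> Lp 2" using assms(7) by (auto simp: H1_def)
  have \<phi>Lp: "\<phi> \<in> Lp 6" using assms(8) by (simp add: D12_def)
  obtain \<eta> H where \<eta>: "\<And>n. test_function (\<eta> n)" and H: "H \<in> Lp 2"
    and lim2: "(\<lambda>n. LINT x|lebesgue. norm (grad (\<eta> n) x - H x) ^ 2) \<longlonglongrightarrow> 0"
    and lim6: "(\<lambda>n. LINT x|lebesgue. \<bar>\<eta> n x - \<phi> x\<bar> ^ 6) \<longlonglongrightarrow> 0"
    using assms(8) unfolding D12_def by blast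
  obtain Gu G\<phi> where Gu: "has_weak_gradient u Gu" and G\<phi>: "has_weak_gradient \<phi> G\<phi>"
    and eq1: "\<And>\<psi>. test_function \<psi> \<Longrightarrow>
          (LINT x|lebesgue. Gu x \<bullet> grad \<psi> x + V x * u x * \<psi> x + \<phi> x * u x * \<psi> x) = (LINT x|lebesgue. u x ^ 5 * \<psi> x)"
    and eq2: "\<And>\<psi>. test_function \<psi> \<Longrightarrow> (LINT x|lebesgue. G\<phi> x \<bullet> grad \<psi> x) = (LINT x|lebesgue. u x ^ 2 * \<psi> x)"
    using assms(9) unfolding weak_solution_def by blast
  have mu [measurable]: "u \<in> borel_measurable lebesgue" and mG: "G \<in> borel_measurable lebesgue"
    and m\<phi> [measurable]: "\<phi> \<in> borel_measurable lebesgue" and mH [measurable]: "H \<in> borel_measurable lebesgue"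
    using uLp G(2) \<phi>Lp H by (auto simp: Lp_def)
  have mGu [measurable]: "Gu \<in> borel_measurable lebesgue" and mG\<phi> [measurable]: "G\<phi> \<in> borel_measurable lebesgue"
    using Gu G\<phi> locally_integrable_measurable by (auto simp: has_weak_gradient_def)
  obtain u' where u' [measurable]: "u' \<in> borel_measurable borel" and u: "AE x in lborel. u x = u' x"
    using borel_version[OF mu] by blast
  obtain G' where G' [measurable]: "G' \<in> borel_measurable borel" and GG: "AE x in lborel. G x = G' x"
    using borel_version[OF mG] by blast
  obtain \<phi>' where \<phi>' [measurable]: "\<phi>' \<in> borel_measurable borel" and \<phi>: "AE x in lborel. \<phi> x = \<phi>' x"
    using borel_version[OF m\<phi>] by blast
  obtain H' where H' [measurable]: "H' \<in> borel_measurable borel" and HH: "AE x in lborel. H x = H' x"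
    using borel_version[OF mH] by blast
  obtain K where K: "K \<in> borel_measurable borel" and KK: "AE x in lborel. Gu x = K x"
    using borel_version[OF mGu] by blast
  obtain L where L: "L \<in> borel_measurable borel" and LL: "AE x in lborel. G\<phi> x = L x"
    using borel_version[OF mG\<phi>] by blast
  have tm: "\<psi> \<in> borel_measurable borel" "grad \<psi> \<in> borel_measurable borel" "\<psi> \<in> borel_measurable lebesgue" "grad \<psi> \<in> borel_measurable lebesgue"
    if "test_function \<psi>" for \<psi>
  proof -
    show a: "\<psi> \<in> borel_measurable borel" "grad \<psi> \<in> borel_measurable borel"
      using C1cD(2,3)[OF test_functionD(3)[OF that]] borel_measurable_continuous_onI by blast+
    then show "\<psi> \<in> borel_measurable lebesgue" "grad \<psi> \<in> borel_measurable lebesgue"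
      by (simp_all add: borel_imp_lebesgue)
  qed
  have Vb [measurable]: "V \<in> borel_measurable borel"
    using Ck_imp_continuous[OF assms(5)] by (rule borel_measurable_continuous_onI)
  have Vl [measurable]: "V \<in> borel_measurable lebesgue"
    using Vb by (rule borel_imp_lebesgue)
  have u'L2: "L2 u'" using Lp_borel_version[OF uLp u' u] by (simp add: L2_def)
  have G'L2: "L2 G'" using Lp_borel_version[OF G(2) G' GG] by (simp add: L2_def)
  have H'L2: "L2 H'" using Lp_borel_version[OF H H' HH] by (simp add: L2_def)
  have wu: "weak_gradient u' G'" by (rule has_weak_gradient_version[OF G(1) u' u G' GG])
  have "AE x in lborel. G' x = K x"
    by (rule weak_gradient_unique[OF wu has_weak_gradient_version[OF Gu u' u K KK]])
  \<comment> \<open>The gradient occurring in the equation is the square integrable one, since weak gradients are unique.\<close>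
  with KK have GuG: "AE x in lborel. Gu x = G' x" by eventually_elim simp
  interpret d12_function \<phi>' H' \<eta>
  proof
    show "integrable lborel (\<lambda>x. \<phi>' x ^ 6)" using Lp_borel_version[OF \<phi>Lp \<phi>' \<phi>] by (simp add: power_even_abs)
    have "(LINT x|lebesgue. norm (grad (\<eta> n) x - H x) ^ 2) = (LBINT x. (norm (grad (\<eta> n) x - H' x))\<^sup>2)" for n
    proof (rule integral_lebesgue_lborel(1))
      note [measurable] = tm[OF \<eta>[of n]]
      show "(\<lambda>x. norm (grad (\<eta> n) x - H x) ^ 2) \<in> borel_measurable lebesgue"
        "(\<lambda>x. (norm (grad (\<eta> n) x - H' x))\<^sup>2) \<in> borel_measurable borel" by measurable
      show "AE x in lborel. norm (grad (\<eta> n) x - H x) ^ 2 = (norm (grad (\<eta> n) x - H' x))\<^sup>2" using HH by eventually_elim simp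
    qed
    with lim2 show "tendsto_L2 (\<lambda>n. grad (\<eta> n)) H'"
      unfolding tendsto_L2_def using H'L2 test_function_L2(2)[OF \<eta>] by simp
    have "(LINT x|lebesgue. \<bar>\<eta> n x - \<phi> x\<bar> ^ 6) = (LBINT x. (\<eta> n x - \<phi>' x) ^ 6)" for n
    proof (rule integral_lebesgue_lborel(1))
      note [measurable] = tm[OF \<eta>[of n]]
      show "(\<lambda>x. \<bar>\<eta> n x - \<phi> x\<bar> ^ 6) \<in> borel_measurable lebesgue"
        "(\<lambda>x. (\<eta> n x - \<phi>' x) ^ 6) \<in> borel_measurable borel" by measurable
      show "AE x in lborel. \<bar>\<eta> n x - \<phi> x\<bar> ^ 6 = (\<eta> n x - \<phi>' x) ^ 6" using \<phi> by eventually_elim (simp add: power_even_abs)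
    qed
    with lim6 show "(\<lambda>n. LBINT x. (\<eta> n x - \<phi>' x) ^ 6) \<longlonglongrightarrow> 0" by simp
  qed (use \<eta> in auto)
  have "AE x in lborel. H' x = L x"
    by (rule weak_gradient_unique[OF \<phi>_weak_gradient has_weak_gradient_version[OF G\<phi> \<phi>' \<phi> L LL]])
  with LL have G\<phi>H: "AE x in lborel. G\<phi> x = H' x" by eventually_elim simp
  interpret schroedinger_poisson \<phi>' H' \<eta> V u' G' C1 C2 C3
  proof
    show "sobolev_pair u' G'" by (rule weak_gradient_imp_sobolev_pair[OF wu u'L2 G'L2])
    fix \<psi> assume t: "test_function \<psi>"
    note [measurable] = tm[OF t]
    have "(LINT x|lebesgue. Gu x \<bullet> grad \<psi> x + V x * u x * \<psi> x + \<phi> x * u x * \<psi> x) = (LBINT x. G' x \<bullet> grad \<psi> x + V x * u' x * \<psi> x + \<phi>' x * u' x * \<psi> x)"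
    proof (rule integral_lebesgue_lborel(1))
      show "AE x in lborel. Gu x \<bullet> grad \<psi> x + V x * u x * \<psi> x + \<phi> x * u x * \<psi> x = G' x \<bullet> grad \<psi> x + V x * u' x * \<psi> x + \<phi>' x * u' x * \<psi> x"
        using GuG u \<phi> by eventually_elim simp
    qed measurable
    moreover have "(LINT x|lebesgue. u x ^ 5 * \<psi> x) = (LBINT x. u' x ^ 5 * \<psi> x)"
    proof (rule integral_lebesgue_lborel(1))
      show "AE x in lborel. u x ^ 5 * \<psi> x = u' x ^ 5 * \<psi> x" using u by eventually_elim simp
    qed measurable
    ultimately show "(LBINT x. G' x \<bullet> grad \<psi> x + V x * u' x * \<psi> x + \<phi>' x * u' x * \<psi> x) = (LBINT x. u' x ^ 5 * \<psi> x)"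
      using eq1[OF t] by simp
    have "(LINT x|lebesgue. G\<phi> x \<bullet> grad \<psi> x) = (LBINT x. H' x \<bullet> grad \<psi> x)"
    proof (rule integral_lebesgue_lborel(1))
      show "AE x in lborel. G\<phi> x \<bullet> grad \<psi> x = H' x \<bullet> grad \<psi> x" using G\<phi>H by eventually_elim simp
    qed measurable
    moreover have "(LINT x|lebesgue. u x ^ 2 * \<psi> x) = (LBINT x. (u' x)\<^sup>2 * \<psi> x)"
    proof (rule integral_lebesgue_lborel(1))
      show "AE x in lborel. u x ^ 2 * \<psi> x = (u' x)\<^sup>2 * \<psi> x" using u by eventually_elim simp
    qed measurable
    ultimately show "(LBINT x. H' x \<bullet> grad \<psi> x) = (LBINT x. (u' x)\<^sup>2 * \<psi> x)"
      using eq2[OF t] by simp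
  qed (use assms in auto)
  have "AE x in lborel. u x = 0" using solution_vanishes(1) u by eventually_elim simp
  moreover have "AE x in lborel. \<phi> x = 0" using solution_vanishes(2) \<phi> by eventually_elim simp
  ultimately show ?thesis by (intro conjI AE_completion)
qed

end
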